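(* For each property $P$ among $A$, $ULA_\mu$, $ULA$, $MSP$, $ONL$, there exists a bounded geometry metric space that has $CE$ but does not have $P$. In particular, each of the properties $ULA_\mu$, $A$ and $MSP$ is strictly stronger than $CE$ (for bounded geometry metric spaces): it implies $CE$ and is not implied by $CE$.
   Context: A metric space $X$ has bounded geometry if for all $R>0$ there is $N_R\in\mathbb{N}$ with $|B(x;R)|\le N_R$ for all $x\in X$, where $B(x;R)=\{y\in X: d(x,y)\le R\}$. For $E\subseteq X$ and $R>0$: $N_R(E)=\{y\in X: d(y,E)\le R\}$ and $\partial_RE=N_R(E)\setminus E$. For a bounded geometry metric space $X$: $CE$: $X$ admits a coarse embedding into a Hilbert space, i.e. a map $f$ from $X$ to a Hilbert space $H$ for which there exist non-decreasing $\rho_\pm:[0,\infty)\to[0,\infty)$ with $\rho_-(t)\to\infty$ as $t\to\infty$ and $\rho_-(d(x,y))\le\|f(x)-f(y)\|\le\rho_+(d(x,y))$ for all $x,y\in X$. $A$ (property A): for all $R,\epsilon>0$ there exist $S>0$ and a map $x\mapsto\xi_x$ from $X$ to the set of probability measures on $X$ (viewed in $\ell^1(X)$) such that $\|\xi_x-\xi_y\|_1<\epsilon$ whenever $d(x,y)\le R$, and $\xi_x$ is supported in $B(x;S)$ for all $x$. $ULA_\mu$: for all $R,\epsilon>0$ there exists $S>0$ such that for all probability measures $\mu$ on $X$ there exists a finite set $E\subseteq X$ with $\mathrm{diam}(E)\le S$ and $\mu(\partial_RE)<\epsilon\,\mu(E)$. $ULA$: for all $R,\epsilon>0$ there exists $S>0$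 such that for all finite nonempty subsets $F$ of $X$ there exists a finite set $E\subseteq X$ with $\mathrm{diam}(E)\le S$ and $|\partial_RE\cap F|<\epsilon|E\cap F|$. $MSP$ (metric sparsification property): there exists $c>0$ such that for all $R>0$ there exists $S>0$ such that for every probability measure $\mu$ on $X$ there is $\Omega\subseteq X$ with a decomposition $\Omega=\bigsqcup_i\Omega_i$ such that $\mu(\Omega)\ge c$; $\mathrm{diam}(\Omega_i)\le S$ for all $i$; and $d(\Omega_i,\Omega_j)>R$ for all $i\ne j$. $ONL$ (operator norm localisation property): for a probability measure $\mu$ on $X$ and a nonzero separable Hilbert space $\mathcal{H}$, let $l^2(X,\mu,\mathcal{H})$ be the Hilbert space of functions $\phi:X\to\mathcal{H}$ with $\|\phi\|^2=\sum_{x\in X}\mu(x)\|\phi(x)\|_{\mathcal{H}}^2<\infty$, modulo functions of norm zero; the support of (the class of) $\phi$ is $\{x:\mu(x)>0,\ \phi(x)\neq 0\}$. A bounded operator $T$ on it is regarded as a matrix $(T_{x,y})$ of bounded operators on $\mathcal{H}$ (indexed by points of the support of $\mu$). For $R>0$, $\mathbb{C}_R[X;\mu,\mathcal{H}]$ is the set of bounded operators $T$ with $T_{x,y}=0$ whenever $d(x,y)>R$. $X$ has $ONL$ if there exists $c>0$ such that for every $R>0$ there exists $S>0$ such that for every such $\mu$, $\mathcal{H}$ and every $T\in\mathbb{C}_R[X;\mu,\mathcal{H}]$ there is a unit vector $\phi\in l^2(X,\mu,\mathcal{H})$ with $\mathrm{diam}(\mathrm{supp}(\phi))\le S$ and $\|T\phi\|\ge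 c\|T\|$. *)

theory Defs
  imports "HOL-Probability.Probability"
begin

section \<open>Metric notions\<close>

text \<open>
  Metric spaces are given by a carrier set and a distance function, as in the library locale
  \<^locale>\<open>Metric_space\<close>. Diameters and distances between sets take values in \<^typ>\<open>ennreal\<close>,
  so that the empty set has diameter \<open>0\<close> and infinite distance to every set.
\<close>

definition bounded_geometry :: "'a set \<Rightarrow> ('a \<Rightarrow> 'a \<Rightarrow> real) \<Rightarrow> bool" where
  "bounded_geometry X d \<longleftrightarrow> Metric_space X d \<and>
     (\<forall>R>0. \<exists>N::nat. \<forall>x\<in>X. finite (Metric_space.mcball X d x R) \<and>
                           card (Metric_space.mcball X d x R) \<le> N)"

definition set_diam :: "('a \<Rightarrow> 'a \<Rightarrow> real) \<Rightarrow> 'a set \<Rightarrow> ennreal" where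
  "set_diam d E = (SUP x\<in>E. SUP y\<in>E. ennreal (d x y))"

definition set_dist :: "('a \<Rightarrow> 'a \<Rightarrow> real) \<Rightarrow> 'a set \<Rightarrow> 'a set \<Rightarrow> ennreal" where
  "set_dist d E F = (INF x\<in>E. INF y\<in>F. ennreal (d x y))"

definition nbhd :: "'a set \<Rightarrow> ('a \<Rightarrow> 'a \<Rightarrow> real) \<Rightarrow> real \<Rightarrow> 'a set \<Rightarrow> 'a set" where
  "nbhd X d R E = {y\<in>X. set_dist d {y} E \<le> ennreal R}"

definition bdry :: "'a set \<Rightarrow> ('a \<Rightarrow> 'a \<Rightarrow> real) \<Rightarrow> real \<Rightarrow> 'a set \<Rightarrow> 'a set" where
  "bdry X d R E = nbhd X d R E - E"

section \<open>Complex Hilbert spaces with an explicit carrier\<close>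

text \<open>
  The properties below quantify over Hilbert spaces, which rules out the type class rendering.
\<close>

record 'h hilbert =
  vcarrier :: "'h set"
  vadd :: "'h \<Rightarrow> 'h \<Rightarrow> 'h"
  vzero :: 'h
  vscale :: "complex \<Rightarrow> 'h \<Rightarrow> 'h"
  vinner :: "'h \<Rightarrow> 'h \<Rightarrow> complex"

definition vnorm :: "'h hilbert \<Rightarrow> 'h \<Rightarrow> real" where
  "vnorm H x = sqrt (Re (vinner H x x))"

definition vdiff :: "'h hilbert \<Rightarrow> 'h \<Rightarrow> 'h \<Rightarrow> 'h" where
  "vdiff H x y = vadd H x (vscale H (- 1) y)"

locale hilbert_space =
  fixes H :: "'h hilbert"
  assumes add_closed: "\<lbrakk>x \<in> vcarrier H; y \<in> vcarrier H\<rbrakk> \<Longrightarrow> vadd H x y \<in> vcarrier H"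
    and zero_closed: "vzero H \<in> vcarrier H"
    and scale_closed: "x \<in> vcarrier H \<Longrightarrow> vscale H a x \<in> vcarrier H"
    and add_assoc: "\<lbrakk>x \<in> vcarrier H; y \<in> vcarrier H; z \<in> vcarrier H\<rbrakk>
      \<Longrightarrow> vadd H (vadd H x y) z = vadd H x (vadd H y z)"
    and add_commute: "\<lbrakk>x \<in> vcarrier H; y \<in> vcarrier H\<rbrakk> \<Longrightarrow> vadd H x y = vadd H y x"
    and add_zero: "x \<in> vcarrier H \<Longrightarrow> vadd H (vzero H) x = x"
    and add_inverse: "x \<in> vcarrier H \<Longrightarrow> \<exists>y\<in>vcarrier H. vadd H x y = vzero H"
    and scale_one: "x \<in> vcarrier H \<Longrightarrow> vscale H 1 x = x"
    and scale_scale: "x \<in> vcarrier H \<Longrightarrow> vscale H a (vscale H b x) = vscale H (a * b) x"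
    and scale_add_right: "\<lbrakk>x \<in> vcarrier H; y \<in> vcarrier H\<rbrakk>
      \<Longrightarrow> vscale H a (vadd H x y) = vadd H (vscale H a x) (vscale H a y)"
    and scale_add_left: "x \<in> vcarrier H
      \<Longrightarrow> vscale H (a + b) x = vadd H (vscale H a x) (vscale H b x)"
    and inner_add: "\<lbrakk>x \<in> vcarrier H; y \<in> vcarrier H; z \<in> vcarrier H\<rbrakk>
      \<Longrightarrow> vinner H (vadd H x y) z = vinner H x z + vinner H y z"
    and inner_scale: "\<lbrakk>x \<in> vcarrier H; y \<in> vcarrier H\<rbrakk>
      \<Longrightarrow> vinner H (vscale H a x) y = a * vinner H x y"
    and inner_cnj: "\<lbrakk>x \<in> vcarrier H; y \<in> vcarrier H\<rbrakk> \<Longrightarrow> vinner H y x = cnj (vinner H x y)"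
    and inner_nonneg: "x \<in> vcarrier H \<Longrightarrow> 0 \<le> Re (vinner H x x)"
    and inner_eq_zero: "\<lbrakk>x \<in> vcarrier H; vinner H x x = 0\<rbrakk> \<Longrightarrow> x = vzero H"
    and complete: "\<lbrakk>\<forall>n::nat. s n \<in> vcarrier H;
        \<forall>e>0. \<exists>N. \<forall>m\<ge>N. \<forall>n\<ge>N. vnorm H (vdiff H (s m) (s n)) < e\<rbrakk>
      \<Longrightarrow> \<exists>l\<in>vcarrier H. (\<lambda>n. vnorm H (vdiff H (s n) l)) \<longlonglongrightarrow> 0"

definition separable_hilbert :: "'h hilbert \<Rightarrow> bool" where
  "separable_hilbert H \<longleftrightarrow> hilbert_space H \<and>
     (\<exists>D. countable D \<and> D \<subseteq> vcarrier H \<and>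
        (\<forall>x\<in>vcarrier H. \<forall>e>0. \<exists>y\<in>D. vnorm H (vdiff H x y) < e))"

definition bounded_operator :: "'h hilbert \<Rightarrow> ('h \<Rightarrow> 'h) \<Rightarrow> bool" where
  "bounded_operator H T \<longleftrightarrow>
     (\<forall>x\<in>vcarrier H. T x \<in> vcarrier H) \<and>
     (\<forall>x\<in>vcarrier H. \<forall>y\<in>vcarrier H. T (vadd H x y) = vadd H (T x) (T y)) \<and>
     (\<forall>a. \<forall>x\<in>vcarrier H. T (vscale H a x) = vscale H a (T x)) \<and>
     (\<exists>K. \<forall>x\<in>vcarrier H. vnorm H (T x) \<le> K * vnorm H x)"

definition operator_norm :: "'h hilbert \<Rightarrow> ('h \<Rightarrow> 'h) \<Rightarrow> real" where
  "operator_norm H T = (SUP x\<in>{x\<in>vcarrier H. vnorm H x \<le> 1}. vnorm H (T x))"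

section \<open>Coarse embeddability\<close>

text \<open>
  The type \<^typ>\<open>nat \<Rightarrow> complex\<close> only bounds the size of the Hilbert spaces. A space of bounded
  geometry is countable, so the target of a coarse embedding may be cut down to the closed span
  of the image. This is separable, hence has at most the cardinality of the continuum and is
  isomorphic to a Hilbert space with carrier in this type.
\<close>

definition CE :: "'a set \<Rightarrow> ('a \<Rightarrow> 'a \<Rightarrow> real) \<Rightarrow> bool" where
  "CE X d \<longleftrightarrow>
     (\<exists>(H :: (nat \<Rightarrow> complex) hilbert) f (\<rho>\<^sub>1 :: real \<Rightarrow> real) (\<rho>\<^sub>2 :: real \<Rightarrow> real).
        hilbert_space H \<and> (\<forall>x\<in>X. f x \<in> vcarrier H) \<and>
        mono_on {0..} \<rho>\<^sub>1 \<and> (\<forall>t\<ge>0. 0 \<le> \<rho>\<^sub>1 t) \<and>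
        mono_on {0..} \<rho>\<^sub>2 \<and> (\<forall>t\<ge>0. 0 \<le> \<rho>\<^sub>2 t) \<and>
        filterlim \<rho>\<^sub>1 at_top at_top \<and>
        (\<forall>x\<in>X. \<forall>y\<in>X. \<rho>\<^sub>1 (d x y) \<le> vnorm H (vdiff H (f x) (f y)) \<and>
                       vnorm H (vdiff H (f x) (f y)) \<le> \<rho>\<^sub>2 (d x y)))"

section \<open>Amenability-type properties\<close>

text \<open>
  On a countable set every probability measure (defined on all subsets) is determined by its
  point masses; a probability measure on \<open>X\<close> is thus a \<open>pmf\<close> whose support lies in \<open>X\<close>.
\<close>

definition prob_measures :: "'a set \<Rightarrow> 'a pmf set" where
  "prob_measures X = {\<mu>. set_pmf \<mu> \<subseteq> X}"

definition property_A :: "'a set \<Rightarrow> ('a \<Rightarrow> 'a \<Rightarrow> real) \<Rightarrow> bool" where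
  "property_A X d \<longleftrightarrow>
     (\<forall>R>0. \<forall>\<epsilon>>0. \<exists>S>0. \<exists>\<xi> :: 'a \<Rightarrow> 'a pmf.
        (\<forall>x\<in>X. \<xi> x \<in> prob_measures X) \<and>
        (\<forall>x\<in>X. \<forall>y\<in>X. d x y \<le> R \<longrightarrow> (\<Sum>\<^sub>\<infinity>z\<in>X. \<bar>pmf (\<xi> x) z - pmf (\<xi> y) z\<bar>) < \<epsilon>) \<and>
        (\<forall>x\<in>X. set_pmf (\<xi> x) \<subseteq> Metric_space.mcball X d x S))"

definition ULA_mu :: "'a set \<Rightarrow> ('a \<Rightarrow> 'a \<Rightarrow> real) \<Rightarrow> bool" where
  "ULA_mu X d \<longleftrightarrow>
     (\<forall>R>0. \<forall>\<epsilon>>0. \<exists>S>0. \<forall>\<mu>\<in>prob_measures X. \<exists>E\<subseteq>X. finite E \<and>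
        set_diam d E \<le> ennreal S \<and>
        measure_pmf.prob \<mu> (bdry X d R E) < \<epsilon> * measure_pmf.prob \<mu> E)"

definition ULA :: "'a set \<Rightarrow> ('a \<Rightarrow> 'a \<Rightarrow> real) \<Rightarrow> bool" where
  "ULA X d \<longleftrightarrow>
     (\<forall>R>0. \<forall>\<epsilon>>0. \<exists>S>0. \<forall>F\<subseteq>X. finite F \<and> F \<noteq> {} \<longrightarrow> (\<exists>E\<subseteq>X. finite E \<and>
        set_diam d E \<le> ennreal S \<and>
        real (card (bdry X d R E \<inter> F)) < \<epsilon> * real (card (E \<inter> F))))"

definition MSP :: "'a set \<Rightarrow> ('a \<Rightarrow> 'a \<Rightarrow> real) \<Rightarrow> bool" where
  "MSP X d \<longleftrightarrow>
     (\<exists>c>0. \<forall>R>0. \<exists>S>0. \<forall>\<mu>\<in>prob_measures X. \<exists>\<Omega>\<subseteq>X. \<exists>\<P>. partition_on \<Omega> \<P> \<and>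
        measure_pmf.prob \<mu> \<Omega> \<ge> c \<and>
        (\<forall>A\<in>\<P>. set_diam d A \<le> ennreal S) \<and>
        (\<forall>A\<in>\<P>. \<forall>B\<in>\<P>. A \<noteq> B \<longrightarrow> set_dist d A B > ennreal R))"

section \<open>Operator norm localisation\<close>

text \<open>
  A class of functions modulo functions of norm zero is represented by its unique member that
  vanishes off the support of \<open>\<mu>\<close>.
\<close>

definition l2_space :: "'a set \<Rightarrow> 'a pmf \<Rightarrow> 'h hilbert \<Rightarrow> ('a \<Rightarrow> 'h) hilbert" where
  "l2_space X \<mu> H = \<lparr>
     vcarrier = {\<phi>. (\<forall>x\<in>set_pmf \<mu>. \<phi> x \<in> vcarrier H) \<and> (\<forall>x. x \<notin> set_pmf \<mu> \<longrightarrow> \<phi> x = vzero H) \<and>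
                    (\<lambda>x. pmf \<mu> x * (vnorm H (\<phi> x))\<^sup>2) summable_on X},
     vadd = (\<lambda>\<phi> \<psi> x. vadd H (\<phi> x) (\<psi> x)),
     vzero = (\<lambda>x. vzero H),
     vscale = (\<lambda>a \<phi> x. vscale H a (\<phi> x)),
     vinner = (\<lambda>\<phi> \<psi>. \<Sum>\<^sub>\<infinity>x\<in>X. complex_of_real (pmf \<mu> x) * vinner H (\<phi> x) (\<psi> x)) \<rparr>"

definition l2_supp :: "'a pmf \<Rightarrow> 'h hilbert \<Rightarrow> ('a \<Rightarrow> 'h) \<Rightarrow> 'a set" where
  "l2_supp \<mu> H \<phi> = {x. pmf \<mu> x > 0 \<and> \<phi> x \<noteq> vzero H}"

definition matrix_entry ::
  "'h hilbert \<Rightarrow> (('a \<Rightarrow> 'h) \<Rightarrow> 'a \<Rightarrow> 'h) \<Rightarrow> 'a \<Rightarrow> 'a \<Rightarrow> 'h \<Rightarrow> 'h" where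
  "matrix_entry H T x y h = T (\<lambda>z. if z = y then h else vzero H) x"

definition finite_prop_ops ::
  "real \<Rightarrow> 'a set \<Rightarrow> ('a \<Rightarrow> 'a \<Rightarrow> real) \<Rightarrow> 'a pmf \<Rightarrow> 'h hilbert \<Rightarrow> (('a \<Rightarrow> 'h) \<Rightarrow> 'a \<Rightarrow> 'h) set" where
  "finite_prop_ops R X d \<mu> H = {T. bounded_operator (l2_space X \<mu> H) T \<and>
     (\<forall>x\<in>set_pmf \<mu>. \<forall>y\<in>set_pmf \<mu>. d x y > R \<longrightarrow>
        (\<forall>h\<in>vcarrier H. matrix_entry H T x y h = vzero H))}"

text \<open>
  Every separable Hilbert space is isomorphic to one with carrier in \<^typ>\<open>nat \<Rightarrow> complex\<close>.
\<close>

definition ONL :: "'a set \<Rightarrow> ('a \<Rightarrow> 'a \<Rightarrow> real) \<Rightarrow> bool" where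
  "ONL X d \<longleftrightarrow>
     (\<exists>c>0. \<forall>R>0. \<exists>S>0. \<forall>\<mu>\<in>prob_measures X. \<forall>H :: (nat \<Rightarrow> complex) hilbert.
        separable_hilbert H \<and> vcarrier H \<noteq> {vzero H} \<longrightarrow>
        (\<forall>T\<in>finite_prop_ops R X d \<mu> H. \<exists>\<phi>\<in>vcarrier (l2_space X \<mu> H).
           vnorm (l2_space X \<mu> H) \<phi> = 1 \<and>
           set_diam d (l2_supp \<mu> H \<phi>) \<le> ennreal S \<and>
           vnorm (l2_space X \<mu> H) (T \<phi>) \<ge> c * operator_norm (l2_space X \<mu> H) T))"

end

theory Submission
  imports Defs "HOL-Library.Nat_Bijection"
begin

text \<open>
  \<open>ULA_mu\<close> implies \<open>MSP\<close> by greedily removing neighbourhoods of almost invariant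
  sets. Under \<open>MSP\<close>, each probability measure has a separated family of bounded sets, and the sum of the
  bump functions around its members is a positive definite kernel of bounded width, slowly varying, equal to \<open>1\<close> on
  the diagonal over a set of measure at least \<open>c\<close>. Such kernels form a compact convex set, so a minimax
  argument yields a single kernel whose diagonal is everywhere at least \<open>c\<close>; the direct sum of the
  feature maps for scales \<open>2^n\<close> is a coarse embedding. Property A supplies kernels directly, through
  the square roots of its measures.

  The space without these properties is a disjoint union of \<open>Z/2\<close>-homology covers of cubic
  graphs of growing girth (Arzhantseva, Guentner and Spakula). A point of the cover is the set of edges that a walk from a
  base vertex crosses an odd number of times, and we take as metric the cardinality of symmetric differences,
  which embeds isometrically into squared Hilbert distance. A difference of at most girth many edges is a
  reduced path, so balls look like balls of the cubic tree. Localised functions therefore see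
  the spectral gap of the tree, while constants have none.
\<close>

section \<open>The Hilbert space of square-summable sequences\<close>

text \<open>All numerical gaps come from 8 < 9: on functions supported within the tree range the
  adjacency operator has norm at most 2 sqrt 2, while constants have eigenvalue 3. One use of this
  gap refutes \<open>ULA\<close> and \<open>property_A\<close>, where the tolerance \<epsilon> may
  be prescribed. In \<open>MSP\<close> and \<open>ONL\<close> the constant \<open>c\<close> is
  existential and precedes \<open>R\<close>, so a single factor decides nothing; the gap is iterated
  \<open>k\<close> times, with \<open>R\<close> growing with \<open>k\<close>, and the cover is
  taken so large that all \<open>k\<close> steps stay in the tree range. \<open>ULA_mu\<close> fails
  because it implies \<open>MSP\<close>. For the implication from \<open>MSP\<close>, the obstacle
  is that the separated family depends on the measure. Passing to kernels makes the choice convex. A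
  diagonal merely bounded below by \<open>c\<close> is enough: points too far apart for a kernel
  have squared feature distance at least 2c at its scale, and this adds up over infinitely many
  scales.\<close>

definition ell2 :: "(nat \<Rightarrow> complex) hilbert" where
  "ell2 = \<lparr> vcarrier = {f. summable (\<lambda>k. (cmod (f k))\<^sup>2)},
     vadd = (\<lambda>f g k. f k + g k), vzero = (\<lambda>k. 0), vscale = (\<lambda>a f k. a * f k),
     vinner = (\<lambda>f g. \<Sum>k. f k * cnj (g k)) \<rparr>"

lemma square_norm_add_le: "(cmod (a + b))\<^sup>2 \<le> 2 * (cmod a)\<^sup>2 + 2 * (cmod b)\<^sup>2"
proof -
  have "(cmod (a + b))\<^sup>2 \<le> (cmod a + cmod b)\<^sup>2"
    by (intro power_mono norm_triangle_ineq) auto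
  also have "\<dots> \<le> 2 * (cmod a)\<^sup>2 + 2 * (cmod b)\<^sup>2"
    using sum_squares_bound[of "cmod a" "cmod b"] by (simp add: power2_sum)
  finally show ?thesis .
qed

lemma ell2_add:
  assumes "summable (\<lambda>k. (cmod (f k))\<^sup>2)" "summable (\<lambda>k. (cmod (g k))\<^sup>2)"
  shows "summable (\<lambda>k. (cmod (f k + g k))\<^sup>2)"
  by (rule summable_comparison_test'[where N = 0 and g = "\<lambda>k. 2 * (cmod (f k))\<^sup>2 + 2 * (cmod (g k))\<^sup>2"])
     (use assms square_norm_add_le in \<open>auto intro!: summable_add summable_mult\<close>)

lemma ell2_inner:
  assumes "summable (\<lambda>k. (cmod (f k))\<^sup>2)" "summable (\<lambda>k. (cmod (g k))\<^sup>2)"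
  shows "summable (\<lambda>k. f k * cnj (g k))"
proof (rule summable_norm_cancel, rule summable_comparison_test'[where N = 0])
  show "summable (\<lambda>k. (cmod (f k))\<^sup>2 + (cmod (g k))\<^sup>2)"
    using assms by (intro summable_add)
next
  fix k
  have "2 * (cmod (f k) * cmod (g k)) \<le> (cmod (f k))\<^sup>2 + (cmod (g k))\<^sup>2"
    using sum_squares_bound[of "cmod (f k)" "cmod (g k)"] by (simp add: mult.assoc)
  moreover have "0 \<le> cmod (f k) * cmod (g k)" by simp
  ultimately have "cmod (f k) * cmod (g k) \<le> (cmod (f k))\<^sup>2 + (cmod (g k))\<^sup>2" by linarith
  then show "norm (norm (f k * cnj (g k))) \<le> (cmod (f k))\<^sup>2 + (cmod (g k))\<^sup>2"
    by (simp add: norm_mult)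
qed

lemma mult_cnj_square: "z * cnj z = of_real ((cmod z)\<^sup>2)"
  by (metis complex_norm_square)

lemma vinner_ell2_self:
  assumes "summable (\<lambda>k. (cmod (f k))\<^sup>2)"
  shows "vinner ell2 f f = complex_of_real (\<Sum>k. (cmod (f k))\<^sup>2)"
  unfolding suminf_of_real[OF assms] by (simp only: ell2_def hilbert.simps mult_cnj_square)

lemma vnorm_ell2:
  assumes "summable (\<lambda>k. (cmod (f k))\<^sup>2)"
  shows "vnorm ell2 f = sqrt (\<Sum>k. (cmod (f k))\<^sup>2)"
  by (simp only: vnorm_def vinner_ell2_self[OF assms] Re_complex_of_real)

lemma vdiff_ell2: "vdiff ell2 f g = (\<lambda>k. f k - g k)"
  by (simp add: vdiff_def ell2_def)

lemma ell2_diff: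
  assumes "summable (\<lambda>k. (cmod (f k))\<^sup>2)" "summable (\<lambda>k. (cmod (g k))\<^sup>2)"
  shows "summable (\<lambda>k. (cmod (f k - g k))\<^sup>2)"
  using ell2_add[of f "\<lambda>k. - g k"] assms by simp

text \<open>Each coordinate is Cauchy. The bounds on finite partial sums pass to the pointwise
  limit, which yields both its square-summability and the convergence in norm.\<close>

lemma ell2_complete:
  fixes s :: "nat \<Rightarrow> nat \<Rightarrow> complex"
  assumes s: "\<And>n. summable (\<lambda>k. (cmod (s n k))\<^sup>2)"
    and cauchy: "\<And>e. e > 0 \<Longrightarrow> \<exists>N. \<forall>m\<ge>N. \<forall>n\<ge>N. sqrt (\<Sum>k. (cmod (s m k - s n k))\<^sup>2) < e"
  shows "\<exists>l. summable (\<lambda>k. (cmod (l k))\<^sup>2) \<and>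
             (\<lambda>n. sqrt (\<Sum>k. (cmod (s n k - l k))\<^sup>2)) \<longlonglongrightarrow> 0"
proof -
  have partial: "(\<Sum>k<K. (cmod (s m k - s n k))\<^sup>2) \<le> e\<^sup>2"
    if "sqrt (\<Sum>k. (cmod (s m k - s n k))\<^sup>2) < e" for m n K e
  proof -
    have "(\<Sum>k<K. (cmod (s m k - s n k))\<^sup>2) \<le> (\<Sum>k. (cmod (s m k - s n k))\<^sup>2)"
      using ell2_diff[OF s s] by (intro sum_le_suminf) auto
    also have "\<dots> \<le> e\<^sup>2"
      using that by (metis less_imp_le sqrt_le_D)
    finally show ?thesis .
  qed
  have "Cauchy (\<lambda>n. s n k)" for k
  proof (rule metric_CauchyI)
    fix e :: real assume "e > 0"
    from cauchy[OF this] obtain N where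
      N: "\<And>m n. m \<ge> N \<Longrightarrow> n \<ge> N \<Longrightarrow> sqrt (\<Sum>k. (cmod (s m k - s n k))\<^sup>2) < e" by blast
    have "dist (s m k) (s n k) < e" if "m \<ge> N" "n \<ge> N" for m n
    proof -
      have "(cmod (s m k - s n k))\<^sup>2 \<le> (\<Sum>k. (cmod (s m k - s n k))\<^sup>2)"
        using ell2_diff[OF s s] sum_le_suminf[of "\<lambda>k. (cmod (s m k - s n k))\<^sup>2" "{k}"] by simp
      then have "cmod (s m k - s n k) \<le> sqrt (\<Sum>k. (cmod (s m k - s n k))\<^sup>2)"
        by (rule real_le_rsqrt)
      then show ?thesis using N[OF that] by (simp add: dist_norm)
    qed
    then show "\<exists>M. \<forall>m\<ge>M. \<forall>n\<ge>M. dist (s m k) (s n k) < e" by blast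
  qed
  then have "(\<lambda>n. s n k) \<longlonglongrightarrow> lim (\<lambda>n. s n k)" for k
    by (simp add: Cauchy_convergent convergent_LIMSEQ_iff[symmetric])
  then obtain l where l: "\<And>k. (\<lambda>n. s n k) \<longlonglongrightarrow> l k" ..
  have limit: "summable (\<lambda>k. (cmod (s m k - l k))\<^sup>2) \<and> (\<Sum>k. (cmod (s m k - l k))\<^sup>2) \<le> e\<^sup>2"
    if N: "\<forall>m\<ge>N. \<forall>n\<ge>N. sqrt (\<Sum>k. (cmod (s m k - s n k))\<^sup>2) < e" and "m \<ge> N" for e N m
  proof -
    have le: "(\<Sum>k<K. (cmod (s m k - l k))\<^sup>2) \<le> e\<^sup>2" for K
    proof (rule LIMSEQ_le_const2)
      show "(\<lambda>n. \<Sum>k<K. (cmod (s m k - s n k))\<^sup>2) \<longlonglongrightarrow> (\<Sum>k<K. (cmod (s m k - l k))\<^sup>2)"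
        by (intro tendsto_intros l)
      show "\<exists>N. \<forall>n\<ge>N. (\<Sum>k<K. (cmod (s m k - s n k))\<^sup>2) \<le> e\<^sup>2"
        using that partial by blast
    qed
    then have "summable (\<lambda>k. (cmod (s m k - l k))\<^sup>2)"
      by (intro summableI_nonneg_bounded[where x = "e\<^sup>2"]) auto
    with le show ?thesis by (auto intro: suminf_le_const)
  qed
  have summ: "summable (\<lambda>k. (cmod (l k))\<^sup>2)"
  proof -
    obtain N where "\<forall>m\<ge>N. \<forall>n\<ge>N. sqrt (\<Sum>k. (cmod (s m k - s n k))\<^sup>2) < 1"
      using cauchy[of 1] by auto
    then have "summable (\<lambda>k. (cmod (s N k - l k))\<^sup>2)"
      using limit by blast
    from ell2_diff[OF s[of N] this] show ?thesis by simp
  qed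
  moreover have "(\<lambda>n. sqrt (\<Sum>k. (cmod (s n k - l k))\<^sup>2)) \<longlonglongrightarrow> 0"
  proof (rule LIMSEQ_I)
    fix r :: real assume "r > 0"
    then obtain N where N: "\<forall>m\<ge>N. \<forall>n\<ge>N. sqrt (\<Sum>k. (cmod (s m k - s n k))\<^sup>2) < r / 2"
      using cauchy[of "r / 2"] by auto
    have "norm (sqrt (\<Sum>k. (cmod (s n k - l k))\<^sup>2) - 0) < r" if "n \<ge> N" for n
    proof -
      from limit[OF N that] have *: "(\<Sum>k. (cmod (s n k - l k))\<^sup>2) \<le> (r / 2)\<^sup>2" by simp
      have "0 \<le> (\<Sum>k. (cmod (s n k - l k))\<^sup>2)"
        using ell2_diff[OF s summ] by (intro suminf_nonneg) auto
      moreover from * have "sqrt (\<Sum>k. (cmod (s n k - l k))\<^sup>2) \<le> r / 2"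
        using \<open>r > 0\<close> by (intro real_le_lsqrt) auto
      ultimately show ?thesis using \<open>r > 0\<close> by simp
    qed
    then show "\<exists>no. \<forall>n\<ge>no. norm (sqrt (\<Sum>k. (cmod (s n k - l k))\<^sup>2) - 0) < r" by blast
  qed
  ultimately show ?thesis by blast
qed

lemma hilbert_space_ell2: "hilbert_space ell2"
proof
  fix x y z :: "nat \<Rightarrow> complex" and a b :: complex
  show "x \<in> vcarrier ell2 \<Longrightarrow> y \<in> vcarrier ell2 \<Longrightarrow> vadd ell2 x y \<in> vcarrier ell2"
    by (auto simp: ell2_def intro: ell2_add)
  show "vzero ell2 \<in> vcarrier ell2" by (simp add: ell2_def)
  show "vscale ell2 a x \<in> vcarrier ell2" if "x \<in> vcarrier ell2"
    using that by (auto simp: ell2_def norm_mult power_mult_distrib intro: summable_mult)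
  show "vadd ell2 (vadd ell2 x y) z = vadd ell2 x (vadd ell2 y z)"
    by (simp add: ell2_def add.assoc)
  show "vadd ell2 x y = vadd ell2 y x" by (simp add: ell2_def add.commute)
  show "vadd ell2 (vzero ell2) x = x" by (simp add: ell2_def)
  show "\<exists>y\<in>vcarrier ell2. vadd ell2 x y = vzero ell2" if "x \<in> vcarrier ell2"
    using that by (intro bexI[of _ "\<lambda>k. - x k"]) (auto simp: ell2_def)
  show "vscale ell2 1 x = x" by (simp add: ell2_def)
  show "vscale ell2 a (vscale ell2 b x) = vscale ell2 (a * b) x"
    by (simp add: ell2_def mult.assoc)
  show "vscale ell2 a (vadd ell2 x y) = vadd ell2 (vscale ell2 a x) (vscale ell2 a y)"
    by (simp add: ell2_def algebra_simps)
  show "vscale ell2 (a + b) x = vadd ell2 (vscale ell2 a x) (vscale ell2 b x)"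
    by (simp add: ell2_def algebra_simps)
  show "vinner ell2 (vadd ell2 x y) z = vinner ell2 x z + vinner ell2 y z"
    if "x \<in> vcarrier ell2" "y \<in> vcarrier ell2" "z \<in> vcarrier ell2"
    using that by (simp add: ell2_def algebra_simps suminf_add[symmetric] ell2_inner)
  show "vinner ell2 (vscale ell2 a x) y = a * vinner ell2 x y"
    if "x \<in> vcarrier ell2" "y \<in> vcarrier ell2"
    using that by (simp add: ell2_def mult.assoc suminf_mult ell2_inner)
  show "vinner ell2 y x = cnj (vinner ell2 x y)"
    if "x \<in> vcarrier ell2" "y \<in> vcarrier ell2"
  proof -
    have "(\<lambda>k. x k * cnj (y k)) sums (\<Sum>k. x k * cnj (y k))"
      using that by (auto simp: ell2_def intro: summable_sums ell2_inner)
    then have "(\<lambda>k. cnj (x k * cnj (y k))) sums cnj (\<Sum>k. x k * cnj (y k))"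
      using sums_cnj by fastforce
    then show ?thesis by (auto simp: ell2_def sums_iff mult.commute)
  qed
  show "0 \<le> Re (vinner ell2 x x)" if "x \<in> vcarrier ell2"
  proof -
    have "summable (\<lambda>k. (cmod (x k))\<^sup>2)" using that by (simp add: ell2_def)
    from vinner_ell2_self[OF this] suminf_nonneg[OF this] show ?thesis by simp
  qed
  show "x = vzero ell2" if "x \<in> vcarrier ell2" "vinner ell2 x x = 0"
  proof -
    have s: "summable (\<lambda>k. (cmod (x k))\<^sup>2)" using that by (simp add: ell2_def)
    from vinner_ell2_self[OF s] that(2) have "(\<Sum>k. (cmod (x k))\<^sup>2) = 0" by simp
    with suminf_eq_zero_iff[OF s] show ?thesis by (auto simp: ell2_def)
  qed
next
  fix s :: "nat \<Rightarrow> nat \<Rightarrow> complex"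
  assume s: "\<forall>n. s n \<in> vcarrier ell2"
    and c: "\<forall>e>0. \<exists>N. \<forall>m\<ge>N. \<forall>n\<ge>N. vnorm ell2 (vdiff ell2 (s m) (s n)) < e"
  from s have s': "summable (\<lambda>k. (cmod (s n k))\<^sup>2)" for n by (simp add: ell2_def)
  from c have "\<exists>N. \<forall>m\<ge>N. \<forall>n\<ge>N. sqrt (\<Sum>k. (cmod (s m k - s n k))\<^sup>2) < e" if "e > 0" for e
    using that by (simp add: vdiff_ell2 vnorm_ell2 ell2_diff s')
  from ell2_complete[OF s' this] obtain l where
    "summable (\<lambda>k. (cmod (l k))\<^sup>2)" "(\<lambda>n. sqrt (\<Sum>k. (cmod (s n k - l k))\<^sup>2)) \<longlonglongrightarrow> 0" by blast
  then show "\<exists>l\<in>vcarrier ell2. (\<lambda>n. vnorm ell2 (vdiff ell2 (s n) l)) \<longlonglongrightarrow> 0"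
    by (intro bexI[of _ l]) (simp_all add: vdiff_ell2 vnorm_ell2 ell2_diff s', simp add: ell2_def)
qed

text \<open>Only differences of the \<open>g x\<close> have to be square-summable; subtracting a
  base point \<open>x0\<close> moves the maps into \<open>ell2\<close> without changing differences.
  The control functions bound squared distances, hence the square roots in the proof.\<close>

lemma CE_coordinates:
  fixes g :: "'a \<Rightarrow> nat \<Rightarrow> real"
  assumes summ: "\<And>x y. x \<in> X \<Longrightarrow> y \<in> X \<Longrightarrow> summable (\<lambda>k. (g x k - g y k)\<^sup>2)"
    and bounds: "\<And>x y. x \<in> X \<Longrightarrow> y \<in> X \<Longrightarrow> \<rho>\<^sub>1 (d x y) \<le> (\<Sum>k. (g x k - g y k)\<^sup>2)"
      "\<And>x y. x \<in> X \<Longrightarrow> y \<in> X \<Longrightarrow> (\<Sum>k. (g x k - g y k)\<^sup>2) \<le> \<rho>\<^sub>2 (d x y)"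
    and mono: "mono_on {0..} \<rho>\<^sub>1" "mono_on {0..} \<rho>\<^sub>2"
    and nonneg: "\<And>t. t \<ge> 0 \<Longrightarrow> 0 \<le> \<rho>\<^sub>1 t" "\<And>t. t \<ge> 0 \<Longrightarrow> 0 \<le> \<rho>\<^sub>2 t"
    and lim: "filterlim \<rho>\<^sub>1 at_top at_top"
  shows "CE X d"
proof -
  define x0 where "x0 = (SOME x. x \<in> X)"
  have x0: "x0 \<in> X" if "x \<in> X" for x using that unfolding x0_def by (rule someI)
  define f where "f x = (\<lambda>k. complex_of_real (g x k - g x0 k))" for x
  have f: "summable (\<lambda>k. (cmod (f x k))\<^sup>2)" if "x \<in> X" for x
    using summ[OF that x0[OF that]] by (simp add: f_def flip: of_real_diff)
  have norm: "vnorm ell2 (vdiff ell2 (f x) (f y)) = sqrt (\<Sum>k. (g x k - g y k)\<^sup>2)"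
    if "x \<in> X" "y \<in> X" for x y
  proof -
    have "cmod (f x k - f y k) = \<bar>g x k - g y k\<bar>" for k
      by (simp add: f_def flip: of_real_diff)
    moreover have "summable (\<lambda>k. (cmod (f x k - f y k))\<^sup>2)"
      using that f by (intro ell2_diff)
    ultimately show ?thesis by (simp add: vdiff_ell2 vnorm_ell2)
  qed
  show ?thesis unfolding CE_def
  proof (intro exI conjI ballI)
    show "hilbert_space ell2" by (rule hilbert_space_ell2)
    show "f x \<in> vcarrier ell2" if "x \<in> X" for x using f[OF that] by (simp add: ell2_def)
    show "mono_on {0..} (\<lambda>t. sqrt (\<rho>\<^sub>1 t))" "mono_on {0..} (\<lambda>t. sqrt (\<rho>\<^sub>2 t))"
      using mono by (auto simp: mono_on_def)
    show "\<forall>t\<ge>0. 0 \<le> sqrt (\<rho>\<^sub>1 t)" "\<forall>t\<ge>0. 0 \<le> sqrt (\<rho>\<^sub>2 t)"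
      using nonneg by auto
    show "filterlim (\<lambda>t. sqrt (\<rho>\<^sub>1 t)) at_top at_top"
      by (rule filterlim_compose[OF sqrt_at_top lim])
  next
    fix x y assume "x \<in> X" "y \<in> X"
    then show "sqrt (\<rho>\<^sub>1 (d x y)) \<le> vnorm ell2 (vdiff ell2 (f x) (f y))"
      and "vnorm ell2 (vdiff ell2 (f x) (f y)) \<le> sqrt (\<rho>\<^sub>2 (d x y))"
      using bounds norm by auto
  qed
qed

section \<open>Positive semidefinite kernels and their feature coordinates\<close>

definition psd :: "'a set \<Rightarrow> ('a \<Rightarrow> 'a \<Rightarrow> real) \<Rightarrow> bool" where
  "psd X K \<longleftrightarrow> (\<forall>x\<in>X. \<forall>y\<in>X. K x y = K y x) \<and>
     (\<forall>m (x :: nat \<Rightarrow> 'a) (c :: nat \<Rightarrow> real). (\<forall>i<m. x i \<in> X) \<longrightarrow>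
        0 \<le> (\<Sum>i<m. \<Sum>j<m. c i * c j * K (x i) (x j)))"

lemma psd_sym: "psd X K \<Longrightarrow> x \<in> X \<Longrightarrow> y \<in> X \<Longrightarrow> K x y = K y x"
  by (simp add: psd_def)

lemma psdD: "psd X K \<Longrightarrow> (\<And>i. i < m \<Longrightarrow> x i \<in> X) \<Longrightarrow>
   0 \<le> (\<Sum>i<(m::nat). \<Sum>j<m. c i * c j * K (x i) (x j))"
  by (simp add: psd_def)

lemma psd_diag:
  assumes "psd X K" "x \<in> X" shows "0 \<le> K x x"
  using psdD[OF assms(1), of 1 "\<lambda>_. x" "\<lambda>_. 1"] assms(2) by simp

lemma psd_pair:
  assumes "psd X K" "x \<in> X" "y \<in> X"
  shows "0 \<le> a\<^sup>2 * K x x + 2 * (a * b) * K x y + b\<^sup>2 * K y y"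
  using psdD[OF assms(1), of 2 "\<lambda>i. if i = 0 then x else y" "\<lambda>i. if i = 0 then a else b"]
    assms(2,3) psd_sym[OF assms]
  by (simp add: numeral_2_eq_2 power2_eq_square algebra_simps)

lemma psd_dist_nonneg:
  assumes "psd X K" "x \<in> X" "y \<in> X"
  shows "0 \<le> K x x + K y y - 2 * K x y"
  using psd_pair[OF assms, of 1 "-1"] by simp

lemma psd_zero_diag:
  assumes "psd X K" "x \<in> X" "y \<in> X" "K x x = 0"
  shows "K x y = 0"
proof (rule ccontr)
  assume ne: "K x y \<noteq> 0"
  \<comment> \<open>This makes the linear term \<open>- (K y y + 1)\<close>, and there is no
    quadratic term because \<open>K x x = 0\<close>; the form would take the value -1.\<close>
  define a where "a = - (K y y + 1) / (2 * K x y)"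
  have "2 * a * K x y = - (K y y + 1)" using ne by (simp add: a_def field_simps)
  with psd_pair[OF assms(1-3), of a 1] assms(4) show False by simp
qed

text \<open>The diagonal entry may vanish; then so does the whole row, and division by zero
  makes the Schur complement equal to the kernel itself.\<close>

definition schur :: "'a \<Rightarrow> ('a \<Rightarrow> 'a \<Rightarrow> real) \<Rightarrow> 'a \<Rightarrow> 'a \<Rightarrow> real" where
  "schur p K = (\<lambda>x y. K x y - K x p * K p y / K p p)"

text \<open>When \<open>K p p\<close> is nonzero, the form of the complement is the minimum of the
  form of \<open>K\<close> over the coefficient of one added test point \<open>p\<close>.\<close>

lemma psd_schur:
  assumes K: "psd X K" and p: "p \<in> X"
  shows "psd X (schur p K)"
  unfolding psd_def
proof (intro conjI ballI allI impI)
  fix x y assume "x \<in> X" "y \<in> X"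
  then show "schur p K x y = schur p K y x"
    using psd_sym[OF K] p by (simp add: schur_def)
next
  fix m and x :: "nat \<Rightarrow> 'a" and c :: "nat \<Rightarrow> real"
  assume x: "\<forall>i<m. x i \<in> X"
  show "0 \<le> (\<Sum>i<m. \<Sum>j<m. c i * c j * schur p K (x i) (x j))"
  proof (cases "K p p = 0")
    case True
    then have "schur p K = K" by (simp add: schur_def fun_eq_iff)
    with psdD[OF K, of m x c] x show ?thesis by simp
  next
    case False
    define b where "b = (\<Sum>i<m. c i * K (x i) p)"
    \<comment> \<open>The minimiser of the quadratic polynomial in the coefficient of
      \<open>p\<close>.\<close>
    define t where "t = - b / K p p"
    define x' where "x' i = (if i < m then x i else p)" for i
    define c' where "c' i = (if i < m then c i else t)" for i
    have b': "(\<Sum>i<m. c i * K p (x i)) = b"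
      unfolding b_def using psd_sym[OF K] x p by (intro sum.cong) auto
    have "0 \<le> (\<Sum>i<Suc m. \<Sum>j<Suc m. c' i * c' j * K (x' i) (x' j))"
      by (rule psdD[OF K]) (use x p in \<open>auto simp: x'_def\<close>)
    also have "\<dots> = (\<Sum>i<m. \<Sum>j<m. c i * c j * K (x i) (x j)) + (\<Sum>i<m. c i * t * K (x i) p)
                 + ((\<Sum>j<m. t * c j * K p (x j)) + t * t * K p p)"
      by (simp add: sum.distrib x'_def c'_def)
    also have "(\<Sum>i<m. c i * t * K (x i) p) = t * b"
      by (simp add: b_def sum_distrib_left algebra_simps)
    also have "(\<Sum>j<m. t * c j * K p (x j)) = t * b"
      by (simp add: b'[symmetric] sum_distrib_left algebra_simps)
    also have "(\<Sum>i<m. \<Sum>j<m. c i * c j * K (x i) (x j)) + t * b + (t * b + t * t * K p p)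
        = (\<Sum>i<m. \<Sum>j<m. c i * c j * K (x i) (x j)) - b * b / K p p"
      using False by (simp add: t_def field_simps)
    also have "b * b / K p p = (\<Sum>i<m. \<Sum>j<m. c i * c j * (K (x i) p * K p (x j) / K p p))"
    proof -
      have "b * b = (\<Sum>i<m. \<Sum>j<m. c i * K (x i) p * (c j * K p (x j)))"
        using sum_product[of "\<lambda>i. c i * K (x i) p" "{..<m}" "\<lambda>j. c j * K p (x j)" "{..<m}"]
        unfolding b' b_def[symmetric] .
      then show ?thesis by (simp add: sum_divide_distrib algebra_simps)
    qed
    finally show ?thesis
      by (simp add: schur_def right_diff_distrib sum_subtractf)
  qed
qed

lemma schur_zero:
  assumes K: "psd X K" and p: "p \<in> X" and y: "y \<in> X"
  shows "schur p K p y = 0"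
  using psd_zero_diag[OF K p y] by (auto simp: schur_def)

text \<open>Infinite Cholesky factorisation: step \<open>n\<close> eliminates row and column
  \<open>n\<close>, so \<open>L n\<close> vanishes in all rows and columns below \<open>n\<close>,
  and the eliminated rank one parts are given by the columns of a triangular matrix
  \<open>a\<close>. Triangularity keeps every sum finite.\<close>

lemma psd_factor_nat:
  fixes K :: "nat \<Rightarrow> nat \<Rightarrow> real"
  assumes "psd UNIV K"
  shows "\<exists>a :: nat \<Rightarrow> nat \<Rightarrow> real. (\<forall>i n. n > i \<longrightarrow> a i n = 0) \<and>
           (\<forall>i j N. N > i \<longrightarrow> K i j = (\<Sum>n<N. a i n * a j n))"
proof -
  define L where "L n = rec_nat K schur n" for n
  have L_Suc: "L (Suc n) = schur n (L n)" and L_0: "L 0 = K" for n by (simp_all add: L_def)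
  have psd_L: "psd UNIV (L n)" for n
    by (induction n) (auto simp: L_Suc L_0 assms psd_schur)
  have L_zero: "i < n \<Longrightarrow> L n i j = 0 \<and> L n j i = 0" for i j n
  proof (induction n arbitrary: i j)
    case (Suc n)
    show ?case
    proof (cases "i = n")
      case True
      then show ?thesis
        using schur_zero[OF psd_L, of n j n] psd_sym[OF psd_L[of "Suc n"], of i j]
        by (simp add: L_Suc)
    next
      case False
      then show ?thesis using Suc by (simp add: L_Suc schur_def)
    qed
  qed simp
  define a where "a i n = L n i n / sqrt (L n n n)" for i n
  have step: "L (Suc n) i j = L n i j - a i n * a j n" for n i j
    using psd_diag[OF psd_L, of n n] psd_sym[OF psd_L[of n], of n j]
    by (simp add: L_Suc schur_def a_def real_sqrt_mult_self)
  have KL: "K i j = (\<Sum>n<N. a i n * a j n) + L N i j" for N i j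
    by (induction N) (auto simp: L_0 step)
  have "K i j = (\<Sum>n<N. a i n * a j n)" if "N > i" for i j N
    using KL[where i = i and j = j and N = N] L_zero[OF that, of j] by simp
  moreover have "a i n = 0" if "n > i" for i n
    using L_zero[OF that] by (simp add: a_def)
  ultimately show ?thesis by blast
qed

lemma psd_coordinates:
  assumes "countable X" and K: "psd X K"
  shows "\<exists>g :: 'a \<Rightarrow> nat \<Rightarrow> real. \<forall>x\<in>X. \<forall>y\<in>X.
           (\<lambda>k. (g x k - g y k)\<^sup>2) sums (K x x + K y y - 2 * K x y)"
proof (cases "X = {}")
  case False
  \<comment> \<open>A finite \<open>X\<close> is enumerated with repetitions; \<open>psd\<close>
    survives this because its test points may coincide.\<close>
  define e where "e = from_nat_into X"
  have e: "e i \<in> X" for i using False by (simp add: e_def from_nat_into)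
  define K' where "K' i j = K (e i) (e j)" for i j
  have "psd UNIV K'"
    unfolding psd_def K'_def using psd_sym[OF K] psdD[OF K] e by auto
  from psd_factor_nat[OF this] obtain a :: "nat \<Rightarrow> nat \<Rightarrow> real" where
    a0: "\<And>i n. n > i \<Longrightarrow> a i n = 0" and aK: "\<And>i j N. N > i \<Longrightarrow> K' i j = (\<Sum>n<N. a i n * a j n)"
    by blast
  have "(\<lambda>k. (a i k - a j k)\<^sup>2) sums (K' i i + K' j j - 2 * K' i j)" for i j
  proof -
    define N where "N = Suc (max i j)"
    have N: "N > i" "N > j" by (auto simp: N_def)
    have "(\<lambda>k. (a i k - a j k)\<^sup>2) sums (\<Sum>k<N. (a i k - a j k)\<^sup>2)"
      using N a0 by (intro sums_finite) auto
    also have "(\<Sum>k<N. (a i k - a j k)\<^sup>2)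
        = (\<Sum>k<N. a i k * a i k) + (\<Sum>k<N. a j k * a j k) - 2 * (\<Sum>k<N. a i k * a j k)"
      by (simp add: sum.distrib[symmetric] sum_subtractf[symmetric] sum_distrib_left
          power2_eq_square algebra_simps)
    finally show ?thesis using N aK by simp
  qed
  moreover have "e (to_nat_on X x) = x" if "x \<in> X" for x
    using assms(1) that by (simp add: e_def)
  then have "K x y = K' (to_nat_on X x) (to_nat_on X y)" if "x \<in> X" "y \<in> X" for x y
    using that by (simp add: K'_def)
  ultimately show ?thesis
    by (intro exI[of _ "\<lambda>x. a (to_nat_on X x)"]) simp
qed auto

text \<open>The embedding is the direct sum of the feature maps of the \<open>K n\<close>. The bound
  on partial sums makes it converge, and every \<open>n\<close> with \<open>T n < d x y\<close>
  contributes at least \<open>\<delta>\<close>; the lower control function counts such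
  \<open>n\<close>.\<close>

lemma CE_kernels:
  fixes K :: "nat \<Rightarrow> 'a \<Rightarrow> 'a \<Rightarrow> real"
  defines "D \<equiv> \<lambda>n x y. K n x x + K n y y - 2 * K n x y"
  assumes X: "countable X" and K: "\<And>n. psd X (K n)"
    and upper: "\<And>x y N. x \<in> X \<Longrightarrow> y \<in> X \<Longrightarrow> (\<Sum>n<N. D n x y) \<le> \<rho> (d x y)"
    and mono: "mono_on {0..} \<rho>" and nonneg: "\<And>t. t \<ge> 0 \<Longrightarrow> 0 \<le> \<rho> t"
    and \<delta>: "\<delta> > 0" and lower: "\<And>n x y. x \<in> X \<Longrightarrow> y \<in> X \<Longrightarrow> d x y > T n \<Longrightarrow> D n x y \<ge> \<delta>"
  shows "CE X d"
proof -
  have D_nonneg: "0 \<le> D n x y" if "x \<in> X" "y \<in> X" for n x y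
    using psd_dist_nonneg[OF K that] by (simp add: D_def)
  have "\<exists>g :: 'a \<Rightarrow> nat \<Rightarrow> real. \<forall>x\<in>X. \<forall>y\<in>X. (\<lambda>k. (g x k - g y k)\<^sup>2) sums D n x y" for n
    using psd_coordinates[OF X K] by (simp add: D_def)
  then obtain g :: "nat \<Rightarrow> 'a \<Rightarrow> nat \<Rightarrow> real" where
    g: "\<And>n x y. x \<in> X \<Longrightarrow> y \<in> X \<Longrightarrow> (\<lambda>k. (g n x k - g n y k)\<^sup>2) sums D n x y" by metis
  \<comment> \<open>The pairing function lays out the coordinates of all feature maps in one
    sequence.\<close>
  define h where "h x k = (case prod_decode k of (n, j) \<Rightarrow> g n x j)" for x k
  have D_summable: "summable (\<lambda>n. D n x y)" if "x \<in> X" "y \<in> X" for x y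
    using upper[OF that] D_nonneg[OF that] by (intro summableI_nonneg_bounded)
  have h_sums: "(\<lambda>k. (h x k - h y k)\<^sup>2) sums (\<Sum>n. D n x y)" if xy: "x \<in> X" "y \<in> X" for x y
  proof -
    have *: "((\<lambda>k. (g n x k - g n y k)\<^sup>2) has_sum D n x y) UNIV" for n
      using g[OF xy] by (intro sums_nonneg_imp_has_sum) auto
    have **: "((\<lambda>n. D n x y) has_sum (\<Sum>n. D n x y)) UNIV"
      using D_nonneg[OF xy] D_summable[OF xy]
      by (intro sums_nonneg_imp_has_sum) auto
    have "((\<lambda>(n, k). (g n x k - g n y k)\<^sup>2) has_sum (\<Sum>n. D n x y)) (Sigma UNIV (\<lambda>_. UNIV))"
    proof (rule has_sum_SigmaI)
      show "(\<lambda>(n, k). (g n x k - g n y k)\<^sup>2) summable_on Sigma UNIV (\<lambda>_. UNIV)"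
        by (rule summable_on_SigmaI[where g = "\<lambda>n. D n x y"])
          (use * ** in \<open>auto dest: has_sum_imp_summable\<close>)
    qed (use * ** in auto)
    then have "((\<lambda>p. (case p of (n, k) \<Rightarrow> (g n x k - g n y k)\<^sup>2)) has_sum (\<Sum>n. D n x y)) UNIV"
      by simp
    moreover have "(\<lambda>k. (h x k - h y k)\<^sup>2) = (\<lambda>p. (case p of (n, k) \<Rightarrow> (g n x k - g n y k)\<^sup>2)) \<circ> prod_decode"
      by (auto simp: h_def fun_eq_iff split: prod.splits)
    ultimately have "((\<lambda>k. (h x k - h y k)\<^sup>2) has_sum (\<Sum>n. D n x y)) UNIV"
      using has_sum_reindex[OF inj_prod_decode[of UNIV],
          of "\<lambda>p. (case p of (n, k) \<Rightarrow> (g n x k - g n y k)\<^sup>2)"]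
      by (simp add: surj_prod_decode)
    then show ?thesis by (rule has_sum_imp_sums)
  qed
  \<comment> \<open>Enlarging \<open>T\<close> only weakens the lower bound. The summand
    \<open>real n\<close> makes each counted set finite, and the accumulated sum makes
    \<open>T'\<close> monotone, so that all \<open>n\<close> up to \<open>N\<close> are counted once
    \<open>t\<close> exceeds \<open>T' N\<close>.\<close>
  define T' where "T' n = real n + (\<Sum>m\<le>n. \<bar>T m\<bar>)" for n
  have T': "T n \<le> T' n" "real n \<le> T' n" for n
  proof -
    have "\<bar>T n\<bar> \<le> (\<Sum>m\<le>n. \<bar>T m\<bar>)" by (intro member_le_sum) auto
    then show "T n \<le> T' n" by (simp add: T'_def)
    show "real n \<le> T' n" by (simp add: T'_def sum_nonneg)
  qed
  have fin: "finite {n. T' n < t}" for t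
  proof (rule finite_subset)
    have "n \<le> nat \<lceil>t\<rceil>" if "T' n < t" for n
      using T'(2)[of n] that by linarith
    then show "{n. T' n < t} \<subseteq> {..nat \<lceil>t\<rceil>}" by auto
  qed auto
  define \<rho>\<^sub>1 where "\<rho>\<^sub>1 t = \<delta> * real (card {n. T' n < t})" for t
  show ?thesis
  proof (rule CE_coordinates[where g = h and \<rho>\<^sub>1 = \<rho>\<^sub>1 and \<rho>\<^sub>2 = \<rho>])
    fix x y assume xy: "x \<in> X" "y \<in> X"
    show "summable (\<lambda>k. (h x k - h y k)\<^sup>2)" using h_sums[OF xy] by (rule sums_summable)
    have eq: "(\<Sum>k. (h x k - h y k)\<^sup>2) = (\<Sum>n. D n x y)"
      using h_sums[OF xy] by (simp add: sums_iff)
    show "(\<Sum>k. (h x k - h y k)\<^sup>2) \<le> \<rho> (d x y)"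
      unfolding eq using upper[OF xy] D_summable[OF xy] by (intro suminf_le_const)
    have "\<rho>\<^sub>1 (d x y) = (\<Sum>n\<in>{n. T' n < d x y}. \<delta>)" by (simp add: \<rho>\<^sub>1_def)
    also have "\<dots> \<le> (\<Sum>n\<in>{n. T' n < d x y}. D n x y)"
      using T'(1) lower[OF xy] by (intro sum_mono) (auto intro: le_less_trans)
    also have "\<dots> \<le> (\<Sum>n. D n x y)"
      using D_nonneg[OF xy] D_summable[OF xy] fin by (intro sum_le_suminf) auto
    finally show "\<rho>\<^sub>1 (d x y) \<le> (\<Sum>k. (h x k - h y k)\<^sup>2)" by (simp add: eq)
  next
    show "mono_on {0..} \<rho>\<^sub>1"
      unfolding \<rho>\<^sub>1_def mono_on_def using \<delta> fin
      by (auto intro!: mult_left_mono card_mono)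
    show "filterlim \<rho>\<^sub>1 at_top at_top"
    proof (subst filterlim_at_top_dense, intro allI)
      fix Z
      obtain N where N: "real N > Z / \<delta>" using reals_Archimedean2 by blast
      have "Z < \<rho>\<^sub>1 t" if "t > T' N" for t
      proof -
        have "mono T'" by (intro incseq_SucI) (simp add: T'_def)
        then have "{..N} \<subseteq> {n. T' n < t}" using that by (auto simp: mono_def intro: le_less_trans)
        from card_mono[OF fin this] have "real N \<le> real (card {n. T' n < t})" by simp
        with N have "Z / \<delta> < real (card {n. T' n < t})" by linarith
        then show ?thesis using \<delta> by (simp add: \<rho>\<^sub>1_def field_simps)
      qed
      then show "\<forall>\<^sub>F t in at_top. Z < \<rho>\<^sub>1 t" using eventually_gt_at_top by (rule eventually_mono[rotated])
    qed
    show "0 \<le> \<rho>\<^sub>1 t" for t using \<delta> by (simp add: \<rho>\<^sub>1_def)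
  qed (fact mono nonneg)+
qed

section \<open>Property A and uniform local amenability\<close>

lemma bounded_geometry_metric: "bounded_geometry X d \<Longrightarrow> Metric_space X d"
  by (simp add: bounded_geometry_def)

lemma bounded_geometry_countable:
  assumes "bounded_geometry X d" shows "countable X"
proof (cases "X = {}")
  case False
  then obtain p where p: "p \<in> X" by blast
  interpret Metric_space X d by (rule bounded_geometry_metric[OF assms])
  have "finite (mcball p (real n + 1))" for n :: nat
    using assms p by (fastforce simp: bounded_geometry_def dest: spec[of _ "real n + 1"])
  then have "countable (\<Union>n. mcball p (real n + 1))" by (simp add: countable_finite)
  moreover have "X \<subseteq> (\<Union>n. mcball p (real n + 1))"
  proof
    fix x assume "x \<in> X"
    obtain n where "d p x \<le> real n" using real_arch_simple by blast
    then have "d p x \<le> real n + 1" by simp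
    with p \<open>x \<in> X\<close> show "x \<in> (\<Union>n. mcball p (real n + 1))" by auto
  qed
  ultimately show ?thesis by (rule countable_subset[rotated])
qed auto

lemma set_diam_le_iff:
  assumes "S \<ge> 0"
  shows "set_diam d E \<le> ennreal S \<longleftrightarrow> (\<forall>x\<in>E. \<forall>y\<in>E. d x y \<le> S)"
  using assms by (auto simp: set_diam_def SUP_le_iff)

lemma set_dist_le:
  assumes "x \<in> E" "y \<in> F" shows "set_dist d E F \<le> ennreal (d x y)"
  unfolding set_dist_def using assms by (meson INF_lower2 order_refl)

lemma set_dist_greaterD:
  assumes "set_dist d E F > ennreal R" "x \<in> E" "y \<in> F"
  shows "d x y > R"
proof (rule ccontr)
  assume "\<not> d x y > R"
  then have "ennreal (d x y) \<le> ennreal R" by (simp add: ennreal_leI)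
  with set_dist_le[OF assms(2,3), of d] assms(1) show False by (meson leD order_trans)
qed

text \<open>Finiteness turns the infimum into a minimum; otherwise strict inequalities between
  points would only give a weak one.\<close>

lemma set_dist_greaterI:
  assumes "finite E" "finite F" "R \<ge> 0" "\<And>x y. x \<in> E \<Longrightarrow> y \<in> F \<Longrightarrow> d x y > R"
  shows "set_dist d E F > ennreal R"
proof (cases "E = {} \<or> F = {}")
  case False
  have "set_dist d E F = Min ((\<lambda>x. Min ((\<lambda>y. ennreal (d x y)) ` F)) ` E)"
    unfolding set_dist_def using assms(1,2) False by (simp add: cInf_eq_Min)
  also have "\<dots> > ennreal R"
    using assms False by (auto simp: ennreal_less_iff)
  finally show ?thesis .
qed (auto simp: set_dist_def)

lemma bdryI:
  assumes "x \<in> X" "x \<notin> E" "y \<in> E" "d x y \<le> R"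
  shows "x \<in> bdry X d R E"
proof -
  have "set_dist d {x} E \<le> ennreal (d x y)" using assms by (intro set_dist_le) auto
  also have "\<dots> \<le> ennreal R" using assms by (intro ennreal_leI) auto
  finally show ?thesis using assms by (simp add: bdry_def nbhd_def)
qed

text \<open>Supplies the finite set on which the greedy selection terminates.\<close>

lemma pmf_finite_approx:
  assumes "c < 1"
  shows "\<exists>F. finite F \<and> F \<subseteq> set_pmf \<mu> \<and> measure_pmf.prob \<mu> F > c"
proof -
  define e where "e = from_nat_into (set_pmf \<mu>)"
  have e: "range e = set_pmf \<mu>"
    unfolding e_def by (rule range_from_nat_into) (auto simp: set_pmf_not_empty)
  have "(\<lambda>n. measure_pmf.prob \<mu> (e ` {..<n})) \<longlonglongrightarrow> measure_pmf.prob \<mu> (\<Union>n. e ` {..<n})"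
    by (rule measure_pmf.finite_Lim_measure_incseq) (auto simp: incseq_def)
  moreover have "(\<Union>n. e ` {..<n}) = set_pmf \<mu>" using e by auto
  then have "measure_pmf.prob \<mu> (\<Union>n. e ` {..<n}) = 1"
    using measure_Int_set_pmf[of \<mu> UNIV] by simp
  ultimately have "(\<lambda>n. measure_pmf.prob \<mu> (e ` {..<n})) \<longlonglongrightarrow> 1" by simp
  from order_tendstoD(1)[OF this assms]
  obtain n where "measure_pmf.prob \<mu> (e ` {..<n}) > c"
    by (auto simp: eventually_sequentially)
  with e show ?thesis by (intro exI[of _ "e ` {..<n}"]) auto
qed

text \<open>\<open>ULA_mu\<close> with \<epsilon> = 1, applied to the measure conditioned on what is
  left, gives a set heavier than its boundary. Its trace is kept, its boundary discarded, and the
  selection repeated: at least half of the mass is kept, and the discarded boundaries separate the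
  pieces.\<close>

lemma ULA_mu_imp_MSP:
  assumes "Metric_space X d" and ula: "ULA_mu X d"
  shows "MSP X d"
proof -
  interpret Metric_space X d by fact
  have sep: "\<exists>S>0. \<forall>\<mu>\<in>prob_measures X. \<exists>\<Omega>\<subseteq>X. \<exists>P. partition_on \<Omega> P \<and>
        measure_pmf.prob \<mu> \<Omega> \<ge> 1/4 \<and> (\<forall>A\<in>P. set_diam d A \<le> ennreal S) \<and>
        (\<forall>A\<in>P. \<forall>B\<in>P. A \<noteq> B \<longrightarrow> set_dist d A B > ennreal R)" if R: "R > 0" for R
  proof -
    from ula R obtain S where S: "S > 0" and
      E: "\<And>\<mu>. \<mu> \<in> prob_measures X \<Longrightarrow> \<exists>E\<subseteq>X. finite E \<and> set_diam d E \<le> ennreal S \<and>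
        measure_pmf.prob \<mu> (bdry X d R E) < measure_pmf.prob \<mu> E"
      unfolding ULA_mu_def by (metis zero_less_one mult_1)
    have greedy: "\<exists>P. finite P \<and> disjoint P \<and> {} \<notin> P \<and> \<Union>P \<subseteq> G \<and>
        (\<forall>A\<in>P. set_diam d A \<le> ennreal S) \<and>
        (\<forall>A\<in>P. \<forall>B\<in>P. A \<noteq> B \<longrightarrow> set_dist d A B > ennreal R) \<and>
        sum (pmf \<mu>) G \<le> 2 * sum (pmf \<mu>) (\<Union>P)"
      if "finite G" "G \<subseteq> set_pmf \<mu>" and \<mu>: "set_pmf \<mu> \<subseteq> X" for G \<mu>
      using that(1,2)
    proof (induction "card G" arbitrary: G rule: less_induct)
      case less
      show ?case
      proof (cases "G = {}")
        case True
        then show ?thesis by (intro exI[of _ "{}"]) auto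
      next
        case False
        have ne: "set_pmf \<mu> \<inter> G \<noteq> {}" using False less.prems by auto
        \<comment> \<open>Conditioning on \<open>G\<close> confines the comparison of
          \<open>E\<close> with its boundary to the remaining points.\<close>
        define \<nu> where "\<nu> = cond_pmf \<mu> G"
        have G_pos: "sum (pmf \<mu>) G > 0"
          using less.prems False by (intro sum_pos) (auto simp: pmf_positive)
        have \<nu>: "measure_pmf.prob \<nu> A = sum (pmf \<mu>) (A \<inter> G) / sum (pmf \<mu>) G" for A
        proof -
          have "measure_pmf.prob \<nu> A = measure_pmf.prob \<nu> (A \<inter> G)"
            using measure_Int_set_pmf[of \<nu> A] less.prems(2) ne
            by (simp add: \<nu>_def inf.absorb2)
          also have "\<dots> = (\<Sum>x\<in>A \<inter> G. pmf \<nu> x)"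
            using less.prems by (intro measure_measure_pmf_finite) auto
          also have "\<dots> = (\<Sum>x\<in>A \<inter> G. pmf \<mu> x / sum (pmf \<mu>) G)"
            unfolding \<nu>_def using less.prems
            by (intro sum.cong refl) (simp add: pmf_cond[OF ne] measure_measure_pmf_finite)
          finally show ?thesis by (simp add: sum_divide_distrib)
        qed
        have "\<nu> \<in> prob_measures X"
          using \<mu> by (auto simp: prob_measures_def \<nu>_def set_cond_pmf[OF ne])
        from E[OF this] obtain E where E: "E \<subseteq> X" "finite E" "set_diam d E \<le> ennreal S"
          and "measure_pmf.prob \<nu> (bdry X d R E) < measure_pmf.prob \<nu> E" by blast
        then have less_E: "sum (pmf \<mu>) (bdry X d R E \<inter> G) < sum (pmf \<mu>) (E \<inter> G)"
          unfolding \<nu> using G_pos by (simp add: divide_less_cancel)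
        have "sum (pmf \<mu>) (bdry X d R E \<inter> G) \<ge> 0" by (simp add: sum_nonneg)
        \<comment> \<open>The strict inequality forces \<open>E\<close> to meet \<open>G\<close>, so
          the induction on \<open>card G\<close> progresses.\<close>
        with less_E have EG: "E \<inter> G \<noteq> {}" by auto
        define G' where "G' = G - (bdry X d R E \<union> E)"
        have "G' \<subset> G" using EG by (auto simp: G'_def)
        then have card: "card G' < card G" using less.prems by (intro psubset_card_mono)
        have G': "finite G'" "G' \<subseteq> set_pmf \<mu>" using less.prems by (auto simp: G'_def)
        obtain P where P: "finite P" "disjoint P" "{} \<notin> P" "\<Union>P \<subseteq> G'"
          "\<forall>A\<in>P. set_diam d A \<le> ennreal S"
          "\<forall>A\<in>P. \<forall>B\<in>P. A \<noteq> B \<longrightarrow> set_dist d A B > ennreal R"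
          "sum (pmf \<mu>) G' \<le> 2 * sum (pmf \<mu>) (\<Union>P)"
          using less.hyps[OF card G'] by (elim exE conjE) (rule that)
        have far: "d y e > R" if "y \<in> G'" "e \<in> E" for y e
        proof (rule ccontr)
          assume "\<not> d y e > R"
          then have "y \<in> bdry X d R E"
            using that less.prems \<mu> by (intro bdryI[of _ _ _ e]) (auto simp: G'_def)
          with that show False by (auto simp: G'_def)
        qed
        have fin: "finite A" if "A \<in> P" for A
          using that P(4) less.prems by (auto simp: G'_def intro: finite_subset)
        have "set_dist d A (E \<inter> G) > ennreal R \<and> set_dist d (E \<inter> G) A > ennreal R" if "A \<in> P" for A
        proof -
          have A: "A \<subseteq> G'" using that P(4) by blast
          then have "R < d y e" "R < d e y" if "y \<in> A" "e \<in> E \<inter> G" for y e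
            using far[of y e] that commute[of y e] by auto
          then show ?thesis
            using fin[OF that] E(2) R by (intro conjI set_dist_greaterI) auto
        qed
        moreover have "set_diam d (E \<inter> G) \<le> ennreal S"
          using E(3) S by (auto simp: set_diam_le_iff)
        moreover have disj: "(E \<inter> G) \<inter> \<Union>P = {}" using P(4) by (auto simp: G'_def)
        moreover have "sum (pmf \<mu>) G \<le> 2 * sum (pmf \<mu>) (\<Union>(insert (E \<inter> G) P))"
        proof -
          have "G = G' \<union> (bdry X d R E \<inter> G \<union> E \<inter> G)" by (auto simp: G'_def)
          then have "sum (pmf \<mu>) G = sum (pmf \<mu>) (G' \<union> (bdry X d R E \<inter> G \<union> E \<inter> G))" by simp
          also have "\<dots> = sum (pmf \<mu>) G' + sum (pmf \<mu>) (bdry X d R E \<inter> G \<union> E \<inter> G)"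
            using less.prems by (intro sum.union_disjoint) (auto simp: G'_def)
          also have "sum (pmf \<mu>) (bdry X d R E \<inter> G \<union> E \<inter> G)
              = sum (pmf \<mu>) (bdry X d R E \<inter> G) + sum (pmf \<mu>) (E \<inter> G)"
            using less.prems by (intro sum.union_disjoint) (auto simp: bdry_def)
          finally have "sum (pmf \<mu>) G \<le> 2 * (sum (pmf \<mu>) (E \<inter> G) + sum (pmf \<mu>) (\<Union>P))"
            using less_E P(7) by simp
          moreover have "finite (\<Union>P)"
            using P(4) less.prems by (auto simp: G'_def intro: finite_subset)
          then have "sum (pmf \<mu>) (E \<inter> G \<union> \<Union>P) = sum (pmf \<mu>) (E \<inter> G) + sum (pmf \<mu>) (\<Union>P)"
            using less.prems disj by (intro sum.union_disjoint) auto
          ultimately show ?thesis by simp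
        qed
        moreover have "disjoint (insert (E \<inter> G) P)"
          using P(2) disj by (auto simp: disjoint_def)
        ultimately show ?thesis
          using P EG by (intro exI[of _ "insert (E \<inter> G) P"]) (auto simp: G'_def)
      qed
    qed
    have "\<exists>\<Omega>\<subseteq>X. \<exists>P. partition_on \<Omega> P \<and>
        measure_pmf.prob \<mu> \<Omega> \<ge> 1/4 \<and> (\<forall>A\<in>P. set_diam d A \<le> ennreal S) \<and>
        (\<forall>A\<in>P. \<forall>B\<in>P. A \<noteq> B \<longrightarrow> set_dist d A B > ennreal R)" if "\<mu> \<in> prob_measures X" for \<mu>
    proof -
      have \<mu>: "set_pmf \<mu> \<subseteq> X" using that by (simp add: prob_measures_def)
      obtain F where F: "finite F" "F \<subseteq> set_pmf \<mu>" "measure_pmf.prob \<mu> F > 1/2"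
        using pmf_finite_approx[of "1/2" \<mu>] by auto
      from greedy[OF F(1,2) \<mu>] obtain P where P: "disjoint P" "{} \<notin> P" "\<Union>P \<subseteq> F"
        "\<forall>A\<in>P. set_diam d A \<le> ennreal S"
        "\<forall>A\<in>P. \<forall>B\<in>P. A \<noteq> B \<longrightarrow> set_dist d A B > ennreal R"
        "sum (pmf \<mu>) F \<le> 2 * sum (pmf \<mu>) (\<Union>P)" by blast
      \<comment> \<open>One half is lost in passing to the finite set \<open>F\<close>, another half
        in the greedy selection.\<close>
      have "measure_pmf.prob \<mu> (\<Union>P) \<ge> 1/4"
        using F P(3,6) finite_subset[OF P(3)] by (simp add: measure_measure_pmf_finite)
      then show ?thesis
        using P F \<mu> by (intro exI[of _ "\<Union>P"] conjI exI[of _ P]) (auto simp: partition_on_def)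
    qed
    with S show ?thesis by blast
  qed
  then show ?thesis
    unfolding MSP_def by (intro exI[of _ "1/4 :: real"] conjI) auto
qed

text \<open>Converts l1 estimates for measures into l2 estimates for their square roots; it serves
  both to embed under \<open>property_A\<close> and to refute that property.\<close>

lemma square_sqrt_diff_le:
  fixes a b :: real
  assumes "a \<ge> 0" "b \<ge> 0" shows "(sqrt a - sqrt b)\<^sup>2 \<le> \<bar>a - b\<bar>"
proof -
  have "(sqrt a - sqrt b)\<^sup>2 = \<bar>sqrt a - sqrt b\<bar> * \<bar>sqrt a - sqrt b\<bar>" by (simp add: power2_eq_square)
  also have "\<dots> \<le> \<bar>sqrt a - sqrt b\<bar> * \<bar>sqrt a + sqrt b\<bar>"
    using assms by (intro mult_left_mono) (auto simp: abs_le_iff)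
  also have "\<dots> = \<bar>(sqrt a)\<^sup>2 - (sqrt b)\<^sup>2\<bar>" by (simp add: power2_eq_square algebra_simps flip: abs_mult)
  finally show ?thesis using assms by simp
qed

text \<open>The square roots of the measures are unit vectors that vary slowly at scale
  \<open>n + 1\<close> and are orthogonal for points more than \<open>2 * S n\<close> apart. The
  summable tolerances 2^-n make the direct sum over \<open>n\<close> converge.\<close>

lemma property_A_imp_CE:
  assumes bg: "bounded_geometry X d" and A: "property_A X d"
  shows "CE X d"
proof -
  interpret Metric_space X d by (rule bounded_geometry_metric[OF bg])
  define Q where "Q n S \<xi> \<longleftrightarrow> S > 0 \<and> (\<forall>x\<in>X. \<xi> x \<in> prob_measures X) \<and>
        (\<forall>x\<in>X. \<forall>y\<in>X. d x y \<le> real n + 1 \<longrightarrow> (\<Sum>\<^sub>\<infinity>z\<in>X. \<bar>pmf (\<xi> x) z - pmf (\<xi> y) z\<bar>) < (1/2)^n) \<and>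
        (\<forall>x\<in>X. set_pmf (\<xi> x) \<subseteq> mcball x S)" for n S and \<xi> :: "'a \<Rightarrow> 'a pmf"
  have "\<exists>S \<xi>. Q n S \<xi>" for n
    using A[unfolded property_A_def, rule_format, of "real n + 1" "(1/2)^n"] by (auto simp: Q_def)
  then obtain S \<xi> where Q: "\<And>n. Q n (S n) (\<xi> n)" by metis
  have S: "S n > 0" for n using Q[of n] by (simp add: Q_def)
  have \<xi>: "set_pmf (\<xi> n x) \<subseteq> X" if "x \<in> X" for n x
    using Q[of n] that by (simp add: Q_def prob_measures_def)
  have close: "(\<Sum>\<^sub>\<infinity>z\<in>X. \<bar>pmf (\<xi> n x) z - pmf (\<xi> n y) z\<bar>) < (1/2)^n"
    if "x \<in> X" "y \<in> X" "d x y \<le> real n + 1" for n x y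
    using Q[of n] that by (simp add: Q_def)
  have supp: "set_pmf (\<xi> n x) \<subseteq> mcball x (S n)" if "x \<in> X" for n x
    using Q[of n] that by (simp add: Q_def)
  have fin: "finite (set_pmf (\<xi> n x))" if "x \<in> X" for n x
  proof -
    have "finite (mcball x (S n))"
      using bg S that unfolding bounded_geometry_def by blast
    with supp[OF that] show ?thesis by (rule finite_subset)
  qed
  define K where "K n x y = (\<Sum>z\<in>set_pmf (\<xi> n x). sqrt (pmf (\<xi> n x) z) * sqrt (pmf (\<xi> n y) z))" for n x y
  have K: "K n x y = (\<Sum>z\<in>Z. sqrt (pmf (\<xi> n x) z) * sqrt (pmf (\<xi> n y) z))"
    if "finite Z" "set_pmf (\<xi> n x) \<subseteq> Z" for n x y Z
    unfolding K_def using that by (intro sum.mono_neutral_left) (auto simp: pmf_eq_0_set_pmf)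
  have K_sym: "K n x y = K n y x" if "x \<in> X" "y \<in> X" for n x y
    using K[of "set_pmf (\<xi> n x) \<union> set_pmf (\<xi> n y)" n x y]
      K[of "set_pmf (\<xi> n x) \<union> set_pmf (\<xi> n y)" n y x] fin that by (simp add: mult.commute)
  have K_diag: "K n x x = 1" if "x \<in> X" for n x
    unfolding K_def by (simp add: sum_pmf_eq_1 fin that)
  have K_psd: "psd X (K n)" for n
    unfolding psd_def
  proof (intro conjI ballI allI impI)
    fix m and x :: "nat \<Rightarrow> 'a" and c :: "nat \<Rightarrow> real"
    assume x: "\<forall>i<m. x i \<in> X"
    define Z where "Z = (\<Union>i<m. set_pmf (\<xi> n (x i)))"
    have Z: "finite Z" using x fin by (auto simp: Z_def)
    have "(\<Sum>i<m. \<Sum>j<m. c i * c j * K n (x i) (x j))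
      = (\<Sum>i<m. \<Sum>j<m. \<Sum>z\<in>Z. (c i * sqrt (pmf (\<xi> n (x i)) z)) * (c j * sqrt (pmf (\<xi> n (x j)) z)))"
      by (intro sum.cong refl, subst K[OF Z]) (auto simp: Z_def sum_distrib_left algebra_simps)
    also have "\<dots> = (\<Sum>i<m. \<Sum>z\<in>Z. \<Sum>j<m. (c i * sqrt (pmf (\<xi> n (x i)) z)) * (c j * sqrt (pmf (\<xi> n (x j)) z)))"
      by (intro sum.cong refl sum.swap)
    also have "\<dots> = (\<Sum>z\<in>Z. \<Sum>i<m. \<Sum>j<m. (c i * sqrt (pmf (\<xi> n (x i)) z)) * (c j * sqrt (pmf (\<xi> n (x j)) z)))"
      by (rule sum.swap)
    also have "\<dots> = (\<Sum>z\<in>Z. (\<Sum>i<m. c i * sqrt (pmf (\<xi> n (x i)) z))\<^sup>2)"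
      by (simp add: power2_eq_square sum_product)
    also have "\<dots> \<ge> 0" by (intro sum_nonneg) auto
    finally show "0 \<le> (\<Sum>i<m. \<Sum>j<m. c i * c j * K n (x i) (x j))" .
  qed (use K_sym in auto)
  have D_close: "K n x x + K n y y - 2 * K n x y \<le> (1/2)^n"
    if "x \<in> X" "y \<in> X" "d x y \<le> real n + 1" for n x y
  proof -
    define Z where "Z = set_pmf (\<xi> n x) \<union> set_pmf (\<xi> n y)"
    have Z: "finite Z" "Z \<subseteq> X" "set_pmf (\<xi> n x) \<subseteq> Z" "set_pmf (\<xi> n y) \<subseteq> Z"
      using fin \<xi> that by (auto simp: Z_def)
    have "K n x x + K n y y - 2 * K n x y = (\<Sum>z\<in>Z. (sqrt (pmf (\<xi> n x) z) - sqrt (pmf (\<xi> n y) z))\<^sup>2)"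
      using K[OF Z(1,3)] K[OF Z(1,4)]
      by (simp add: sum_distrib_left power2_eq_square algebra_simps flip: sum.distrib sum_subtractf)
    also have "\<dots> \<le> (\<Sum>z\<in>Z. \<bar>pmf (\<xi> n x) z - pmf (\<xi> n y) z\<bar>)"
      by (intro sum_mono square_sqrt_diff_le) auto
    also have "\<dots> = (\<Sum>\<^sub>\<infinity>z\<in>Z. \<bar>pmf (\<xi> n x) z - pmf (\<xi> n y) z\<bar>)"
      using Z(1) by simp
    also have "\<dots> = (\<Sum>\<^sub>\<infinity>z\<in>X. \<bar>pmf (\<xi> n x) z - pmf (\<xi> n y) z\<bar>)"
      using Z by (intro infsum_cong_neutral) (auto simp: Z_def set_pmf_iff)
    finally show ?thesis using close[OF that] by simp
  qed
  have K_nonneg: "0 \<le> K n x y" for n x y unfolding K_def by (intro sum_nonneg) auto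
  show ?thesis
  \<comment> \<open>The tolerances sum to at most 2, and each of the at most \<open>d x y\<close>
    scales with \<open>real n + 1 < d x y\<close> adds at most 2 because \<open>K\<close> is
    nonnegative; this is the origin of \<open>2 + 2 * t\<close>.\<close>
  proof (rule CE_kernels[where K = K and \<rho> = "\<lambda>t. 2 + 2 * t" and \<delta> = 2 and T = "\<lambda>n. 2 * S n"])
    fix x y N assume xy: "x \<in> X" "y \<in> X"
    have "(\<Sum>n<N. K n x x + K n y y - 2 * K n x y)
        \<le> (\<Sum>n<N. (1/2)^n + (if real n + 1 < d x y then 2 else 0))"
    proof (rule sum_mono)
      fix n
      have "(0::real) \<le> (1/2)^n" by simp
      then show "K n x x + K n y y - 2 * K n x y \<le> (1/2)^n + (if real n + 1 < d x y then 2 else 0)"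
      proof (cases "d x y \<le> real n + 1")
        case True
        then show ?thesis using D_close[OF xy] by simp
      next
        case False
        then show ?thesis using \<open>0 \<le> (1/2)^n\<close> K_nonneg[of n x y] K_diag[OF xy(1), of n] K_diag[OF xy(2), of n]
          by (simp only: if_True not_le)
      qed
    qed
    also have "\<dots> = (\<Sum>n<N. (1/2)^n) + 2 * real (card {n\<in>{..<N}. real n + 1 < d x y})"
      by (simp add: sum.distrib sum.If_cases Int_def)
    also have "(\<Sum>n<N. (1/2)^n) \<le> (2 :: real)"
      using sum_le_suminf[of "\<lambda>n. (1/2 :: real)^n" "{..<N}"] by (simp add: suminf_geometric)
    also have "real (card {n\<in>{..<N}. real n + 1 < d x y}) \<le> d x y"
    proof -
      have "n < nat \<lfloor>d x y\<rfloor>" if "real n + 1 < d x y" for n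
        using that by linarith
      then have "card {n\<in>{..<N}. real n + 1 < d x y} \<le> card {..<nat \<lfloor>d x y\<rfloor>}"
        by (intro card_mono) auto
      then have "real (card {n\<in>{..<N}. real n + 1 < d x y}) \<le> real (nat \<lfloor>d x y\<rfloor>)"
        unfolding of_nat_le_iff by simp
      also have "\<dots> \<le> d x y" using nonneg[of x y] by linarith
      finally show ?thesis .
    qed
    finally show "(\<Sum>n<N. K n x x + K n y y - 2 * K n x y) \<le> 2 + 2 * d x y" by simp
  next
    fix n x y assume xy: "x \<in> X" "y \<in> X" and far: "2 * S n < d x y"
    have "set_pmf (\<xi> n x) \<inter> set_pmf (\<xi> n y) = {}"
    proof (rule ccontr)
      assume "set_pmf (\<xi> n x) \<inter> set_pmf (\<xi> n y) \<noteq> {}"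
      then obtain z where "z \<in> set_pmf (\<xi> n x)" "z \<in> set_pmf (\<xi> n y)" by blast
      then have "z \<in> X" "d x z \<le> S n" "d y z \<le> S n" using supp xy by fastforce+
      with triangle[of x z y] xy far commute[of y z] show False by simp
    qed
    then have "K n x y = 0" unfolding K_def by (intro sum.neutral) (auto simp: pmf_eq_0_set_pmf)
    then show "2 \<le> K n x x + K n y y - 2 * K n x y" using K_diag xy by simp
  qed (use K_psd bounded_geometry_countable[OF bg] in \<open>auto simp: mono_on_def\<close>)
qed

section \<open>Kernels from separated families\<close>

lemma finite_weights_pmf:
  fixes w :: "'a \<Rightarrow> real"
  assumes F: "finite F" and w: "\<And>x. x \<in> F \<Longrightarrow> w x \<ge> 0" and pos: "sum w F > 0"
  shows "\<exists>\<mu>. set_pmf \<mu> \<subseteq> F \<and> (\<forall>x\<in>F. pmf \<mu> x = w x / sum w F)"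
proof -
  define p where "p x = (if x \<in> F then w x / sum w F else 0)" for x
  have p: "p x \<ge> 0" for x using w pos by (simp add: p_def)
  have "(\<integral>\<^sup>+x. ennreal (p x) \<partial>count_space UNIV) = (\<Sum>x\<in>F. ennreal (p x))"
    by (rule nn_integral_count_space') (auto simp: F p_def)
  also have "\<dots> = ennreal (sum p F)" using p by (rule sum_ennreal)
  also have "sum p F = 1" using pos by (simp add: p_def flip: sum_divide_distrib)
  finally have 1: "(\<integral>\<^sup>+x. ennreal (p x) \<partial>count_space UNIV) = 1" by simp
  show ?thesis
    using set_embed_pmf[of p, OF p 1] pmf_embed_pmf[of p, OF p 1]
    by (intro exI[of _ "embed_pmf p"]) (auto simp: p_def split: if_splits)
qed

text \<open>The tent function max(0, 1 - 2 dist(x,A) / R), written as a supremum over points so that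
  no distance to a set occurs. It reaches \<open>R / 2\<close> beyond \<open>A\<close>, so bumps
  around sets more than \<open>R\<close> apart have disjoint supports.\<close>

definition bump :: "('a \<Rightarrow> 'a \<Rightarrow> real) \<Rightarrow> real \<Rightarrow> 'a set \<Rightarrow> 'a \<Rightarrow> real" where
  "bump d R A x = (SUP y\<in>A. max 0 (1 - 2 * d x y / R))"

context Metric_space
begin

lemma bump_bdd: "R > 0 \<Longrightarrow> bdd_above ((\<lambda>y. max 0 (1 - 2 * d x y / R)) ` A)"
  by (intro bdd_aboveI[of _ 1]) auto

lemma bump_nonneg:
  assumes "R > 0" "A \<noteq> {}" shows "0 \<le> bump d R A x"
proof -
  from assms obtain y where "y \<in> A" by blast
  then show ?thesis
    unfolding bump_def using assms by (intro cSUP_upper2[OF bump_bdd]) auto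
qed

lemma bump_le_1: "R > 0 \<Longrightarrow> A \<noteq> {} \<Longrightarrow> bump d R A x \<le> 1"
  unfolding bump_def by (rule cSUP_least) auto

lemma bump_eq_1:
  assumes "R > 0" "x \<in> A" "A \<subseteq> M" shows "bump d R A x = 1"
proof (rule antisym)
  show "bump d R A x \<le> 1" using assms by (intro bump_le_1) auto
  have "max 0 (1 - 2 * d x x / R) \<le> bump d R A x"
    unfolding bump_def using assms by (intro cSUP_upper bump_bdd) auto
  then show "1 \<le> bump d R A x" using assms by (auto simp: subset_iff)
qed

lemma bump_posD:
  assumes "R > 0" "A \<noteq> {}" "bump d R A x > 0"
  shows "\<exists>y\<in>A. d x y < R / 2"
proof (rule ccontr)
  assume "\<not> (\<exists>y\<in>A. d x y < R / 2)"
  then have "bump d R A x \<le> 0"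
    unfolding bump_def using assms by (intro cSUP_least) (auto simp: field_simps not_less)
  with assms show False by simp
qed

lemma bump_lipschitz:
  assumes "R > 0" "A \<noteq> {}" "A \<subseteq> M" "x \<in> M" "y \<in> M"
  shows "bump d R A x - bump d R A y \<le> 2 * d x y / R"
proof -
  have "bump d R A x \<le> bump d R A y + 2 * d x y / R"
    unfolding bump_def[of d R A x]
  proof (rule cSUP_least)
    fix z assume z: "z \<in> A"
    have "d y z \<le> d x y + d x z" using triangle[of y x z] assms z commute[of x y] by auto
    then have "2 * d y z / R \<le> (2 * d x y + 2 * d x z) / R"
      using assms(1) by (intro divide_right_mono) auto
    then have "1 - 2 * d x z / R \<le> (1 - 2 * d y z / R) + 2 * d x y / R"
      by (simp add: add_divide_distrib)
    moreover have "0 \<le> 2 * d x y / R" using assms(1) by simp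
    ultimately have "max 0 (1 - 2 * d x z / R) \<le> max 0 (1 - 2 * d y z / R) + 2 * d x y / R"
      by linarith
    also have "max 0 (1 - 2 * d y z / R) \<le> bump d R A y"
      unfolding bump_def using assms z by (intro cSUP_upper bump_bdd) auto
    finally show "max 0 (1 - 2 * d x z / R) \<le> bump d R A y + 2 * d x y / R" by simp
  qed (use assms in auto)
  then show ?thesis by simp
qed

end

text \<open>Kernels are functions on pairs so that Tychonoff's theorem applies, and the range is
  prescribed on the whole type so that they lie in a compact box. The 8 stems from two bumps of
  slope \<open>2 / R\<close>: twice the square of 2.\<close>

definition cut_kernels :: "'a set \<Rightarrow> ('a \<Rightarrow> 'a \<Rightarrow> real) \<Rightarrow> real \<Rightarrow> real \<Rightarrow> ('a \<times> 'a \<Rightarrow> real) set" where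
  "cut_kernels X d R T = {k. (\<forall>p. k p \<in> {0..1}) \<and> psd X (curry k) \<and>
     (\<forall>x\<in>X. \<forall>y\<in>X. d x y > T \<longrightarrow> k (x, y) = 0) \<and>
     (\<forall>x\<in>X. \<forall>y\<in>X. k (x, x) + k (y, y) - 2 * k (x, y) \<le> 8 * (d x y / R)\<^sup>2)}"

text \<open>Each single condition involves finitely many coordinates and is closed; the box is
  compact by Tychonoff.\<close>

lemma compact_cut_kernels: "compact (cut_kernels X d R T)"
proof -
  have coord[continuous_intros]: "continuous_on S (\<lambda>k :: 'a \<times> 'a \<Rightarrow> real. k p)" for S p
    by (rule continuous_on_subset[OF continuous_on_product_coordinates subset_UNIV])
  have "compactin (product_topology (\<lambda>_ :: 'a \<times> 'a. euclidean :: real topology) UNIV) (PiE UNIV (\<lambda>_. {0..1}))"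
    by (simp add: compactin_PiE)
  then have box: "compact (PiE UNIV (\<lambda>_. {0..1}) :: ('a \<times> 'a \<Rightarrow> real) set)"
    by (simp add: euclidean_product_topology)
  have "closed {k :: 'a \<times> 'a \<Rightarrow> real. psd X (curry k) \<and>
     (\<forall>x\<in>X. \<forall>y\<in>X. d x y > T \<longrightarrow> k (x, y) = 0) \<and>
     (\<forall>x\<in>X. \<forall>y\<in>X. k (x, x) + k (y, y) - 2 * k (x, y) \<le> 8 * (d x y / R)\<^sup>2)}"
    unfolding psd_def curry_def Ball_def
    by (intro closed_Collect_conj closed_Collect_all closed_Collect_imp closed_Collect_le
        closed_Collect_eq continuous_intros open_Collect_const)
  from compact_Int_closed[OF box this] show ?thesis
    by (rule back_subst[where P = compact]) (auto simp: cut_kernels_def PiE_def)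
qed

lemma psd_convex:
  assumes "psd X K" "psd X L" "0 \<le> t" "t \<le> 1"
  shows "psd X (\<lambda>x y. (1 - t) * K x y + t * L x y)"
  unfolding psd_def
proof (intro conjI ballI allI impI)
  fix m and x :: "nat \<Rightarrow> 'a" and c :: "nat \<Rightarrow> real"
  assume x: "\<forall>i<m. x i \<in> X"
  have "(\<Sum>i<m. \<Sum>j<m. c i * c j * ((1 - t) * K (x i) (x j) + t * L (x i) (x j)))
    = (1 - t) * (\<Sum>i<m. \<Sum>j<m. c i * c j * K (x i) (x j)) + t * (\<Sum>i<m. \<Sum>j<m. c i * c j * L (x i) (x j))"
    by (simp add: sum_distrib_left sum.distrib[symmetric] algebra_simps)
  also have "\<dots> \<ge> 0"
    using psdD[OF assms(1), of m x c] psdD[OF assms(2), of m x c] x assms(3,4) by simp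
  finally show "0 \<le> (\<Sum>i<m. \<Sum>j<m. c i * c j * ((1 - t) * K (x i) (x j) + t * L (x i) (x j)))" .
qed (use psd_sym[OF assms(1)] psd_sym[OF assms(2)] in auto)

lemma cut_kernels_convex:
  assumes "k \<in> cut_kernels X d R T" "l \<in> cut_kernels X d R T" "0 \<le> t" "t \<le> 1"
  shows "(\<lambda>p. (1 - t) * k p + t * l p) \<in> cut_kernels X d R T"
proof -
  have conv: "(1 - t) * a + t * b \<le> u" if "a \<le> u" "b \<le> u" for a b u :: real
    using that assms(3,4) convex_bound_le[of a u b "1 - t" t] by simp
  show ?thesis
    using assms psd_convex[of X "curry k" "curry l" t] conv
    unfolding cut_kernels_def mem_Collect_eq curry_def
  proof (elim conjE, intro conjI allI ballI impI)
    fix x y assume xy: "x \<in> X" "y \<in> X"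
      and k: "\<forall>x\<in>X. \<forall>y\<in>X. k (x, x) + k (y, y) - 2 * k (x, y) \<le> 8 * (d x y / R)\<^sup>2"
      and l: "\<forall>x\<in>X. \<forall>y\<in>X. l (x, x) + l (y, y) - 2 * l (x, y) \<le> 8 * (d x y / R)\<^sup>2"
    from conv[OF k[rule_format, OF xy] l[rule_format, OF xy]]
    show "(1 - t) * k (x, x) + t * l (x, x) + ((1 - t) * k (y, y) + t * l (y, y)) -
           2 * ((1 - t) * k (x, y) + t * l (x, y)) \<le> 8 * (d x y / R)\<^sup>2"
      by (simp add: algebra_simps)
  qed auto
qed

text \<open>The Gram kernel of the bumps is positive semidefinite; its width is the diameter
  \<open>S\<close> plus twice the reach \<open>R / 2\<close> of a bump.\<close>

lemma separated_family_kernel: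
  assumes "Metric_space X d" and R: "R > 0" and S: "S > 0"
    and P: "\<And>A. A \<in> P \<Longrightarrow> A \<subseteq> X" "{} \<notin> P"
    and diam: "\<And>A x y. A \<in> P \<Longrightarrow> x \<in> A \<Longrightarrow> y \<in> A \<Longrightarrow> d x y \<le> S"
    and sep: "\<And>A B x y. A \<in> P \<Longrightarrow> B \<in> P \<Longrightarrow> A \<noteq> B \<Longrightarrow> x \<in> A \<Longrightarrow> y \<in> B \<Longrightarrow> d x y > R"
  shows "\<exists>k\<in>cut_kernels X d R (S + R). \<forall>x\<in>\<Union>P. k (x, x) = 1"
proof -
  interpret Metric_space X d by fact
  have ne: "A \<noteq> {}" if "A \<in> P" for A using that P(2) by auto
  have unique: "A = B" if AB: "A \<in> P" "B \<in> P" "x \<in> X" "bump d R A x > 0" "bump d R B x > 0" for A B x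
  proof (rule ccontr)
    assume "A \<noteq> B"
    obtain a b where "a \<in> A" "d x a < R / 2" "b \<in> B" "d x b < R / 2"
      using bump_posD[OF R ne[OF AB(1)] AB(4)] bump_posD[OF R ne[OF AB(2)] AB(5)] by blast
    moreover have "d a b \<le> d x a + d x b"
      using triangle[of a x b] commute[of a x] calculation AB P(1) by (auto simp: subset_iff)
    ultimately show False using sep[OF AB(1,2) \<open>A \<noteq> B\<close>, of a b] by linarith
  qed
  \<comment> \<open>At most one bump is positive at each point, so sums over the possibly infinite
    family \<open>P\<close> reduce to finite ones.\<close>
  define near where "near x = {A\<in>P. x \<in> X \<and> bump d R A x > 0}" for x
  have near: "near x = {} \<or> (\<exists>A\<in>P. near x = {A})" for x
  proof (cases "near x = {}")
    case False
    then obtain A where "A \<in> near x" by blast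
    then have "near x = {A}" "A \<in> P" using unique[of A _ x] unfolding near_def by blast+
    then show ?thesis by blast
  qed simp
  have fin: "finite (near x)" for x using near[of x] by auto
  define k where "k = (\<lambda>(x, y). \<Sum>A\<in>near x \<inter> near y. bump d R A x * bump d R A y)"
  have k: "k (x, y) = (\<Sum>A\<in>Q. bump d R A x * bump d R A y)"
    if "x \<in> X" "y \<in> X" "finite Q" "near x \<inter> near y \<subseteq> Q" "Q \<subseteq> P" for x y Q
    unfolding k_def prod.case
  proof (rule sum.mono_neutral_left)
    show "\<forall>A\<in>Q - near x \<inter> near y. bump d R A x * bump d R A y = 0"
    proof
      fix A assume A: "A \<in> Q - near x \<inter> near y"
      then have "A \<in> P" using that by auto
      then have "\<not> 0 < bump d R A x \<or> \<not> 0 < bump d R A y"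
        using A that(1,2) by (auto simp: near_def)
      then have "bump d R A x = 0 \<or> bump d R A y = 0"
        using bump_nonneg[OF R ne[OF \<open>A \<in> P\<close>]] by (metis antisym not_le)
      then show "bump d R A x * bump d R A y = 0" by simp
    qed
  qed (use that in auto)
  have k_range: "k (x, y) \<in> {0..1}" for x y
  proof (cases "near x \<inter> near y = {}")
    case False
    then obtain A where "A \<in> near x" "A \<in> near y" by blast
    then have A: "A \<in> P" "near x \<inter> near y = {A}"
      using near[of x] near[of y] by (simp add: near_def, auto)
    then have "k (x, y) = bump d R A x * bump d R A y" by (simp add: k_def)
    then show ?thesis
      using bump_nonneg[OF R ne[OF A(1)]] bump_le_1[OF R ne[OF A(1)]] by (simp add: mult_le_one)
  qed (simp add: k_def)
  have k_psd: "psd X (curry k)"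
    unfolding psd_def curry_def
  proof (intro conjI ballI allI impI)
    fix m and x :: "nat \<Rightarrow> 'a" and c :: "nat \<Rightarrow> real"
    assume x: "\<forall>i<m. x i \<in> X"
    define Q where "Q = (\<Union>i<m. near (x i))"
    have Q: "finite Q" "Q \<subseteq> P" using fin by (auto simp: Q_def near_def)
    have "(\<Sum>i<m. \<Sum>j<m. c i * c j * k (x i, x j))
      = (\<Sum>i<m. \<Sum>j<m. \<Sum>A\<in>Q. (c i * bump d R A (x i)) * (c j * bump d R A (x j)))"
      using x by (intro sum.cong refl, subst k[OF _ _ Q(1) _ Q(2)])
        (auto simp: Q_def sum_distrib_left algebra_simps)
    also have "\<dots> = (\<Sum>i<m. \<Sum>A\<in>Q. \<Sum>j<m. (c i * bump d R A (x i)) * (c j * bump d R A (x j)))"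
      by (intro sum.cong refl sum.swap)
    also have "\<dots> = (\<Sum>A\<in>Q. \<Sum>i<m. \<Sum>j<m. (c i * bump d R A (x i)) * (c j * bump d R A (x j)))"
      by (rule sum.swap)
    also have "\<dots> = (\<Sum>A\<in>Q. (\<Sum>i<m. c i * bump d R A (x i))\<^sup>2)"
      by (simp add: power2_eq_square sum_product)
    also have "\<dots> \<ge> 0" by (intro sum_nonneg) auto
    finally show "0 \<le> (\<Sum>i<m. \<Sum>j<m. c i * c j * k (x i, x j))" .
  qed (simp add: k_def Int_commute mult.commute)
  have k_far: "k (x, y) = 0" if xy: "x \<in> X" "y \<in> X" "d x y > S + R" for x y
  proof -
    have "near x \<inter> near y = {}"
    proof (rule ccontr)
      assume "near x \<inter> near y \<noteq> {}"
      then obtain A where A: "A \<in> P" "bump d R A x > 0" "bump d R A y > 0" by (auto simp: near_def)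
      then obtain a b where ab: "a \<in> A" "d x a < R / 2" "b \<in> A" "d y b < R / 2"
        using bump_posD[OF R ne[OF A(1)] A(2)] bump_posD[OF R ne[OF A(1)] A(3)] by blast
      then have "d x y \<le> d x a + d a y" "d a y \<le> d a b + d b y"
        using P(1)[OF A(1)] xy by (auto intro!: triangle)
      then show False using ab diam[OF A(1) ab(1,3)] xy commute[of b y] by linarith
    qed
    then show ?thesis by (simp add: k_def)
  qed
  have k_close: "k (x, x) + k (y, y) - 2 * k (x, y) \<le> 8 * (d x y / R)\<^sup>2" if xy: "x \<in> X" "y \<in> X" for x y
  proof -
    \<comment> \<open>At most two bumps are positive at \<open>x\<close> or \<open>y\<close>, and
      each contributes at most \<open>(2 * d x y / R)\<^sup>2\<close>.\<close>
    define Q where "Q = near x \<union> near y"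
    have Q: "finite Q" "Q \<subseteq> P" using fin by (auto simp: Q_def near_def)
    have "card Q \<le> card (near x) + card (near y)" unfolding Q_def by (rule card_Un_le)
    also have "\<dots> \<le> 2" using near[of x] near[of y] by auto
    finally have card: "card Q \<le> 2" .
    have "k (x, x) + k (y, y) - 2 * k (x, y) = (\<Sum>A\<in>Q. (bump d R A x - bump d R A y)\<^sup>2)"
    proof -
      have "near x \<subseteq> Q" "near y \<subseteq> Q" "near x \<inter> near y \<subseteq> Q" by (auto simp: Q_def)
      then show ?thesis
        using k[OF xy(1,1) Q(1) _ Q(2)] k[OF xy(2,2) Q(1) _ Q(2)] k[OF xy Q(1) _ Q(2)]
        by (simp add: sum_distrib_left power2_eq_square algebra_simps flip: sum.distrib sum_subtractf)
    qed
    also have "\<dots> \<le> (\<Sum>A\<in>Q. (2 * d x y / R)\<^sup>2)"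
    proof (rule sum_mono)
      fix A assume "A \<in> Q"
      then have "A \<in> P" using Q by auto
      then have "\<bar>bump d R A x - bump d R A y\<bar> \<le> 2 * d x y / R"
        using bump_lipschitz[OF R ne P(1) xy, of A] bump_lipschitz[OF R ne P(1) xy(2,1), of A] commute[of x y]
        by (simp add: abs_le_iff)
      then have "\<bar>bump d R A x - bump d R A y\<bar>\<^sup>2 \<le> (2 * d x y / R)\<^sup>2" by (intro power_mono) auto
      then show "(bump d R A x - bump d R A y)\<^sup>2 \<le> (2 * d x y / R)\<^sup>2" by simp
    qed
    also have "\<dots> \<le> 2 * (2 * d x y / R)\<^sup>2" using card by (simp add: mult_right_mono)
    finally show ?thesis by (simp add: power_divide power_mult_distrib)
  qed
  have k_diag: "k (x, x) = 1" if "x \<in> \<Union>P" for x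
  proof -
    from that obtain A where A: "A \<in> P" "x \<in> A" by blast
    have x: "x \<in> X" using A P by blast
    have 1: "bump d R A x = 1" using R A P(1) by (intro bump_eq_1) auto
    then have "A \<in> near x" using A x by (simp add: near_def)
    then have "near x = {A}" using near[of x] by auto
    then show ?thesis by (simp add: k_def 1)
  qed
  have "k p \<in> {0..1}" for p using k_range by (cases p) simp
  then have "k \<in> cut_kernels X d R (S + R)"
    unfolding cut_kernels_def mem_Collect_eq by (intro conjI ballI allI impI k_psd k_far k_close)
  with k_diag show ?thesis by (intro bexI[of _ k] ballI)
qed

section \<open>The metric sparsification property\<close>

definition sparsified :: "'a set \<Rightarrow> ('a \<Rightarrow> 'a \<Rightarrow> real) \<Rightarrow> real \<Rightarrow> real \<Rightarrow> real \<Rightarrow> 'a pmf \<Rightarrow> bool" where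
  "sparsified X d c R S \<mu> \<longleftrightarrow> (\<exists>\<Omega>\<subseteq>X. \<exists>P. partition_on \<Omega> P \<and>
        measure_pmf.prob \<mu> \<Omega> \<ge> c \<and> (\<forall>A\<in>P. set_diam d A \<le> ennreal S) \<and>
        (\<forall>A\<in>P. \<forall>B\<in>P. A \<noteq> B \<longrightarrow> set_dist d A B > ennreal R))"

lemma MSP_iff_sparsified:
  "MSP X d \<longleftrightarrow> (\<exists>c>0. \<forall>R>0. \<exists>S>0. \<forall>\<mu>\<in>prob_measures X. sparsified X d c R S \<mu>)"
  by (simp only: MSP_def sparsified_def)

text \<open>Minimax by a variational argument: a kernel that minimises the sum of squared deficits
  below \<open>c\<close> has no deficit. Otherwise its deficits, normalised, form a probability
  measure, and a separated family for this measure gives a kernel in whose direction the sum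
  decreases.\<close>

lemma MSP_kernel_finite:
  assumes X: "Metric_space X d" and R: "R > 0" and S: "S > 0" and F: "finite F" "F \<subseteq> X"
    and msp: "\<And>\<mu>. \<mu> \<in> prob_measures X \<Longrightarrow> sparsified X d c R S \<mu>"
  shows "\<exists>k\<in>cut_kernels X d R (S + R). \<forall>x\<in>F. k (x, x) \<ge> c"
proof -
  let ?C = "cut_kernels X d R (S + R)"
  have family: "\<exists>k\<in>?C. \<forall>x\<in>\<Union>P. k (x, x) = 1"
    if P: "partition_on \<Omega> P" "\<Omega> \<subseteq> X" "\<forall>A\<in>P. set_diam d A \<le> ennreal S"
      "\<forall>A\<in>P. \<forall>B\<in>P. A \<noteq> B \<longrightarrow> set_dist d A B > ennreal R" for \<Omega> P
  proof (rule separated_family_kernel[OF X R S])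
    show "A \<subseteq> X" if "A \<in> P" for A using P that by (auto simp: partition_on_def)
    show "{} \<notin> P" using P by (simp add: partition_on_def)
    show "d x y \<le> S" if "A \<in> P" "x \<in> A" "y \<in> A" for A x y
      using P(3) that S by (simp add: set_diam_le_iff)
    show "d x y > R" if "A \<in> P" "B \<in> P" "A \<noteq> B" "x \<in> A" "y \<in> B" for A B x y
      using P(4) that by (auto intro: set_dist_greaterD)
  qed
  define \<Phi> where "\<Phi> k = (\<Sum>x\<in>F. (max 0 (c - k (x, x)))\<^sup>2)" for k :: "'a \<times> 'a \<Rightarrow> real"
  have coord[continuous_intros]: "continuous_on S (\<lambda>k :: 'a \<times> 'a \<Rightarrow> real. k p)" for S p
    by (rule continuous_on_subset[OF continuous_on_product_coordinates subset_UNIV])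
  have "continuous_on ?C \<Phi>" unfolding \<Phi>_def by (intro continuous_intros)
  moreover have "?C \<noteq> {}"
  proof -
    have "partition_on {} ({} :: 'a set set)" by (simp add: partition_on_def)
    from family[OF this] show ?thesis by auto
  qed
  ultimately obtain k where k: "k \<in> ?C" and min: "\<And>l. l \<in> ?C \<Longrightarrow> \<Phi> k \<le> \<Phi> l"
    using continuous_attains_inf[OF compact_cut_kernels] by blast
  define w where "w x = max 0 (c - k (x, x))" for x
  have w: "w x \<ge> 0" for x by (simp add: w_def)
  show ?thesis
  proof (cases "sum w F > 0")
    case False
    have "sum w F = 0" using False sum_nonneg[of F w] w by force
    then have "\<forall>x\<in>F. w x = 0" using sum_nonneg_eq_0_iff[OF F(1)] w by blast
    then have "c \<le> k (x, x)" if "x \<in> F" for x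
      using that max.cobounded2[of "c - k (x, x)" 0] by (simp add: w_def)
    with k show ?thesis by blast
  next
    case True
    obtain \<mu> where \<mu>: "set_pmf \<mu> \<subseteq> F" "\<forall>x\<in>F. pmf \<mu> x = w x / sum w F"
      using finite_weights_pmf[OF F(1) w True] by (elim exE conjE) (rule that)
    have \<mu>X: "\<mu> \<in> prob_measures X" using \<mu>(1) F(2) by (simp add: prob_measures_def)
    obtain \<Omega> P where P: "\<Omega> \<subseteq> X" "partition_on \<Omega> P"
      "measure_pmf.prob \<mu> \<Omega> \<ge> c" "\<forall>A\<in>P. set_diam d A \<le> ennreal S"
      "\<forall>A\<in>P. \<forall>B\<in>P. A \<noteq> B \<longrightarrow> set_dist d A B > ennreal R"
      using msp[OF \<mu>X] unfolding sparsified_def by (elim exE conjE) (rule that)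
    have "\<Union>P = \<Omega>" using P(2) by (simp add: partition_on_def)
    with family[OF P(2,1,4,5)] obtain l where l: "l \<in> ?C" "\<forall>x\<in>\<Omega>. l (x, x) = 1" by auto
    have l01: "0 \<le> l p" "l p \<le> 1" and k01: "0 \<le> k p" "k p \<le> 1" for p
      using l(1) k by (simp_all add: cut_kernels_def del: split_paired_All)
    define \<eta> where "\<eta> = (\<Sum>x\<in>F. (w x)\<^sup>2)"
    define \<Delta> where "\<Delta> x = l (x, x) - k (x, x)" for x
    have \<eta>_pos: "\<eta> > 0"
    proof -
      have "sum w F \<noteq> 0" using True by simp
      then obtain x where "x \<in> F" "w x \<noteq> 0" by (rule sum.not_neutral_contains_not_neutral)
      then show ?thesis unfolding \<eta>_def using F by (intro sum_pos2[of _ x]) auto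
    qed
    \<comment> \<open>The diagonal of \<open>l\<close> averages to at least the measure of
      \<open>\<Omega>\<close>, hence to at least \<open>c\<close>, while that of \<open>k\<close>
      misses \<open>c\<close> by exactly \<open>w x\<close> wherever the weight is positive.\<close>
    have gain: "(\<Sum>x\<in>F. w x * \<Delta> x) \<ge> \<eta>"
    proof -
      have "measure_pmf.prob \<mu> \<Omega> = measure_pmf.prob \<mu> (\<Omega> \<inter> F)"
        using \<mu>(1) measure_Int_set_pmf[of \<mu> \<Omega>] measure_Int_set_pmf[of \<mu> "\<Omega> \<inter> F"]
        by (simp add: inf.absorb2 Int_assoc)
      also have "\<dots> = (\<Sum>x\<in>\<Omega> \<inter> F. pmf \<mu> x)" using F by (simp add: measure_measure_pmf_finite)
      also have "\<dots> = (\<Sum>x\<in>\<Omega> \<inter> F. w x) / sum w F"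
        using \<mu>(2) by (simp add: sum_divide_distrib)
      finally have "c * sum w F \<le> (\<Sum>x\<in>\<Omega> \<inter> F. w x)" using P(3) True by (simp add: pos_le_divide_eq)
      also have "\<dots> = (\<Sum>x\<in>\<Omega> \<inter> F. w x * l (x, x))" using l(2) by simp
      also have "\<dots> \<le> (\<Sum>x\<in>F. w x * l (x, x))"
        using F w l01 by (intro sum_mono2) auto
      finally have "(\<Sum>x\<in>F. w x * (c - k (x, x))) \<le> (\<Sum>x\<in>F. w x * \<Delta> x)"
        by (simp add: \<Delta>_def right_diff_distrib sum_subtractf sum_distrib_left mult.commute)
      also have "(\<Sum>x\<in>F. w x * (c - k (x, x))) = \<eta>"
        unfolding \<eta>_def by (intro sum.cong refl) (auto simp: w_def max_def power2_eq_square)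
      finally show ?thesis .
    qed
    \<comment> \<open>Small enough for the quadratic error \<open>t\<^sup>2 * card F\<close> to stay
      below half of the first-order gain \<open>2 * t * \<eta>\<close>, and at most 1 for
      convexity.\<close>
    define t where "t = \<eta> / (\<eta> + real (card F))"
    have t: "0 < t" "t \<le> 1" "t * real (card F) \<le> \<eta>"
      using \<eta>_pos by (auto simp: t_def field_simps add_pos_nonneg)
    define l' where "l' p = (1 - t) * k p + t * l p" for p
    have "l' \<in> ?C"
      unfolding l'_def using cut_kernels_convex[OF k l(1), of t] t by simp
    from min[OF this] have "\<Phi> k \<le> \<Phi> l'" .
    also have "\<Phi> l' \<le> (\<Sum>x\<in>F. (w x - t * \<Delta> x)\<^sup>2)"
      unfolding \<Phi>_def
    proof (rule sum_mono)
      fix x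
      have eq: "c - l' (x, x) = (c - k (x, x)) - t * \<Delta> x"
        by (simp add: l'_def \<Delta>_def algebra_simps)
      \<comment> \<open>Clipping at 0 is harmless: \<open>c - k (x, x)\<close> is at most
        \<open>w x\<close>, so the clipped value lies between 0 and the positive part of
        \<open>w x - t * \<Delta> x\<close>.\<close>
      have "\<bar>max 0 (c - l' (x, x))\<bar> \<le> \<bar>w x - t * \<Delta> x\<bar>"
        unfolding eq w_def by linarith
      then show "(max 0 (c - l' (x, x)))\<^sup>2 \<le> (w x - t * \<Delta> x)\<^sup>2"
        by (simp only: abs_le_square_iff)
    qed
    also have "\<dots> = \<Phi> k - 2 * t * (\<Sum>x\<in>F. w x * \<Delta> x) + t\<^sup>2 * (\<Sum>x\<in>F. (\<Delta> x)\<^sup>2)"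
      by (simp add: \<Phi>_def w_def[symmetric] power2_diff sum.distrib sum_subtractf sum_distrib_left
          power_mult_distrib algebra_simps)
    also have "\<dots> \<le> \<Phi> k - 2 * t * \<eta> + t\<^sup>2 * real (card F)"
    proof -
      have "(\<Delta> x)\<^sup>2 \<le> 1" for x
        using l01[of "(x, x)"] k01[of "(x, x)"] by (simp add: \<Delta>_def abs_square_le_1)
      then have "(\<Sum>x\<in>F. (\<Delta> x)\<^sup>2) \<le> (\<Sum>x\<in>F. 1)" by (intro sum_mono)
      then have "t\<^sup>2 * (\<Sum>x\<in>F. (\<Delta> x)\<^sup>2) \<le> t\<^sup>2 * real (card F)" by (intro mult_left_mono) auto
      moreover have "2 * t * \<eta> \<le> 2 * t * (\<Sum>x\<in>F. w x * \<Delta> x)"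
        using gain t by (intro mult_left_mono) auto
      ultimately show ?thesis by linarith
    qed
    also have "t\<^sup>2 * real (card F) \<le> t * \<eta>"
      using t by (simp add: power2_eq_square mult.assoc)
    finally have "t * \<eta> \<le> 0" by (simp add: mult.commute)
    with t \<eta>_pos show ?thesis by (simp add: mult_le_0_iff)
  qed
qed

text \<open>The finite intersection property passes from finite sets of points to all of
  \<open>X\<close>, with the same \<open>c\<close> at every scale. At scale \<open>2^n\<close> the
  squared feature distance is at most \<open>8 * (d x y)\<^sup>2 / 4^n\<close>; replacing 4^-n by
  2^-n and summing gives the 16.\<close>

lemma MSP_imp_CE:
  assumes bg: "bounded_geometry X d" and msp: "MSP X d"
  shows "CE X d"
proof -
  interpret Metric_space X d by (rule bounded_geometry_metric[OF bg])
  from msp obtain c where c: "c > 0" and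
    dec: "\<And>R. R > 0 \<Longrightarrow> \<exists>S>0. \<forall>\<mu>\<in>prob_measures X. sparsified X d c R S \<mu>"
    unfolding MSP_iff_sparsified by blast
  have "\<exists>T. \<exists>k\<in>cut_kernels X d R T. \<forall>x\<in>X. k (x, x) \<ge> c" if R: "R > 0" for R
  proof -
    from dec[OF R] obtain S where S: "S > 0" and
      S': "\<And>\<mu>. \<mu> \<in> prob_measures X \<Longrightarrow> sparsified X d c R S \<mu>" by blast
    have coord: "continuous_on UNIV (\<lambda>k :: 'a \<times> 'a \<Rightarrow> real. k p)" for p
      by (rule continuous_on_product_coordinates)
    have "cut_kernels X d R (S + R) \<inter> \<Inter>((\<lambda>x. {k. c \<le> k (x, x)}) ` X) \<noteq> {}"
    proof (rule compact_imp_fip_image[OF compact_cut_kernels])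
      show "closed {k :: 'a \<times> 'a \<Rightarrow> real. c \<le> k (x, x)}" for x
        by (intro closed_Collect_le continuous_intros coord)
      fix F assume "finite F" "F \<subseteq> X"
      from MSP_kernel_finite[OF Metric_space_axioms R S this S']
      show "cut_kernels X d R (S + R) \<inter> (\<Inter>x\<in>F. {k. c \<le> k (x, x)}) \<noteq> {}" by blast
    qed
    then show ?thesis by blast
  qed
  then have "\<exists>T k. k \<in> cut_kernels X d (2^n) T \<and> (\<forall>x\<in>X. k (x, x) \<ge> c)" for n :: nat
    by (metis zero_less_numeral zero_less_power)
  then obtain T k where k: "\<And>n. k n \<in> cut_kernels X d (2^n) (T n)"
    and k_diag: "\<And>n x. x \<in> X \<Longrightarrow> k n (x, x) \<ge> c" by metis
  show ?thesis
  proof (rule CE_kernels[where K = "\<lambda>n. curry (k n)" and \<rho> = "\<lambda>t. 16 * t\<^sup>2" and \<delta> = "2 * c" and T = T])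
    show "psd X (curry (k n))" for n using k[of n] by (simp add: cut_kernels_def)
    fix x y assume xy: "x \<in> X" "y \<in> X"
    fix N :: nat
    have "(\<Sum>n<N. curry (k n) x x + curry (k n) y y - 2 * curry (k n) x y)
        \<le> (\<Sum>n<N. 8 * (d x y)\<^sup>2 * (1/2)^n)"
    proof (rule sum_mono)
      fix n
      have "curry (k n) x x + curry (k n) y y - 2 * curry (k n) x y \<le> 8 * (d x y / 2^n)\<^sup>2"
        using k[of n] xy by (simp add: cut_kernels_def)
      also have "\<dots> = 8 * (d x y)\<^sup>2 * ((1/2)^n * (1/2)^n)"
        by (simp add: power_divide power2_eq_square)
      also have "\<dots> \<le> 8 * (d x y)\<^sup>2 * ((1/2)^n * 1)"
        by (intro mult_left_mono) (auto simp: power_le_one)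
      finally show "curry (k n) x x + curry (k n) y y - 2 * curry (k n) x y \<le> 8 * (d x y)\<^sup>2 * (1/2)^n"
        by simp
    qed
    also have "\<dots> = 8 * (d x y)\<^sup>2 * (\<Sum>n<N. (1/2)^n)" by (simp add: sum_distrib_left)
    also have "\<dots> \<le> 8 * (d x y)\<^sup>2 * 2"
      using sum_le_suminf[of "\<lambda>n. (1/2 :: real)^n" "{..<N}"]
      by (intro mult_left_mono) (simp_all add: suminf_geometric)
    finally show "(\<Sum>n<N. curry (k n) x x + curry (k n) y y - 2 * curry (k n) x y) \<le> 16 * (d x y)\<^sup>2"
      by simp
  next
    fix n x y assume xy: "x \<in> X" "y \<in> X" "T n < d x y"
    have "k n (x, y) = 0" using k[of n] xy by (simp add: cut_kernels_def)
    then show "2 * c \<le> curry (k n) x x + curry (k n) y y - 2 * curry (k n) x y"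
      using k_diag[OF xy(1), of n] k_diag[OF xy(2), of n] by simp
  qed (use c bounded_geometry_countable[OF bg] in \<open>auto simp: mono_on_def intro: power_mono\<close>)
qed

section \<open>Homology covers of cubic graphs of large girth\<close>

text \<open>Points are natural numbers, read as finite sets of edge codes; this is the Hamming
  distance of binary expansions. All covers thus live in one ambient metric space.\<close>

definition hdist :: "nat \<Rightarrow> nat \<Rightarrow> real" where
  "hdist x y = real (card (sym_diff (set_decode x) (set_decode y)))"

lemma hdist_commute: "hdist x y = hdist y x"
  by (simp add: hdist_def Un_commute)

lemma Metric_space_hdist: "Metric_space X hdist"
proof
  fix x y z :: nat
  show "0 \<le> hdist x y" by (simp add: hdist_def)
  show "hdist x y = hdist y x" by (rule hdist_commute)
  have "set_decode x = set_decode y \<longleftrightarrow> x = y" by (metis set_decode_inverse)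
  then show "hdist x y = 0 \<longleftrightarrow> x = y" by (auto simp: hdist_def)
  have "card (sym_diff (set_decode x) (set_decode z))
      \<le> card (sym_diff (set_decode x) (set_decode y) \<union> sym_diff (set_decode y) (set_decode z))"
    by (intro card_mono) auto
  also have "\<dots> \<le> card (sym_diff (set_decode x) (set_decode y)) + card (sym_diff (set_decode y) (set_decode z))"
    by (rule card_Un_le)
  finally show "hdist x z \<le> hdist x y + hdist y z"
    unfolding hdist_def by linarith
qed

lemma CE_hdist: "CE X hdist"
proof (rule CE_coordinates[where g = "\<lambda>x k. of_bool (k \<in> set_decode x)" and \<rho>\<^sub>1 = "\<lambda>t. t" and \<rho>\<^sub>2 = "\<lambda>t. t"])
  fix x y :: nat
  let ?D = "sym_diff (set_decode x) (set_decode y)"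
  have "(\<lambda>k. (of_bool (k \<in> set_decode x) - of_bool (k \<in> set_decode y))\<^sup>2) = (\<lambda>k. if k \<in> ?D then 1 else 0 :: real)"
    by auto
  moreover have "(\<lambda>k. if k \<in> ?D then 1 else 0 :: real) sums (\<Sum>k\<in>?D. 1)"
    by (rule sums_If_finite_set) simp
  ultimately have *: "(\<lambda>k. (of_bool (k \<in> set_decode x) - of_bool (k \<in> set_decode y))\<^sup>2) sums hdist x y"
    by (simp add: hdist_def)
  then show "summable (\<lambda>k. (of_bool (k \<in> set_decode x) - of_bool (k \<in> set_decode y) :: real)\<^sup>2)"
    "hdist x y \<le> (\<Sum>k. (of_bool (k \<in> set_decode x) - of_bool (k \<in> set_decode y))\<^sup>2)"
    "(\<Sum>k. (of_bool (k \<in> set_decode x) - of_bool (k \<in> set_decode y))\<^sup>2) \<le> hdist x y"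
    by (auto simp: sums_iff)
qed (auto simp: mono_on_def filterlim_ident)

lemma odd_card_sym_diff:
  assumes "finite A" "finite B"
  shows "odd (card (sym_diff A B)) \<longleftrightarrow> odd (card A) \<noteq> odd (card B)"
proof -
  have "card A = card (A - B) + card (A \<inter> B)"
    using assms by (metis card_Diff_subset_Int card_mono finite_Int inf_le1 le_add_diff_inverse2)
  moreover have "card B = card (B - A) + card (A \<inter> B)"
    using assms by (metis card_Diff_subset_Int card_mono finite_Int inf_le2 le_add_diff_inverse2 Int_commute)
  moreover have "card (sym_diff A B) = card (A - B) + card (B - A)"
    using assms by (intro card_Un_disjoint) auto
  ultimately show ?thesis by simp presburger
qed

text \<open>The colours act by involutions, so equal adjacent letters are the only
  cancellation.\<close>

definition reduced_word :: "nat list \<Rightarrow> bool" where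
  "reduced_word w \<longleftrightarrow> set w \<subseteq> {..<3} \<and> distinct_adj w"

text \<open>A cubic graph on \<open>W\<close> whose edges are properly coloured by \<open>{0, 1, 2}\<close>; the involution \<open>p i\<close>
  crosses the edge of colour \<open>i\<close>. The girth assumption is stated for closed walks.\<close>

locale cubic_graph =
  fixes W :: "nat set" and p :: "nat \<Rightarrow> nat \<Rightarrow> nat" and r :: nat and v0 :: nat
  assumes finite_W: "finite W" and v0: "v0 \<in> W"
    and p_in: "i < 3 \<Longrightarrow> v \<in> W \<Longrightarrow> p i v \<in> W"
    and p_p: "i < 3 \<Longrightarrow> v \<in> W \<Longrightarrow> p i (p i v) = v"
    and girth: "v \<in> W \<Longrightarrow> reduced_word w \<Longrightarrow> w \<noteq> [] \<Longrightarrow> length w \<le> Suc r \<Longrightarrow> fold p w v \<noteq> v"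
begin

text \<open>The minimum gives both ends of an edge the same code; the tag \<open>r\<close> separates
  the edges of different graphs of the tower.\<close>

definition edge :: "nat \<Rightarrow> nat \<Rightarrow> nat" where
  "edge i v = prod_encode (r, prod_encode (i, min v (p i v)))"

definition edges :: "nat set" where
  "edges = {edge i v | i v. i < 3 \<and> v \<in> W}"

lemma p_ne: "i < 3 \<Longrightarrow> v \<in> W \<Longrightarrow> p i v \<noteq> v"
  using girth[of v "[i]"] by (simp add: reduced_word_def)

lemma edge_p: "i < 3 \<Longrightarrow> v \<in> W \<Longrightarrow> edge i (p i v) = edge i v"
  by (simp add: edge_def p_p min.commute)

lemma edge_eq_iff:
  assumes "i < 3" "j < 3" "u \<in> W" "v \<in> W"
  shows "edge j u = edge i v \<longleftrightarrow> j = i \<and> (u = v \<or> u = p i v)"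
proof
  assume "edge j u = edge i v"
  then have "j = i" and m: "min u (p i u) = min v (p i v)" by (auto simp: edge_def)
  from m have "u = v \<or> u = p i v \<or> p i u = v \<or> p i u = p i v" by (auto simp: min_def split: if_splits)
  then have "u = v \<or> u = p i v" using p_p[OF assms(1,3)] p_p[OF assms(1,4)] by metis
  with \<open>j = i\<close> show "j = i \<and> (u = v \<or> u = p i v)" by blast
next
  assume "j = i \<and> (u = v \<or> u = p i v)"
  then show "edge j u = edge i v" using edge_p assms by auto
qed

lemma finite_edges: "finite edges"
proof (rule finite_subset)
  show "edges \<subseteq> (\<lambda>(i, v). edge i v) ` ({..<3} \<times> W)" by (auto simp: edges_def)
qed (use finite_W in auto)

section \<open>Mod 2 boundaries of edge sets, and trails\<close>

definition odd_at :: "nat set \<Rightarrow> nat \<Rightarrow> bool" where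
  "odd_at s u \<longleftrightarrow> odd (card {i. i < 3 \<and> edge i u \<in> s})"

lemma odd_at_sym_diff: "odd_at (sym_diff s t) u \<longleftrightarrow> odd_at s u \<noteq> odd_at t u"
proof -
  have "{i. i < 3 \<and> edge i u \<in> sym_diff s t}
      = sym_diff {i. i < 3 \<and> edge i u \<in> s} {i. i < 3 \<and> edge i u \<in> t}" by auto
  then show ?thesis unfolding odd_at_def by (simp only:) (rule odd_card_sym_diff; simp)
qed

lemma odd_at_edge:
  assumes "i < 3" "u \<in> W" "v \<in> W"
  shows "odd_at {edge i v} u \<longleftrightarrow> (u = v) \<noteq> (u = p i v)"
proof -
  have "{j. j < 3 \<and> edge j u \<in> {edge i v}} = (if u = v \<or> u = p i v then {i} else {})"
    using assms edge_eq_iff by auto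
  moreover have "p i v \<noteq> v" using assms by (intro p_ne)
  ultimately show ?thesis by (auto simp: odd_at_def)
qed

text \<open>The mod 2 chain \<open>D\<close> has boundary \<open>g + h\<close>, which is zero for
  \<open>g = h\<close>.\<close>

definition boundary :: "nat set \<Rightarrow> nat \<Rightarrow> nat \<Rightarrow> bool" where
  "boundary D g h \<longleftrightarrow> (\<forall>u\<in>W. odd_at D u \<longleftrightarrow> (u = g) \<noteq> (u = h))"

lemma boundary_step:
  assumes "boundary D g h" "i < 3" "g \<in> W"
  shows "boundary (sym_diff D {edge i g}) (p i g) h"
  using assms odd_at_edge unfolding boundary_def odd_at_sym_diff by blast

fun trail :: "nat \<Rightarrow> nat list \<Rightarrow> nat list" where
  "trail g [] = []"
| "trail g (i # w) = edge i g # trail (p i g) w"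

lemma length_trail [simp]: "length (trail g w) = length w"
  by (induction w arbitrary: g) auto

lemma nth_trail: "k < length w \<Longrightarrow> trail g w ! k = edge (w ! k) (fold p (take k w) g)"
  by (induction w arbitrary: g k) (auto simp: nth_Cons' take_Cons')

lemma fold_p_in: "set w \<subseteq> {..<3} \<Longrightarrow> g \<in> W \<Longrightarrow> fold p w g \<in> W"
  by (induction w arbitrary: g) (auto simp: p_in)

text \<open>Two equal adjacent colours would cross the same edge twice.\<close>

lemma trail_reduced:
  "set w \<subseteq> {..<3} \<Longrightarrow> g \<in> W \<Longrightarrow> distinct (trail g w) \<Longrightarrow> reduced_word w"
proof (induction w arbitrary: g)
  case (Cons i w)
  then have "reduced_word w" using Cons.IH[of "p i g"] by (simp add: p_in)
  moreover have "w = [] \<or> i \<noteq> hd w"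
  proof (cases w)
    case (Cons j w')
    then have "edge j (p i g) \<noteq> edge i g" using Cons.prems by auto
    then show ?thesis using Cons Cons.prems edge_p[of i g] by auto
  qed simp
  ultimately show ?case using Cons.prems by (auto simp: reduced_word_def distinct_adj_Cons)
qed (simp add: reduced_word_def)

lemma boundary_trail:
  "set w \<subseteq> {..<3} \<Longrightarrow> g \<in> W \<Longrightarrow> distinct (trail g w) \<Longrightarrow> boundary (set (trail g w)) g (fold p w g)"
proof (induction w arbitrary: g)
  case Nil
  then show ?case by (simp add: boundary_def odd_at_def)
next
  case (Cons i w)
  then have IH: "boundary (set (trail (p i g) w)) (p i g) (fold p w (p i g))" by (simp add: p_in)
  from Cons.prems have i: "i < 3" and g: "g \<in> W" and e: "edge i g \<notin> set (trail (p i g) w)" by auto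
  have "edge i (p i g) = edge i g" "p i (p i g) = g" using i g by (auto simp: edge_p p_p)
  with boundary_step[OF IH i p_in[OF i g]]
  have "boundary (sym_diff (set (trail (p i g) w)) {edge i g}) g (fold p w (p i g))" by simp
  moreover have "sym_diff (set (trail (p i g) w)) {edge i g} = set (trail g (i # w))" using e by auto
  ultimately show ?case by simp
qed

text \<open>Any edge of \<open>D\<close> at the current vertex is followed and deleted, and the
  first boundary point moves along. A vertex other than \<open>h\<close> has odd degree in what is
  left, so the walk can get stuck only at \<open>h\<close>. The last clause records that it is stuck
  there; it rules out the empty walk when \<open>g = h\<close> has an edge in
  \<open>D\<close>.\<close>

lemma greedy_trail:
  assumes "finite D" "g \<in> W" "h \<in> W" "boundary D g h"
  shows "\<exists>w. set w \<subseteq> {..<3} \<and> distinct (trail g w) \<and> set (trail g w) \<subseteq> D \<and> fold p w g = h \<and>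
             (\<forall>i<3. edge i h \<in> D \<longrightarrow> edge i h \<in> set (trail g w))"
  using assms
proof (induction "card D" arbitrary: D g rule: less_induct)
  case less
  show ?case
  proof (cases "\<exists>i<3. edge i g \<in> D")
    case False
    then have none: "{i. i < 3 \<and> edge i g \<in> D} = {}" by blast
    have "\<not> odd_at D g" unfolding odd_at_def none by simp
    then have "g = h" using less.prems by (auto simp: boundary_def)
    with False show ?thesis by (intro exI[of _ "[]"]) auto
  next
    case True
    then obtain i where i: "i < 3" "edge i g \<in> D" by blast
    define D' where "D' = D - {edge i g}"
    have D': "D' = sym_diff D {edge i g}" using i by (auto simp: D'_def)
    have "boundary D' (p i g) h" unfolding D' using less.prems i by (intro boundary_step)
    moreover have "card D' < card D" unfolding D'_def using i less.prems by (intro card_Diff1_less)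
    ultimately obtain w where w: "set w \<subseteq> {..<3}" "distinct (trail (p i g) w)"
      "set (trail (p i g) w) \<subseteq> D'" "fold p w (p i g) = h"
      "\<forall>j<3. edge j h \<in> D' \<longrightarrow> edge j h \<in> set (trail (p i g) w)"
      using less.hyps[of D' "p i g"] less.prems p_in i by (auto simp: D'_def)
    then show ?thesis using i by (intro exI[of _ "i # w"]) (auto simp: D'_def)
  qed
qed

text \<open>What the greedy trail misses would contain a closed trail, hence a short closed reduced walk.\<close>

lemma short_trail:
  assumes D: "D \<subseteq> edges" "card D \<le> Suc r" and gh: "g \<in> W" "h \<in> W" "boundary D g h"
  shows "\<exists>w. reduced_word w \<and> set (trail g w) = D \<and> length w = card D \<and> fold p w g = h"
proof -
  have fin: "finite D" using D finite_edges finite_subset by blast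
  obtain w where w: "set w \<subseteq> {..<3}" "distinct (trail g w)" "set (trail g w) \<subseteq> D" "fold p w g = h"
    using greedy_trail[OF fin gh] by blast
  define D' where "D' = D - set (trail g w)"
  have even: "\<not> odd_at D' u" if "u \<in> W" for u
  proof -
    have "D' = sym_diff D (set (trail g w))" using w(3) by (auto simp: D'_def)
    then show ?thesis
      using boundary_trail[OF w(1) gh(1) w(2)] gh(3) that w(4)
      by (simp only: odd_at_sym_diff boundary_def)
  qed
  have "D' = {}"
  proof (rule ccontr)
    assume "D' \<noteq> {}"
    then obtain e where "e \<in> D'" by blast
    then obtain i u where iu: "i < 3" "u \<in> W" "edge i u \<in> D'"
      using D(1) unfolding D'_def edges_def by blast
    \<comment> \<open>An even set has zero boundary, so the walk from \<open>u\<close> is closed; it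
      crosses \<open>edge i u\<close> and is therefore nonempty.\<close>
    have "boundary D' u u" using even by (simp add: boundary_def)
    from greedy_trail[OF _ iu(2,2) this] fin obtain w' where
      w': "set w' \<subseteq> {..<3}" "distinct (trail u w')" "set (trail u w') \<subseteq> D'" "fold p w' u = u"
      "edge i u \<in> set (trail u w')" using iu by (auto simp: D'_def)
    have "length w' = card (set (trail u w'))" using distinct_card[OF w'(2)] by simp
    also have "\<dots> \<le> card D" using w'(3) fin by (intro card_mono) (auto simp: D'_def)
    finally have "length w' \<le> Suc r" using D by simp
    moreover have "w' \<noteq> []" using w'(5) by auto
    ultimately show False using girth[OF iu(2) trail_reduced[OF w'(1) iu(2) w'(2)]] w'(4) by blast
  qed
  then have "set (trail g w) = D" using w(3) by (auto simp: D'_def)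
  moreover have "length w = card D" using distinct_card[OF w(2)] calculation by simp
  ultimately show ?thesis using w(4) trail_reduced[OF w(1) gh(1) w(2)] by blast
qed

lemma reduced_take: "reduced_word w \<Longrightarrow> reduced_word (take k w)"
  by (auto simp: reduced_word_def distinct_adj_conv_nth dest: in_set_takeD)

text \<open>\<open>D\<close> consists of the edges of a short reduced walk from \<open>g\<close>.
  Only its first edge can touch \<open>g\<close>: a later one would bring the walk back to
  \<open>g\<close> and close a reduced walk that the girth forbids.\<close>

lemma at_most_one_edge:
  assumes D: "D \<subseteq> edges" "card D \<le> Suc r" and gh: "g \<in> W" "h \<in> W" "boundary D g h"
    and ij: "i < 3" "j < 3" "edge i g \<in> D" "edge j g \<in> D"
  shows "i = j"
proof -
  from short_trail[OF D gh] obtain w where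
    w: "reduced_word w" "set (trail g w) = D" "length w = card D" by blast
  have closed: "k = 0" if "fold p (take k w) g = g" "k \<le> length w" for k
    using girth[OF gh(1) reduced_take[OF w(1), of k]] that w(3) D(2) by (cases w) auto
  have "w ! 0 = l" if "l < 3" "edge l g \<in> D" for l
  proof -
    from that w(2) obtain k where k: "k < length w" "trail g w ! k = edge l g"
      by (metis in_set_conv_nth length_trail)
    define u where "u = fold p (take k w) g"
    have wk: "w ! k < 3" using w(1) k(1) by (auto simp: reduced_word_def subset_iff)
    have "set (take k w) \<subseteq> {..<3}" using reduced_take[OF w(1), of k] by (simp add: reduced_word_def)
    then have u: "u \<in> W" unfolding u_def using gh(1) by (rule fold_p_in)
    have "edge (w ! k) u = edge l g" using k nth_trail[OF k(1)] by (simp add: u_def)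
    \<comment> \<open>The edge is crossed either away from \<open>g\<close>, which closes a prefix
      of length \<open>k\<close>, or into \<open>g\<close>, which closes one of length
      \<open>k + 1\<close>.\<close>
    then have eq: "w ! k = l" "u = g \<or> u = p l g"
      using edge_eq_iff[OF that(1) wk u gh(1)] by auto
    have "u \<noteq> p l g"
    proof
      assume "u = p l g"
      then have "fold p (take (Suc k) w) g = g"
        using k(1) eq(1) p_p[OF that(1) gh(1)] by (simp add: take_Suc_conv_app_nth u_def)
      with closed[of "Suc k"] k(1) show False by simp
    qed
    with eq have "k = 0" using closed[of k] k(1) by (auto simp: u_def)
    with eq show ?thesis by simp
  qed
  with ij show ?thesis by metis
qed

text \<open>Marker codes with colour 3, which no edge has. Every point of this cover contains them
  and no point of a cover with another tag does, which keeps such covers at distance at least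
  \<open>r\<close>.\<close>

definition base :: "nat set" where
  "base = (\<lambda>j. prod_encode (r, prod_encode (3, j))) ` {..<r}"

section \<open>The homology cover and its neighbour maps\<close>

inductive cover :: "nat set \<Rightarrow> nat \<Rightarrow> bool" where
  base: "cover base v0"
| step: "cover s v \<Longrightarrow> i < 3 \<Longrightarrow> cover (sym_diff s {edge i v}) (p i v)"

lemma base_edges: "base \<inter> edges = {}" "finite base" "card base = r"
  by (auto simp: base_def edges_def edge_def card_image inj_on_def)

lemma cover_props:
  "cover s v \<Longrightarrow> v \<in> W \<and> base \<subseteq> s \<and> s \<subseteq> base \<union> edges \<and> boundary s v0 v"
proof (induction rule: cover.induct)
  case base
  have none: "{i. i < 3 \<and> edge i u \<in> base} = {}" for u by (auto simp: base_def edge_def)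
  have "\<not> odd_at base u" for u unfolding odd_at_def none by simp
  then show ?case using v0 by (simp add: boundary_def)
next
  case (step s v i)
  then have "edge i v \<in> edges" by (auto simp: edges_def)
  moreover have "boundary (sym_diff s {edge i v}) v0 (p i v)"
    using boundary_step[of s v v0 i] step by (auto simp: boundary_def)
  ultimately show ?case using step base_edges p_in by auto
qed

lemma cover_finite: "cover s v \<Longrightarrow> finite s"
  using cover_props base_edges(2) finite_edges by (meson finite_UnI finite_subset)

lemma cover_diff:
  assumes "cover s v" "cover t u"
  shows "sym_diff s t \<subseteq> edges" "boundary (sym_diff s t) v u"
  using cover_props[OF assms(1)] cover_props[OF assms(2)]
  by (auto simp only: boundary_def odd_at_sym_diff)

text \<open>The boundary of \<open>s\<close> is \<open>v0 + v\<close>, so \<open>s\<close>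
  determines \<open>v\<close>.\<close>

lemma cover_unique: "cover s v \<Longrightarrow> cover s u \<Longrightarrow> v = u"
  using cover_diff(2)[of s v s u] cover_props[of s v] by (auto simp: boundary_def odd_at_def)

definition V :: "nat set" where "V = {x. \<exists>v. cover (set_decode x) v}"

definition proj :: "nat \<Rightarrow> nat" where "proj x = (THE v. cover (set_decode x) v)"

text \<open>The lift of \<open>p i\<close>: prolonging the walk by one step toggles the edge
  crossed.\<close>

definition act :: "nat \<Rightarrow> nat \<Rightarrow> nat" where
  "act i x = set_encode (sym_diff (set_decode x) {edge i (proj x)})"

lemma cover_proj: "x \<in> V \<Longrightarrow> cover (set_decode x) (proj x)"
  unfolding V_def proj_def using cover_unique by (auto intro: theI)

lemma proj_eq: "cover (set_decode x) v \<Longrightarrow> proj x = v"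
  unfolding proj_def using cover_unique by blast

lemma V_I: "cover s v \<Longrightarrow> set_encode s \<in> V"
  using cover_finite by (auto simp: V_def)

lemma proj_in: "x \<in> V \<Longrightarrow> proj x \<in> W"
  using cover_proj cover_props by blast

lemma decode_act: "set_decode (act i x) = sym_diff (set_decode x) {edge i (proj x)}"
  unfolding act_def by (rule set_encode_inverse) simp

lemma cover_act: "x \<in> V \<Longrightarrow> i < 3 \<Longrightarrow> cover (set_decode (act i x)) (p i (proj x))"
  unfolding decode_act by (intro cover.step cover_proj)

lemma act_in: "x \<in> V \<Longrightarrow> i < 3 \<Longrightarrow> act i x \<in> V"
  using cover_act by (auto simp: V_def)

lemma act_act:
  assumes "x \<in> V" "i < 3" shows "act i (act i x) = x"
proof -
  have "set_decode (act i (act i x)) = set_decode x"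
    unfolding decode_act[of i "act i x"] proj_eq[OF cover_act[OF assms]]
    using assms proj_in by (auto simp: edge_p decode_act)
  then show ?thesis by (metis set_decode_inverse)
qed

lemma hdist_act:
  assumes "x \<in> V" "z \<in> V" "i < 3"
  shows "hdist (act i x) z =
    (if edge i (proj x) \<in> sym_diff (set_decode x) (set_decode z) then hdist x z - 1 else hdist x z + 1)"
proof -
  let ?D = "sym_diff (set_decode x) (set_decode z)" and ?e = "edge i (proj x)"
  have "sym_diff (set_decode (act i x)) (set_decode z) = (if ?e \<in> ?D then ?D - {?e} else insert ?e ?D)"
    unfolding decode_act by auto
  moreover have "card (?D - {?e}) = card ?D - 1" "card ?D \<ge> 1" if "?e \<in> ?D"
    using that by (auto simp: card_gt_0_iff Suc_le_eq intro!: card_Diff_singleton)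
  moreover have "card (insert ?e ?D) = Suc (card ?D)" if "?e \<notin> ?D"
    using that by (intro card_insert_disjoint) auto
  ultimately show ?thesis unfolding hdist_def by (simp add: of_nat_diff)
qed

text \<open>The tree property. The range is \<open>r + 1\<close> rather than \<open>r\<close> in
  order to include the neighbours of the support of a function living within distance
  \<open>r\<close> of \<open>z\<close>.\<close>

lemma at_most_one_closer:
  assumes "x \<in> V" "z \<in> V" "hdist x z \<le> real r + 1" "i < 3" "j < 3"
    and "hdist (act i x) z < hdist x z" "hdist (act j x) z < hdist x z"
  shows "i = j"
proof (rule at_most_one_edge)
  let ?D = "sym_diff (set_decode x) (set_decode z)"
  show "?D \<subseteq> edges" "boundary ?D (proj x) (proj z)"
    using cover_diff[OF cover_proj[OF assms(1)] cover_proj[OF assms(2)]] by simp_all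
  show "card ?D \<le> Suc r" using assms(3) by (simp add: hdist_def)
  show "edge i (proj x) \<in> ?D" "edge j (proj x) \<in> ?D"
    using assms(6,7) hdist_act[OF assms(1,2,4)] hdist_act[OF assms(1,2,5)]
    by (metis less_add_one less_asym)+
qed (use assms proj_in in auto)

lemma finite_V: "finite V" and V_nonempty: "V \<noteq> {}"
proof -
  have "V \<subseteq> set_encode ` Pow (base \<union> edges)"
  proof
    fix x assume "x \<in> V"
    then have "set_decode x \<in> Pow (base \<union> edges)" using cover_proj cover_props by blast
    then show "x \<in> set_encode ` Pow (base \<union> edges)" by (metis image_eqI set_decode_inverse)
  qed
  then show "finite V" by (rule finite_subset) (simp add: base_edges finite_edges)
  show "V \<noteq> {}" using V_I[OF cover.base] by blast
qed

text \<open>Within distance \<open>r\<close> every point is reached by a walk whose length is the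
  distance, so words enumerate the ball. The bound is the same for all graphs, as the bounded
  geometry of their union requires.\<close>

lemma card_ball:
  assumes "x \<in> V" "R \<le> real r"
  shows "card {y\<in>V. hdist x y \<le> R} \<le> card {w. set w \<subseteq> {..<3 :: nat} \<and> length w \<le> nat \<lfloor>R\<rfloor>}"
proof (rule surj_card_le)
  show "finite {w. set w \<subseteq> {..<3 :: nat} \<and> length w \<le> nat \<lfloor>R\<rfloor>}"
    by (intro finite_lists_length_le) auto
  let ?f = "\<lambda>w. set_encode (sym_diff (set_decode x) (set (trail (proj x) w)))"
  show "{y\<in>V. hdist x y \<le> R} \<subseteq> ?f ` {w. set w \<subseteq> {..<3 :: nat} \<and> length w \<le> nat \<lfloor>R\<rfloor>}"
  proof clarify
    fix y assume y: "y \<in> V" "hdist x y \<le> R"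
    let ?D = "sym_diff (set_decode x) (set_decode y)"
    have D: "?D \<subseteq> edges" "boundary ?D (proj x) (proj y)"
      using cover_diff[OF cover_proj[OF assms(1)] cover_proj[OF y(1)]] by simp_all
    have card: "card ?D \<le> nat \<lfloor>R\<rfloor>" "card ?D \<le> Suc r"
      using y(2) assms(2) by (simp_all add: hdist_def le_nat_floor)
    obtain w where w: "reduced_word w" "set (trail (proj x) w) = ?D" "length w = card ?D"
      using short_trail[OF D(1) card(2) proj_in[OF assms(1)] proj_in[OF y(1)] D(2)] by blast
    have "sym_diff (set_decode x) ?D = set_decode y" by auto
    then have "?f w = y" unfolding w(2) by simp
    then show "y \<in> ?f ` {w. set w \<subseteq> {..<3 :: nat} \<and> length w \<le> nat \<lfloor>R\<rfloor>}"
      using w card by (intro image_eqI[of _ _ w]) (auto simp: reduced_word_def)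
  qed
qed

lemma V_decode:
  assumes "x \<in> V"
  shows "base \<subseteq> set_decode x" "k \<in> set_decode x \<Longrightarrow> fst (prod_decode k) = r"
proof -
  have *: "base \<subseteq> set_decode x" "set_decode x \<subseteq> base \<union> edges"
    using cover_props[OF cover_proj[OF assms]] by simp_all
  show "base \<subseteq> set_decode x" by (rule *)
  assume "k \<in> set_decode x"
  then have "k \<in> base \<or> k \<in> edges" using *(2) by blast
  then show "fst (prod_decode k) = r" by (auto simp: base_def edges_def edge_def)
qed

end

section \<open>A tower of covers\<close>

text \<open>Left multiplication by the generator \<open>i\<close> on the ball of radius
  \<open>r + 1\<close> in the cubic tree. A missing edge at a leaf becomes a fixed point, which
  keeps the map an involution.\<close>

definition push :: "nat \<Rightarrow> nat \<Rightarrow> nat list \<Rightarrow> nat list" where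
  "push r i w = (if w \<noteq> [] \<and> hd w = i then tl w else if length w \<le> r then i # w else w)"

definition word_ball :: "nat \<Rightarrow> nat list set" where
  "word_ball r = {w. reduced_word w \<and> length w \<le> Suc r}"

lemma finite_word_ball: "finite (word_ball r)"
proof (rule finite_subset)
  show "word_ball r \<subseteq> {w. set w \<subseteq> {..<3} \<and> length w \<le> Suc r}"
    by (auto simp: word_ball_def reduced_word_def)
qed (simp add: finite_lists_length_le)

lemma push_in: "i < 3 \<Longrightarrow> w \<in> word_ball r \<Longrightarrow> push r i w \<in> word_ball r"
  by (cases w) (auto simp: word_ball_def push_def reduced_word_def distinct_adj_Cons)

lemma push_push: "w \<in> word_ball r \<Longrightarrow> push r i (push r i w) = w"
  by (cases w) (auto simp: word_ball_def push_def reduced_word_def distinct_adj_Cons)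

lemma foldr_push_in: "set w \<subseteq> {..<3} \<Longrightarrow> b \<in> word_ball r \<Longrightarrow> foldr (push r) w b \<in> word_ball r"
  by (induction w) (auto simp: push_in)

text \<open>Starting from the root, a reduced word of length at most \<open>r + 1\<close> meets
  neither cancellation nor the cut-off.\<close>

lemma foldr_push_Nil: "w \<in> word_ball r \<Longrightarrow> foldr (push r) w [] = w"
  by (induction w) (auto simp: word_ball_def push_def reduced_word_def distinct_adj_Cons)

text \<open>Cubic graphs of large girth: the Cayley graph of a group of permutations of a finite tree,
  generated by the three involutions that move along the edges of one colour. A short reduced word
  moves the root and hence acts without fixed points on permutations.\<close>

lemma cubic_graph_exists: "\<exists>W p v0. cubic_graph W p r v0"
proof -
  let ?B = "word_ball r"
  define G where "G = {g \<in> ?B \<rightarrow>\<^sub>E ?B. inj_on g ?B}"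
  \<comment> \<open>Composition on the right, so that \<open>fold q w g\<close> evaluates
    \<open>g\<close> at the point reached by \<open>foldr (push r) w\<close>.\<close>
  define q where "q i g = restrict (\<lambda>w. g (push r i w)) ?B" for i and g :: "nat list \<Rightarrow> nat list"
  have "finite (?B \<rightarrow>\<^sub>E ?B)" by (intro finite_PiE finite_word_ball)
  then have "finite G" by (rule finite_subset[rotated]) (auto simp: G_def)
  then obtain c :: "(nat list \<Rightarrow> nat list) \<Rightarrow> nat" where c: "inj_on c G"
    using finite_imp_inj_to_nat_seg by blast
  define p where "p i v = c (q i (inv_into G c v))" for i v
  have q_in: "q i g \<in> G" if "i < 3" "g \<in> G" for i g
  proof -
    have "inj_on (push r i) ?B" by (rule inj_on_inverseI[where g = "push r i"]) (rule push_push)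
    moreover have "push r i ` ?B \<subseteq> ?B" using push_in that by blast
    ultimately have "inj_on (g \<circ> push r i) ?B"
      using that by (intro comp_inj_on) (auto simp: G_def intro: inj_on_subset)
    then have "inj_on (q i g) ?B" by (simp add: q_def inj_on_def)
    with that push_in show ?thesis by (auto simp: G_def q_def)
  qed
  have q_q: "q i (q i g) = g" if "i < 3" "g \<in> G" for i g
  proof
    fix w show "q i (q i g) w = g w"
    proof (cases "w \<in> ?B")
      case True
      then show ?thesis using push_in[OF that(1)] push_push by (simp add: q_def)
    next
      case False
      then have "g w = undefined" using that(2) by (auto simp: G_def intro: PiE_arb)
      with False show ?thesis by (simp add: q_def)
    qed
  qed
  have fold_q: "fold q w g b = g (foldr (push r) w b) \<and> fold q w g \<in> G"
    if "set w \<subseteq> {..<3}" "g \<in> G" "b \<in> ?B" for w g b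
    using that(1,2)
  proof (induction w arbitrary: g)
    case (Cons i w)
    then have "fold q w (q i g) b = q i g (foldr (push r) w b)" "fold q w (q i g) \<in> G"
      using q_in by auto
    moreover have "foldr (push r) w b \<in> ?B" using Cons.prems that(3) by (intro foldr_push_in) auto
    then have "q i g (foldr (push r) w b) = g (push r i (foldr (push r) w b))" by (simp add: q_def)
    ultimately show ?case by simp
  qed simp
  have p_c: "p i (c g) = c (q i g)" if "g \<in> G" for i g using c that by (simp add: p_def)
  have fold_p: "fold p w (c g) = c (fold q w g)" if "set w \<subseteq> {..<3}" "g \<in> G" for w g
    using that by (induction w arbitrary: g) (auto simp: p_c q_in)
  have id: "restrict (\<lambda>w. w) ?B \<in> G" by (auto simp: G_def inj_on_def)
  have Nil: "[] \<in> ?B" by (simp add: word_ball_def reduced_word_def)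
  have "cubic_graph (c ` G) p r (c (restrict (\<lambda>w. w) ?B))"
  proof
    show "finite (c ` G)" using \<open>finite G\<close> by simp
    show "c (restrict (\<lambda>w. w) ?B) \<in> c ` G" using id by simp
    show "p i v \<in> c ` G" if "i < 3" "v \<in> c ` G" for i v using that q_in p_c by auto
    show "p i (p i v) = v" if "i < 3" "v \<in> c ` G" for i v using that q_in p_c q_q by auto
  next
    fix v w assume "v \<in> c ` G" and w: "reduced_word w" "w \<noteq> []" "length w \<le> Suc r"
    then obtain g where g: "g \<in> G" "v = c g" by blast
    have w3: "set w \<subseteq> {..<3}" and wB: "w \<in> ?B" using w by (auto simp: reduced_word_def word_ball_def)
    show "fold p w v \<noteq> v"
    proof
      assume "fold p w v = v"
      \<comment> \<open>Evaluation at the root: \<open>g\<close> would take the same value at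
        \<open>w\<close> and at \<open>[]\<close>, against injectivity.\<close>
      then have "fold q w g = g" using fold_p[OF w3 g(1)] fold_q[OF w3 g(1) Nil] c g by (auto dest: inj_onD)
      then have "g w = g []" using fold_q[OF w3 g(1) Nil] foldr_push_Nil[OF wB] by simp
      then show False using g(1) wB Nil w(2) by (auto simp: G_def dest: inj_onD)
    qed
  qed
  then show ?thesis by blast
qed

text \<open>All that the estimates use of the covers. The index \<open>n\<close> is also the radius
  up to which \<open>V n\<close> looks like a tree, and \<open>N\<close> bounds balls uniformly in
  \<open>n\<close>.\<close>

locale cubic_tower =
  fixes V :: "nat \<Rightarrow> nat set" and act :: "nat \<Rightarrow> nat \<Rightarrow> nat \<Rightarrow> nat" and N :: "real \<Rightarrow> nat"
  assumes finite_V: "finite (V n)" and V_nonempty: "V n \<noteq> {}"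
    and act_in: "x \<in> V n \<Longrightarrow> i < 3 \<Longrightarrow> act n i x \<in> V n"
    and act_act: "x \<in> V n \<Longrightarrow> i < 3 \<Longrightarrow> act n i (act n i x) = x"
    and hdist_act: "x \<in> V n \<Longrightarrow> z \<in> V n \<Longrightarrow> i < 3 \<Longrightarrow>
      hdist (act n i x) z = hdist x z + 1 \<or> hdist (act n i x) z = hdist x z - 1"
    and at_most_one_closer: "x \<in> V n \<Longrightarrow> z \<in> V n \<Longrightarrow> hdist x z \<le> real n + 1 \<Longrightarrow> i < 3 \<Longrightarrow> j < 3 \<Longrightarrow>
      hdist (act n i x) z < hdist x z \<Longrightarrow> hdist (act n j x) z < hdist x z \<Longrightarrow> i = j"
    and card_ball: "x \<in> V n \<Longrightarrow> R \<le> real n \<Longrightarrow> card {y\<in>V n. hdist x y \<le> R} \<le> N R"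
    and apart: "x \<in> V m \<Longrightarrow> y \<in> V n \<Longrightarrow> m \<noteq> n \<Longrightarrow> real m \<le> hdist x y"

lemma cubic_tower_exists: "\<exists>V act N. cubic_tower V act N"
proof -
  obtain W p v0 where g: "\<And>n. cubic_graph (W n) (p n) n (v0 n)"
    using cubic_graph_exists by metis
  define VV where "VV n = cubic_graph.V (p n) n (v0 n)" for n
  define aa where "aa n = cubic_graph.act (p n) n (v0 n)" for n
  define NN where "NN R = card {w. set w \<subseteq> {..<3 :: nat} \<and> length w \<le> nat \<lfloor>R\<rfloor>}" for R :: real
  have "cubic_tower VV aa NN"
  proof
    fix n x z i j
    interpret cubic_graph "W n" "p n" n "v0 n" by (rule g)
    show "finite (VV n)" "VV n \<noteq> {}" using finite_V V_nonempty by (simp_all add: VV_def)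
    show "aa n i x \<in> VV n" "aa n i (aa n i x) = x" if "x \<in> VV n" "i < 3"
      using that unfolding VV_def aa_def by (auto intro: act_in act_act)
    show "hdist (aa n i x) z = hdist x z + 1 \<or> hdist (aa n i x) z = hdist x z - 1"
      if "x \<in> VV n" "z \<in> VV n" "i < 3"
      using that hdist_act[of x z i] unfolding VV_def aa_def by presburger
    show "i = j" if "x \<in> VV n" "z \<in> VV n" "hdist x z \<le> real n + 1" "i < 3" "j < 3"
      "hdist (aa n i x) z < hdist x z" "hdist (aa n j x) z < hdist x z"
      using that at_most_one_closer[of x z i j] unfolding VV_def aa_def by blast
    show "card {y\<in>VV n. hdist x y \<le> R} \<le> NN R" if "x \<in> VV n" "R \<le> real n" for R
      using that card_ball[of x R] unfolding VV_def NN_def by blast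
  next
    fix m n x y assume x: "x \<in> VV m" and y: "y \<in> VV n" and "m \<noteq> n"
    interpret x: cubic_graph "W m" "p m" m "v0 m" by (rule g)
    interpret y: cubic_graph "W n" "p n" n "v0 n" by (rule g)
    \<comment> \<open>Codes carry their tag, so none of the \<open>m\<close> markers of the first
      cover occurs in \<open>y\<close>.\<close>
    have "k \<notin> set_decode y" if "k \<in> x.base" for k
    proof
      assume "k \<in> set_decode y"
      then have "fst (prod_decode k) = n" using y.V_decode(2)[of y k] y by (simp add: VV_def)
      then show False using that \<open>m \<noteq> n\<close> by (auto simp: x.base_def)
    qed
    then have "x.base \<subseteq> sym_diff (set_decode x) (set_decode y)"
      using x.V_decode(1)[of x] x by (auto simp: VV_def)
    then have "card x.base \<le> card (sym_diff (set_decode x) (set_decode y))"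
      by (intro card_mono) auto
    then show "real m \<le> hdist x y" by (simp add: hdist_def x.base_edges)
  qed
  then show ?thesis by blast
qed

text \<open>Weighted Cauchy-Schwarz: the weight is 2 where \<open>P\<close> holds and 1 elsewhere,
  and the three weights add up to at most 4.\<close>

lemma weighted_square_sum:
  fixes a :: "nat \<Rightarrow> real"
  assumes "\<And>i j. i < 3 \<Longrightarrow> j < 3 \<Longrightarrow> P i \<Longrightarrow> P j \<Longrightarrow> i = j"
  shows "(\<Sum>i<3. a i)\<^sup>2 \<le> 4 * (\<Sum>i<3. (a i)\<^sup>2 / (if P i then 2 else 1))"
proof -
  have *: "(a + b + c)\<^sup>2 \<le> 2 * a\<^sup>2 + 4 * b\<^sup>2 + 4 * c\<^sup>2" for a b c :: real
  proof -
    have "2 * a\<^sup>2 + 4 * b\<^sup>2 + 4 * c\<^sup>2 - (a + b + c)\<^sup>2 = (a - b - c)\<^sup>2 + 2 * (b - c)\<^sup>2"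
      by (simp add: power2_eq_square algebra_simps)
    then show ?thesis by (smt (verit) zero_le_power2)
  qed
  have sum3: "(\<Sum>i<3. f i) = f 0 + f 1 + f 2" for f :: "nat \<Rightarrow> real"
    by (simp add: numeral_3_eq_3 numeral_2_eq_2)
  have unique: "P 0 \<Longrightarrow> \<not> P 1 \<and> \<not> P 2" "P 1 \<Longrightarrow> \<not> P 2"
    using assms[of 0 1] assms[of 0 2] assms[of 1 2] by auto
  consider "P 0" "\<not> P 1" "\<not> P 2" | "\<not> P 0" "P 1" "\<not> P 2" | "\<not> P 0" "\<not> P 1" "P 2"
    | "\<not> P 0" "\<not> P 1" "\<not> P 2"
    using unique by blast
  then show ?thesis
  proof cases
    case 1 then show ?thesis using *[of "a 0" "a 1" "a 2"] by (simp add: sum3)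
  next
    case 2 then show ?thesis using *[of "a 1" "a 0" "a 2"] by (simp add: sum3 add.commute)
  next
    case 3 then show ?thesis using *[of "a 2" "a 0" "a 1"] by (simp add: sum3 add_ac)
  next
    case 4
    have "(a 0 + a 1 + a 2)\<^sup>2 \<le> 4 * ((a 0)\<^sup>2 + (a 1)\<^sup>2 + (a 2)\<^sup>2)"
      by (rule order_trans[OF *]) (simp add: distrib_left)
    with 4 show ?thesis by (simp add: sum3)
  qed
qed

section \<open>Bounded geometry and expansion of the tower\<close>

context cubic_tower
begin

definition X :: "nat set" where "X = (\<Union>n. V n)"

lemma V_X: "V n \<subseteq> X" by (auto simp: X_def)

text \<open>A ball of radius \<open>R\<close> meets a second component only if that component has
  index at most \<open>R\<close>; the finitely many components of small index are counted
  wholesale.\<close>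

lemma bounded_geometry_X: "bounded_geometry X hdist"
proof -
  interpret Metric_space X hdist by (rule Metric_space_hdist)
  have "finite (mcball x R) \<and> card (mcball x R) \<le> N R + card (\<Union>m\<le>nat \<lceil>R\<rceil>. V m)"
    if "R > 0" and x: "x \<in> X" for x R
  proof -
    define B where "B = (\<Union>m\<le>nat \<lceil>R\<rceil>. V m)"
    have B: "finite B" using finite_V by (auto simp: B_def)
    obtain n where n: "x \<in> V n" using x by (auto simp: X_def)
    show ?thesis
    proof (cases "R \<le> real n")
      case True
      have "mcball x R \<subseteq> {y\<in>V n. hdist x y \<le> R} \<union> B"
      proof
        fix y assume y: "y \<in> mcball x R"
        then have "y \<in> X" by simp
        then obtain m where m: "y \<in> V m" by (auto simp: X_def)
        show "y \<in> {y\<in>V n. hdist x y \<le> R} \<union> B"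
        proof (cases "m = n")
          case False
          then have "real m \<le> R" using apart[OF m n] y hdist_commute[of x y] by simp
          then have "m \<le> nat \<lceil>R\<rceil>" by linarith
          then show ?thesis using m by (auto simp: B_def)
        qed (use m y in auto)
      qed
      moreover have "card ({y\<in>V n. hdist x y \<le> R} \<union> B) \<le> N R + card B"
        using card_Un_le[of "{y\<in>V n. hdist x y \<le> R}" B] card_ball[OF n True] by linarith
      moreover have "finite ({y\<in>V n. hdist x y \<le> R} \<union> B)" using B finite_V by auto
      ultimately show ?thesis unfolding B_def[symmetric] by (meson card_mono finite_subset le_trans)
    next
      case False
      have "mcball x R \<subseteq> B"
      proof
        fix y assume y: "y \<in> mcball x R"
        then have "y \<in> X" by simp
        then obtain m where m: "y \<in> V m" by (auto simp: X_def)
        have "real m \<le> R"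
          using apart[OF m n] y hdist_commute[of x y] False by (cases "m = n") auto
        then have "m \<le> nat \<lceil>R\<rceil>" by linarith
        then show "y \<in> B" using m by (auto simp: B_def)
      qed
      then show ?thesis unfolding B_def[symmetric] using B by (meson card_mono finite_subset trans_le_add2)
    qed
  qed
  then show ?thesis unfolding bounded_geometry_def using Metric_space_axioms by blast
qed

lemma sum_act:
  assumes "i < 3" shows "(\<Sum>x\<in>V n. f (act n i x)) = (\<Sum>x\<in>V n. f x)"
  by (rule sum.reindex_bij_witness[of _ "act n i" "act n i"]) (use assms act_in act_act in auto)

lemma hdist_self_act:
  assumes "x \<in> V n" "i < 3" shows "hdist x (act n i x) = 1"
proof -
  have "hdist x x = 0" "hdist (act n i x) x \<ge> 0" by (simp_all add: hdist_def)
  with hdist_act[OF assms(1,1,2)] show ?thesis by (simp add: hdist_commute)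
qed

text \<open>Weights \<open>2\<close> towards \<open>z\<close> and \<open>1\<close> away from \<open>z\<close>
  realise the norm of the adjacency operator of the cubic tree, \<open>2 sqrt 2\<close>.\<close>

lemma adjacency_bound:
  fixes \<phi> :: "nat \<Rightarrow> real"
  assumes z: "z \<in> V n" and supp: "\<And>x. x \<in> V n \<Longrightarrow> \<phi> x \<noteq> 0 \<Longrightarrow> hdist x z \<le> real n"
  shows "(\<Sum>x\<in>V n. (\<Sum>i<3. \<phi> (act n i x))\<^sup>2) \<le> 8 * (\<Sum>x\<in>V n. (\<phi> x)\<^sup>2)"
proof -
  define closer where "closer x i \<longleftrightarrow> hdist (act n i x) z < hdist x z" for x i
  define w where "w x i = (if closer x i then 2 else 1 :: real)" for x i
  have "(\<Sum>x\<in>V n. (\<Sum>i<3. \<phi> (act n i x))\<^sup>2) \<le> (\<Sum>x\<in>V n. 4 * (\<Sum>i<3. (\<phi> (act n i x))\<^sup>2 / w x i))"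
  proof (rule sum_mono)
    fix x assume x: "x \<in> V n"
    show "(\<Sum>i<3. \<phi> (act n i x))\<^sup>2 \<le> 4 * (\<Sum>i<3. (\<phi> (act n i x))\<^sup>2 / w x i)"
    proof (cases "\<exists>i<3. \<phi> (act n i x) \<noteq> 0")
      case True
      then obtain i where i: "i < 3" "\<phi> (act n i x) \<noteq> 0" by blast
      have "hdist x z \<le> real n + 1" using supp[OF act_in[OF x i(1)] i(2)] hdist_act[OF x z i(1)] by linarith
      then have "i = j" if "i < 3" "j < 3" "closer x i" "closer x j" for i j
        using at_most_one_closer[OF x z] that by (auto simp: closer_def)
      then show ?thesis unfolding w_def by (rule weighted_square_sum)
    next
      case False
      then show ?thesis by simp
    qed
  qed
  also have "\<dots> = 4 * (\<Sum>i<3. \<Sum>x\<in>V n. (\<phi> (act n i x))\<^sup>2 / w x i)"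
    by (subst sum.swap) (simp add: sum_distrib_left)
  also have "(\<Sum>i<3. \<Sum>x\<in>V n. (\<phi> (act n i x))\<^sup>2 / w x i)
      = (\<Sum>i<3. \<Sum>y\<in>V n. (\<phi> y)\<^sup>2 / w (act n i y) i)"
  proof (rule sum.cong[OF refl])
    fix i :: nat assume "i \<in> {..<3}"
    then have i: "i < 3" by simp
    have "(\<Sum>y\<in>V n. (\<phi> y)\<^sup>2 / w (act n i y) i)
        = (\<Sum>x\<in>V n. (\<phi> (act n i x))\<^sup>2 / w (act n i (act n i x)) i)"
      by (rule sum_act[OF i, symmetric])
    then show "(\<Sum>x\<in>V n. (\<phi> (act n i x))\<^sup>2 / w x i) = (\<Sum>y\<in>V n. (\<phi> y)\<^sup>2 / w (act n i y) i)"
      using act_act[OF _ i] by simp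
  qed
  also have "\<dots> = (\<Sum>y\<in>V n. \<Sum>i<3. (\<phi> y)\<^sup>2 / w (act n i y) i)" by (rule sum.swap)
  also have "\<dots> \<le> (\<Sum>y\<in>V n. 2 * (\<phi> y)\<^sup>2)"
  proof (rule sum_mono)
    fix y assume y: "y \<in> V n"
    show "(\<Sum>i<3. (\<phi> y)\<^sup>2 / w (act n i y) i) \<le> 2 * (\<phi> y)\<^sup>2"
    proof (cases "\<phi> y = 0")
      case False
      have "hdist y z \<le> real n + 1" using supp[OF y False] by simp
      then have unique: "i = j" if "i < 3" "j < 3" "closer y i" "closer y j" for i j
        using at_most_one_closer[OF y z] that by (auto simp: closer_def)
      \<comment> \<open>Seen from \<open>y\<close>, a closer neighbour gives 1 and a farther one
        1/2, so the sum is at most 1 + 1/2 + 1/2; together with the factor 4 this is the constant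
        8.\<close>
      have w: "1 / w (act n i y) i = (if closer y i then 1 else 1/2)" if "i < 3" for i
        using hdist_act[OF y z that] act_act[OF y that] by (auto simp: w_def closer_def)
      have "(\<Sum>i<3. 1 / w (act n i y) i) \<le> 2"
        using unique[of 0 1] unique[of 0 2] unique[of 1 2] w[of 0] w[of 1] w[of 2]
        by (auto simp: numeral_3_eq_3 numeral_2_eq_2)
      then have "(\<phi> y)\<^sup>2 * (\<Sum>i<3. 1 / w (act n i y) i) \<le> (\<phi> y)\<^sup>2 * 2" by (intro mult_left_mono) auto
      then show ?thesis by (simp add: sum_distrib_left)
    qed simp
  qed
  finally show ?thesis by (simp add: sum_distrib_left)
qed

text \<open>Counting edges writes \<open>3 * card E\<close> as the sum of \<open>g\<close> over the
  neighbours of \<open>E\<close>. By Cauchy-Schwarz and \<open>adjacency_bound\<close> its square is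
  at most \<open>8 * card E\<close> times the number of neighbours.\<close>

lemma expansion:
  assumes E: "E \<subseteq> V n" and z: "z \<in> V n" "\<And>x. x \<in> E \<Longrightarrow> hdist x z \<le> real n"
  shows "9 * real (card E) \<le> 8 * real (card {x\<in>V n. \<exists>i<3. act n i x \<in> E})"
proof (cases "E = {}")
  case False
  let ?\<phi> = "\<lambda>x. of_bool (x \<in> E) :: real" and ?N = "{x\<in>V n. \<exists>i<3. act n i x \<in> E}"
  define g where "g x = (\<Sum>i<3. ?\<phi> (act n i x))" for x
  have E': "finite E" using E finite_V finite_subset by blast
  have card: "(\<Sum>x\<in>V n. ?\<phi> x) = real (card E)"
    using E finite_V by (simp add: of_bool_def sum.If_cases Int_absorb1)
  have "(\<Sum>x\<in>?N. g x) = (\<Sum>x\<in>V n. g x)"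
    using finite_V by (intro sum.mono_neutral_left) (auto simp: g_def)
  also have "\<dots> = (\<Sum>i<3. \<Sum>x\<in>V n. ?\<phi> (act n i x))" unfolding g_def by (rule sum.swap)
  also have "\<dots> = (\<Sum>i<(3::nat). \<Sum>x\<in>V n. ?\<phi> x)" by (rule sum.cong[OF refl], rule sum_act) simp
  also have "\<dots> = 3 * real (card E)" by (simp only: card sum_constant) simp
  finally have "(3 * real (card E))\<^sup>2 = (\<Sum>x\<in>?N. g x * 1)\<^sup>2" by simp
  also have "\<dots> \<le> (\<Sum>x\<in>?N. (g x)\<^sup>2) * (\<Sum>x\<in>?N. 1\<^sup>2)" by (rule Cauchy_Schwarz_ineq_sum)
  also have "(\<Sum>x\<in>?N. (g x)\<^sup>2) \<le> (\<Sum>x\<in>V n. (g x)\<^sup>2)" using finite_V by (intro sum_mono2) auto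
  also have "\<dots> \<le> 8 * (\<Sum>x\<in>V n. (?\<phi> x)\<^sup>2)"
    unfolding g_def by (rule adjacency_bound[OF z(1)]) (use z(2) in auto)
  also have "(\<Sum>x\<in>V n. (?\<phi> x)\<^sup>2) = (\<Sum>x\<in>V n. ?\<phi> x)" by (intro sum.cong) auto
  also have "\<dots> = real (card E)" by (rule card)
  finally have "real (card E) * (9 * real (card E)) \<le> real (card E) * (8 * real (card ?N))"
    by (simp add: power2_eq_square mult_right_mono)
  then show ?thesis using E' False by (simp add: card_gt_0_iff)
qed simp

text \<open>For \<open>F = V n\<close>, all neighbours in \<open>V n\<close> of the trace of
  \<open>E\<close> lie in \<open>E\<close> or in its 1-boundary, so the expansion factor 9/8 leaves
  a boundary of at least 1/8 of the trace; hence the choice \<epsilon> = 1/8.\<close>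

lemma not_ULA: "\<not> ULA X hdist"
proof
  assume "ULA X hdist"
  from this[unfolded ULA_def, rule_format, of 1 "1/8"] obtain S where S: "S > 0"
    and ula: "\<And>F. F \<subseteq> X \<Longrightarrow> finite F \<Longrightarrow> F \<noteq> {} \<Longrightarrow> \<exists>E\<subseteq>X. finite E \<and>
        set_diam hdist E \<le> ennreal S \<and>
        real (card (bdry X hdist 1 E \<inter> F)) < 1/8 * real (card (E \<inter> F))" by auto
  obtain n where n: "S \<le> real n" using real_arch_simple by blast
  obtain E where E: "set_diam hdist E \<le> ennreal S"
    "real (card (bdry X hdist 1 E \<inter> V n)) < 1/8 * real (card (E \<inter> V n))"
    using ula[OF V_X finite_V V_nonempty] by blast
  have "E \<inter> V n \<noteq> {}"
  proof
    assume "E \<inter> V n = {}"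
    with E(2) show False by simp
  qed
  then obtain z where z: "z \<in> E" "z \<in> V n" by blast
  have "9 * real (card (E \<inter> V n)) \<le> 8 * real (card {x\<in>V n. \<exists>i<3. act n i x \<in> E \<inter> V n})"
    using E(1) S n z by (intro expansion[of _ _ z]) (auto simp: set_diam_le_iff intro: order_trans)
  moreover have "card {x\<in>V n. \<exists>i<3. act n i x \<in> E \<inter> V n} \<le> card ((E \<inter> V n) \<union> (bdry X hdist 1 E \<inter> V n))"
  proof (rule card_mono)
    show "{x\<in>V n. \<exists>i<3. act n i x \<in> E \<inter> V n} \<subseteq> (E \<inter> V n) \<union> (bdry X hdist 1 E \<inter> V n)"
    proof (rule subsetI, rule ccontr)
      fix x assume "x \<in> {x\<in>V n. \<exists>i<3. act n i x \<in> E \<inter> V n}"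
      then obtain i where x: "x \<in> V n" "i < 3" "act n i x \<in> E" by blast
      assume no: "x \<notin> (E \<inter> V n) \<union> (bdry X hdist 1 E \<inter> V n)"
      then have "x \<in> bdry X hdist 1 E"
        using x hdist_self_act[OF x(1,2)] V_X by (intro bdryI[of _ _ _ "act n i x"]) auto
      with x no show False by simp
    qed
  qed (use finite_V in auto)
  moreover have "card ((E \<inter> V n) \<union> (bdry X hdist 1 E \<inter> V n)) \<le> card (E \<inter> V n) + card (bdry X hdist 1 E \<inter> V n)"
    by (rule card_Un_le)
  ultimately show False using E(2) by linarith
qed

end

section \<open>Failure of the localisation properties\<close>

context cubic_tower
begin

text \<open>A Poincare inequality for localised functions: after expanding the squares only the
  cross term needs \<open>adjacency_bound\<close>.\<close>

lemma gradient_bound: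
  fixes h :: "nat \<Rightarrow> real"
  assumes "z \<in> V n" "\<And>x. x \<in> V n \<Longrightarrow> h x \<noteq> 0 \<Longrightarrow> hdist x z \<le> real n"
  shows "(\<Sum>x\<in>V n. (h x)\<^sup>2) \<le> 3 * (\<Sum>x\<in>V n. \<Sum>i<3. (h x - h (act n i x))\<^sup>2)"
proof -
  define g where "g x = (\<Sum>i<3. h (act n i x))" for x
  define Q where "Q = (\<Sum>x\<in>V n. (h x)\<^sup>2)"
  have g: "(\<Sum>x\<in>V n. (g x)\<^sup>2) \<le> 8 * Q"
    unfolding g_def Q_def by (rule adjacency_bound[OF assms])
  have eq: "(\<Sum>i<3. (h x - h (act n i x))\<^sup>2) = 3 * (h x)\<^sup>2 + (\<Sum>i<3. (h (act n i x))\<^sup>2) - 2 * (h x * g x)" for x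
    by (simp add: g_def power2_diff sum.distrib sum_subtractf sum_distrib_left algebra_simps)
  have "(\<Sum>x\<in>V n. \<Sum>i<3. (h (act n i x))\<^sup>2) = (\<Sum>i<3. \<Sum>x\<in>V n. (h (act n i x))\<^sup>2)" by (rule sum.swap)
  also have "\<dots> = (\<Sum>i<(3::nat). Q)" unfolding Q_def by (rule sum.cong[OF refl], rule sum_act) simp
  finally have neigh: "(\<Sum>x\<in>V n. \<Sum>i<3. (h (act n i x))\<^sup>2) = 3 * Q" by simp
  \<comment> \<open>Tuned so that the gradient sum is at least 6Q - 3Q - 8Q/3 = Q/3.\<close>
  have "2 * (h x * g x) \<le> 3 * (h x)\<^sup>2 + (g x)\<^sup>2 / 3" for x
    using zero_le_power2[of "3 * h x - g x"] by (simp add: power2_diff power_mult_distrib field_simps)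
  then have "(\<Sum>x\<in>V n. 2 * (h x * g x)) \<le> (\<Sum>x\<in>V n. 3 * (h x)\<^sup>2 + (g x)\<^sup>2 / 3)" by (intro sum_mono)
  also have "\<dots> = 3 * Q + (\<Sum>x\<in>V n. (g x)\<^sup>2) / 3"
    by (simp add: Q_def sum.distrib sum_distrib_left sum_divide_distrib)
  finally have "(\<Sum>x\<in>V n. 2 * (h x * g x)) \<le> 3 * Q + 8 * Q / 3" using g by linarith
  moreover have "(\<Sum>x\<in>V n. \<Sum>i<3. (h x - h (act n i x))\<^sup>2) = 3 * Q + 3 * Q - (\<Sum>x\<in>V n. 2 * (h x * g x))"
    by (simp only: eq sum.distrib sum_subtractf neigh sum_distrib_left[symmetric] Q_def)
  ultimately show ?thesis unfolding Q_def[symmetric] by linarith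
qed

text \<open>For fixed \<open>z\<close>, the function \<open>sqrt (pmf (\<xi> x) z)\<close> of
  \<open>x\<close> is supported near \<open>z\<close>, so \<open>gradient_bound\<close> applies.
  Summed over \<open>z\<close>, its left side becomes \<open>card (V n)\<close>, whereas closeness
  1/10 along three edges bounds the right side by 9/10 of that.\<close>

lemma not_property_A: "\<not> property_A X hdist"
proof
  assume "property_A X hdist"
  from this[unfolded property_A_def, rule_format, of 1 "1/10"]
  obtain S and \<xi> :: "nat \<Rightarrow> nat pmf" where S: "S > 0"
    and close: "\<forall>x\<in>X. \<forall>y\<in>X. hdist x y \<le> 1 \<longrightarrow> (\<Sum>\<^sub>\<infinity>z\<in>X. \<bar>pmf (\<xi> x) z - pmf (\<xi> y) z\<bar>) < 1/10"
    and supp: "\<forall>x\<in>X. set_pmf (\<xi> x) \<subseteq> Metric_space.mcball X hdist x S" by auto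
  interpret Metric_space X hdist by (rule Metric_space_hdist)
  obtain n where n: "S < real n" using reals_Archimedean2 by blast
  \<comment> \<open>As \<open>n\<close> exceeds \<open>S\<close>, the measures are trapped in
    \<open>V n\<close>: other components are at distance at least \<open>n\<close>.\<close>
  have ball: "z \<in> V n \<and> hdist x z \<le> real n" if x: "x \<in> V n" and z: "z \<in> set_pmf (\<xi> x)" for x z
  proof -
    have "z \<in> mcball x S" using supp x z V_X by blast
    then have zX: "z \<in> X" and le: "hdist x z \<le> S" by auto
    from zX obtain m where m: "z \<in> V m" by (auto simp: X_def)
    have "m = n" using apart[OF x m] le n by force
    with m le n show ?thesis by simp
  qed
  have "real (card (V n)) = (\<Sum>x\<in>V n. \<Sum>z\<in>V n. pmf (\<xi> x) z)"
    using ball finite_V by (subst sum.cong[OF refl sum_pmf_eq_1]) auto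
  also have "\<dots> = (\<Sum>z\<in>V n. \<Sum>x\<in>V n. (sqrt (pmf (\<xi> x) z))\<^sup>2)"
    by (subst sum.swap) simp
  also have "\<dots> \<le> (\<Sum>z\<in>V n. 3 * (\<Sum>x\<in>V n. \<Sum>i<3. (sqrt (pmf (\<xi> x) z) - sqrt (pmf (\<xi> (act n i x)) z))\<^sup>2))"
    by (intro sum_mono gradient_bound) (auto simp: ball set_pmf_iff)
  also have "\<dots> \<le> (\<Sum>z\<in>V n. 3 * (\<Sum>x\<in>V n. \<Sum>i<3. \<bar>pmf (\<xi> x) z - pmf (\<xi> (act n i x)) z\<bar>))"
    by (intro sum_mono mult_left_mono square_sqrt_diff_le) auto
  also have "\<dots> = 3 * (\<Sum>x\<in>V n. \<Sum>z\<in>V n. \<Sum>i<3. \<bar>pmf (\<xi> x) z - pmf (\<xi> (act n i x)) z\<bar>)"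
    by (subst sum.swap) (simp only: sum_distrib_left)
  also have "\<dots> = 3 * (\<Sum>x\<in>V n. \<Sum>i<3. \<Sum>z\<in>V n. \<bar>pmf (\<xi> x) z - pmf (\<xi> (act n i x)) z\<bar>)"
    by (rule arg_cong[where f = "\<lambda>t. 3 * t"], rule sum.cong[OF refl], rule sum.swap)
  also have "\<dots> \<le> 3 * (\<Sum>x\<in>V n. \<Sum>i<(3::nat). 1/10)"
  proof (intro mult_left_mono sum_mono)
    fix x and i :: nat assume x: "x \<in> V n" and "i \<in> {..<3}"
    then have i: "i < 3" by simp
    have ax: "act n i x \<in> V n" using act_in x i by blast
    have "(\<Sum>z\<in>V n. \<bar>pmf (\<xi> x) z - pmf (\<xi> (act n i x)) z\<bar>)
        = (\<Sum>\<^sub>\<infinity>z\<in>V n. \<bar>pmf (\<xi> x) z - pmf (\<xi> (act n i x)) z\<bar>)" using finite_V by simp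
    also have "\<dots> = (\<Sum>\<^sub>\<infinity>z\<in>X. \<bar>pmf (\<xi> x) z - pmf (\<xi> (act n i x)) z\<bar>)"
    proof (rule infsum_cong_neutral)
      fix z assume "z \<in> X - V n"
      then have "pmf (\<xi> x) z = 0" "pmf (\<xi> (act n i x)) z = 0"
        using ball[OF x, of z] ball[OF ax, of z] by (auto simp: set_pmf_iff)
      then show "\<bar>pmf (\<xi> x) z - pmf (\<xi> (act n i x)) z\<bar> = 0" by simp
    qed (use V_X in auto)
    also have "\<dots> \<le> 1/10"
      using close[rule_format, of x "act n i x"] hdist_self_act[OF x i] x ax V_X by (simp add: subset_iff)
    finally show "(\<Sum>z\<in>V n. \<bar>pmf (\<xi> x) z - pmf (\<xi> (act n i x)) z\<bar>) \<le> 1/10" .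
  qed simp
  also have "\<dots> = 9/10 * real (card (V n))" by simp
  finally show False using finite_V V_nonempty by (simp add: card_gt_0_iff)
qed

text \<open>Every enlargement by 1 gains a factor 9/8 as long as the set stays within distance
  \<open>n\<close> of one point, which \<open>S + real k \<le> real n\<close> guarantees.\<close>

lemma iterated_expansion:
  assumes "E \<subseteq> V n" "E \<noteq> {}" "\<And>x y. x \<in> E \<Longrightarrow> y \<in> E \<Longrightarrow> hdist x y \<le> S" "S + real k \<le> real n"
  shows "(9/8)^k * real (card E) \<le> real (card {x\<in>V n. \<exists>y\<in>E. hdist x y \<le> real k})"
  using assms(4)
proof (induction k)
  case 0
  have "card E \<le> card {x\<in>V n. \<exists>y\<in>E. hdist x y \<le> 0}"
    using assms(1) finite_V by (intro card_mono) (auto simp: hdist_def intro: bexI)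
  then show ?case by simp
next
  case (Suc k)
  interpret Metric_space UNIV hdist by (rule Metric_space_hdist)
  let ?N = "\<lambda>k::nat. {x\<in>V n. \<exists>y\<in>E. hdist x y \<le> real k}"
  obtain z where z: "z \<in> E" using assms(2) by blast
  have "(9/8)^Suc k * real (card E) \<le> 9/8 * real (card (?N k))"
    using Suc by (simp add: mult.commute)
  also have "\<dots> \<le> real (card {x\<in>V n. \<exists>i<3. act n i x \<in> ?N k})"
  proof -
    have "hdist x z \<le> real n" if x: "x \<in> ?N k" for x
    proof -
      from x obtain y where "y \<in> E" "hdist x y \<le> real k" by blast
      then show ?thesis using triangle[of x y z] assms(3)[of y z] z Suc.prems by simp
    qed
    then have "9 * real (card (?N k)) \<le> 8 * real (card {x\<in>V n. \<exists>i<3. act n i x \<in> ?N k})"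
      using z assms(1) by (intro expansion[of _ _ z]) auto
    then show ?thesis by simp
  qed
  also have "card {x\<in>V n. \<exists>i<3. act n i x \<in> ?N k} \<le> card (?N (Suc k))"
  proof (rule card_mono)
    show "{x\<in>V n. \<exists>i<3. act n i x \<in> ?N k} \<subseteq> ?N (Suc k)"
    proof
      fix x assume "x \<in> {x\<in>V n. \<exists>i<3. act n i x \<in> ?N k}"
      then obtain i y where x: "x \<in> V n" "i < 3" "y \<in> E" "hdist (act n i x) y \<le> real k" by blast
      then have "hdist x y \<le> real (Suc k)"
        using triangle[of x "act n i x" y] hdist_self_act[OF x(1,2)] by simp
      with x show "x \<in> ?N (Suc k)" by blast
    qed
  qed (use finite_V in auto)
  finally show ?case by simp
qed

text \<open>Pieces more than \<open>2 * real k + 1\<close> apart have disjoint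
  \<open>k\<close>-neighbourhoods, each at least (9/8)^k times as large. Since these fit into
  \<open>V n\<close>, (9/8)^k c is at most 1, which a large \<open>k\<close> violates.\<close>

lemma not_MSP: "\<not> MSP X hdist"
proof
  assume "MSP X hdist"
  then obtain c where c: "c > 0" and
    dec: "\<forall>R>0. \<exists>S>0. \<forall>\<mu>\<in>prob_measures X. sparsified X hdist c R S \<mu>"
    unfolding MSP_iff_sparsified by blast
  interpret Metric_space X hdist by (rule Metric_space_hdist)
  obtain k where k: "1 / c < (9/8)^k" using real_arch_pow[of "9/8" "1/c"] by auto
  obtain S where S: "S > 0" and dec': "\<forall>\<mu>\<in>prob_measures X. sparsified X hdist c (2 * real k + 1) S \<mu>"
    using dec[rule_format, of "2 * real k + 1"] by auto
  obtain n where n: "S + real k \<le> real n" using real_arch_simple by blast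
  define \<mu> where "\<mu> = pmf_of_set (V n)"
  have \<mu>: "set_pmf \<mu> = V n" using finite_V V_nonempty by (simp add: \<mu>_def)
  then have "\<mu> \<in> prob_measures X" using V_X by (simp add: prob_measures_def)
  then have "sparsified X hdist c (2 * real k + 1) S \<mu>" using dec' by blast
  then obtain \<Omega> P where P: "\<Omega> \<subseteq> X" "partition_on \<Omega> P" "measure_pmf.prob \<mu> \<Omega> \<ge> c"
    "\<forall>A\<in>P. set_diam hdist A \<le> ennreal S"
    "\<forall>A\<in>P. \<forall>B\<in>P. A \<noteq> B \<longrightarrow> set_dist hdist A B > ennreal (2 * real k + 1)"
    unfolding sparsified_def by (elim exE conjE) (rule that)
  \<comment> \<open>Traces on \<open>V n\<close>; empty ones are dropped because
    \<open>iterated_expansion\<close> is about nonempty sets.\<close>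
  define Q where "Q = (\<lambda>A. A \<inter> V n) ` P - {{}}"
  define N where "N A = {x\<in>V n. \<exists>y\<in>A. hdist x y \<le> real k}" for A
  have "Q \<subseteq> Pow (V n)" by (auto simp: Q_def)
  then have finQ: "finite Q" and sub: "\<And>A. A \<in> Q \<Longrightarrow> A \<subseteq> V n"
    using finite_V by (auto intro: finite_subset)
  have diam: "hdist x y \<le> S" if "A \<in> Q" "x \<in> A" "y \<in> A" for A x y
    using that P(4) S by (auto simp: Q_def set_diam_le_iff)
  have sep: "hdist x y > 2 * real k + 1" if AB: "A \<in> Q" "B \<in> Q" "A \<noteq> B" "x \<in> A" "y \<in> B" for A B x y
  proof -
    obtain A' B' where A': "A' \<in> P" "A = A' \<inter> V n" and B': "B' \<in> P" "B = B' \<inter> V n"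
      using AB(1,2) by (auto simp: Q_def)
    then have "A' \<noteq> B'" using AB(3) by auto
    then have "set_dist hdist A' B' > ennreal (2 * real k + 1)" using P(5) A' B' by blast
    then show ?thesis by (rule set_dist_greaterD) (use A' B' AB in auto)
  qed
  have cover: "\<Omega> \<inter> V n = \<Union>Q" using P(2) by (auto simp: Q_def partition_on_def)
  have "c \<le> real (card (V n \<inter> \<Omega>)) / real (card (V n))"
    using P(3) finite_V V_nonempty by (simp add: \<mu>_def measure_pmf_of_set)
  then have "c * real (card (V n)) \<le> real (card (\<Omega> \<inter> V n))"
    using finite_V V_nonempty by (simp add: pos_le_divide_eq card_gt_0_iff Int_commute)
  also have "card (\<Omega> \<inter> V n) \<le> (\<Sum>A\<in>Q. card A)"
    unfolding cover using card_UN_le[OF finQ, of "\<lambda>A. A"] by simp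
  finally have "(9/8)^k * (c * real (card (V n))) \<le> (9/8)^k * real (\<Sum>A\<in>Q. card A)"
    by (intro mult_left_mono) auto
  also have "\<dots> = (\<Sum>A\<in>Q. (9/8)^k * real (card A))" by (simp add: sum_distrib_left)
  also have "\<dots> \<le> (\<Sum>A\<in>Q. real (card (N A)))"
    unfolding N_def
  proof (rule sum_mono)
    fix A assume A: "A \<in> Q"
    then show "(9/8)^k * real (card A) \<le> real (card {x\<in>V n. \<exists>y\<in>A. hdist x y \<le> real k})"
      using sub[OF A] diam[OF A] n by (intro iterated_expansion[where S = S]) (auto simp: Q_def)
  qed
  also have "\<dots> = real (card (\<Union>A\<in>Q. N A))"
  proof -
    have "N A \<inter> N B = {}" if AB: "A \<in> Q" "B \<in> Q" "A \<noteq> B" for A B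
    proof (rule ccontr)
      assume "N A \<inter> N B \<noteq> {}"
      then obtain x a b where x: "x \<in> V n" "a \<in> A" "b \<in> B" "hdist x a \<le> real k" "hdist x b \<le> real k"
        by (auto simp: N_def)
      have "x \<in> X" "a \<in> X" "b \<in> X" using x sub AB V_X by blast+
      then show False using triangle[of a x b] commute[of a x] sep[OF AB x(2,3)] x(4,5) by linarith
    qed
    moreover have "finite (N A)" for A using finite_V by (simp add: N_def)
    ultimately have "card (\<Union>A\<in>Q. N A) = (\<Sum>A\<in>Q. card (N A))"
      using finQ by (intro card_UN_disjoint) auto
    then show ?thesis by simp
  qed
  also have "\<dots> \<le> 1 * real (card (V n))"
    using finite_V card_mono[of "V n" "\<Union>A\<in>Q. N A"] by (auto simp: N_def)
  finally have "((9/8)^k * c) * real (card (V n)) \<le> 1 * real (card (V n))" by (simp add: mult.assoc)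
  then have "(9/8)^k * c \<le> 1" using finite_V V_nonempty by (simp add: card_gt_0_iff)
  then show False using k c by (simp add: field_simps)
qed

end

text \<open>The complex line as a Hilbert space in the prescribed carrier type; scalar functions
  suffice to refute \<open>ONL\<close>.\<close>

definition cline :: "(nat \<Rightarrow> complex) hilbert" where
  "cline = \<lparr> vcarrier = {f. \<forall>k>0. f k = 0}, vadd = (\<lambda>f g k. f k + g k), vzero = (\<lambda>k. 0),
     vscale = (\<lambda>a f k. a * f k), vinner = (\<lambda>f g. f 0 * cnj (g 0)) \<rparr>"

lemma vnorm_cline: "vnorm cline f = cmod (f 0)"
  by (simp add: vnorm_def cline_def mult_cnj_square)

lemma vdiff_cline: "vdiff cline f g = (\<lambda>k. f k - g k)"
  by (simp add: vdiff_def cline_def)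

lemma hilbert_space_cline: "hilbert_space cline"
proof
  fix s :: "nat \<Rightarrow> nat \<Rightarrow> complex"
  assume s: "\<forall>n. s n \<in> vcarrier cline"
    and c: "\<forall>e>0. \<exists>N. \<forall>m\<ge>N. \<forall>n\<ge>N. vnorm cline (vdiff cline (s m) (s n)) < e"
  from c have "Cauchy (\<lambda>n. s n 0)"
    by (simp add: vnorm_cline vdiff_cline Cauchy_def dist_norm)
  then obtain l where "(\<lambda>n. s n 0) \<longlonglongrightarrow> l" using Cauchy_convergent convergentD by blast
  then have "(\<lambda>n. cmod (s n 0 - l)) \<longlonglongrightarrow> 0"
    by (simp add: LIM_zero_iff tendsto_norm_zero_iff)
  then show "\<exists>l\<in>vcarrier cline. (\<lambda>n. vnorm cline (vdiff cline (s n) l)) \<longlonglongrightarrow> 0"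
    by (intro bexI[of _ "\<lambda>k. if k = 0 then l else 0"])
      (simp_all add: vnorm_cline vdiff_cline, simp add: cline_def)
next
  fix x :: "nat \<Rightarrow> complex"
  show "\<exists>y\<in>vcarrier cline. vadd cline x y = vzero cline" if "x \<in> vcarrier cline"
    using that by (intro bexI[of _ "\<lambda>k. - x k"]) (auto simp: cline_def)
  show "x = vzero cline" if "x \<in> vcarrier cline" "vinner cline x x = 0"
  proof
    fix k show "x k = vzero cline k" using that by (cases "k = 0") (auto simp: cline_def)
  qed
qed (auto simp: cline_def algebra_simps)

lemma separable_cline: "separable_hilbert cline"
proof -
  obtain D :: "complex set" where D: "countable D" "\<And>X. open X \<Longrightarrow> X \<noteq> {} \<Longrightarrow> \<exists>d\<in>D. d \<in> X"
    using countable_dense_exists by blast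
  let ?e = "\<lambda>q k. if k = (0::nat) then q else 0 :: complex"
  have "\<exists>y\<in>?e ` D. vnorm cline (vdiff cline x y) < e" if e: "e > 0" for x e
  proof -
    have "ball (x 0) e \<noteq> {}" using e by simp
    from D(2)[OF open_ball this] obtain q where "q \<in> D" "q \<in> ball (x 0) e" by blast
    then show ?thesis by (intro bexI[of _ "?e q"]) (auto simp: vnorm_cline vdiff_cline dist_norm)
  qed
  then show ?thesis
    unfolding separable_hilbert_def using D(1) hilbert_space_cline
    by (intro conjI exI[of _ "?e ` D"]) (auto simp: cline_def)
qed

section \<open>Powers of the Markov operator\<close>

context cubic_tower
begin

abbreviation L2 :: "nat \<Rightarrow> (nat \<Rightarrow> nat \<Rightarrow> complex) hilbert" where
  "L2 n \<equiv> l2_space X (pmf_of_set (V n)) cline"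

text \<open>The average over the three neighbours; the value zero off \<open>V n\<close> is the
  representative that \<open>l2_space\<close> prescribes.\<close>

definition markov :: "nat \<Rightarrow> (nat \<Rightarrow> nat \<Rightarrow> complex) \<Rightarrow> nat \<Rightarrow> nat \<Rightarrow> complex" where
  "markov n \<phi> x = (if x \<in> V n then (\<lambda>j. (\<Sum>i<3. \<phi> (act n i x) j) / 3) else (\<lambda>j. 0))"

text \<open>The squared norm before division by \<open>card (V n)\<close>; vectors of
  \<open>cline\<close> live in coordinate 0.\<close>

definition energy :: "nat \<Rightarrow> (nat \<Rightarrow> nat \<Rightarrow> complex) \<Rightarrow> real" where
  "energy n \<phi> = (\<Sum>x\<in>V n. (cmod (\<phi> x 0))\<^sup>2)"

lemma set_pmf_V: "set_pmf (pmf_of_set (V n)) = V n"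
  using finite_V V_nonempty by simp

lemma pmf_V: "pmf (pmf_of_set (V n)) x = (if x \<in> V n then 1 / real (card (V n)) else 0)"
  using finite_V V_nonempty by (simp add: indicator_def)

lemma carrier_L2:
  "\<phi> \<in> vcarrier (L2 n) \<longleftrightarrow> (\<forall>x j. x \<notin> V n \<or> j \<noteq> 0 \<longrightarrow> \<phi> x j = 0)"
proof -
  have "(\<lambda>x. pmf (pmf_of_set (V n)) x * (vnorm cline (\<phi> x))\<^sup>2) summable_on X"
    using finite_V[of n]
    by (intro finite_nonzero_values_imp_summable_on finite_subset[OF _ finite_V[of n]]) (auto simp: pmf_V)
  then have "\<phi> \<in> vcarrier (L2 n) \<longleftrightarrow>
      (\<forall>x\<in>V n. \<phi> x \<in> vcarrier cline) \<and> (\<forall>x. x \<notin> V n \<longrightarrow> \<phi> x = vzero cline)"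
    by (simp add: l2_space_def set_pmf_V)
  also have "\<dots> \<longleftrightarrow> (\<forall>x j. x \<notin> V n \<or> j \<noteq> 0 \<longrightarrow> \<phi> x j = 0)"
    by (auto simp: cline_def fun_eq_iff)
  finally show ?thesis .
qed

lemma vnorm_L2: "vnorm (L2 n) \<phi> = sqrt (energy n \<phi> / real (card (V n)))"
proof -
  have "vinner (L2 n) \<phi> \<phi> = (\<Sum>\<^sub>\<infinity>x\<in>X. complex_of_real (pmf (pmf_of_set (V n)) x) * vinner cline (\<phi> x) (\<phi> x))"
    by (simp add: l2_space_def)
  also have "\<dots> = (\<Sum>\<^sub>\<infinity>x\<in>V n. complex_of_real (pmf (pmf_of_set (V n)) x) * vinner cline (\<phi> x) (\<phi> x))"
    using V_X by (intro infsum_cong_neutral) (auto simp: pmf_V)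
  also have "\<dots> = (\<Sum>x\<in>V n. complex_of_real ((cmod (\<phi> x 0))\<^sup>2 / real (card (V n))))"
    using finite_V by (simp add: pmf_V cline_def mult_cnj_square)
  also have "\<dots> = complex_of_real (energy n \<phi> / real (card (V n)))"
    by (simp add: energy_def sum_divide_distrib)
  finally show ?thesis by (simp add: vnorm_def)
qed

lemma vzero_cline: "vzero cline = (\<lambda>j. 0)" by (simp add: cline_def)

lemma markov_carrier: "\<phi> \<in> vcarrier (L2 n) \<Longrightarrow> markov n \<phi> \<in> vcarrier (L2 n)"
  unfolding carrier_L2 markov_def by auto

lemma markov_add: "markov n (vadd (L2 n) \<phi> \<psi>) = vadd (L2 n) (markov n \<phi>) (markov n \<psi>)"
  by (auto simp: markov_def l2_space_def cline_def fun_eq_iff sum.distrib add_divide_distrib)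

lemma markov_scale: "markov n (vscale (L2 n) a \<phi>) = vscale (L2 n) a (markov n \<phi>)"
  by (auto simp: markov_def l2_space_def cline_def fun_eq_iff sum_distrib_left)

lemma cmod_markov_le:
  assumes "x \<in> V n"
  shows "(cmod (markov n \<phi> x 0))\<^sup>2 \<le> (\<Sum>i<3. cmod (\<phi> (act n i x) 0))\<^sup>2 / 9"
proof -
  have "cmod (markov n \<phi> x 0) \<le> (\<Sum>i<3. cmod (\<phi> (act n i x) 0)) / 3"
    using assms norm_sum[of "\<lambda>i. \<phi> (act n i x) 0" "{..<3}"] by (simp add: markov_def norm_divide)
  then have "(cmod (markov n \<phi> x 0))\<^sup>2 \<le> ((\<Sum>i<3. cmod (\<phi> (act n i x) 0)) / 3)\<^sup>2"
    by (intro power_mono) auto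
  then show ?thesis by (simp add: power_divide)
qed

lemma energy_markov: "energy n (markov n \<phi>) \<le> energy n \<phi>"
proof -
  have "energy n (markov n \<phi>) \<le> (\<Sum>x\<in>V n. (\<Sum>i<3. (cmod (\<phi> (act n i x) 0))\<^sup>2) / 3)"
    unfolding energy_def
  proof (rule sum_mono)
    fix x assume x: "x \<in> V n"
    have "(\<Sum>i<3. cmod (\<phi> (act n i x) 0) * 1)\<^sup>2
        \<le> (\<Sum>i<3. (cmod (\<phi> (act n i x) 0))\<^sup>2) * (\<Sum>i<(3::nat). 1\<^sup>2)"
      by (rule Cauchy_Schwarz_ineq_sum)
    with cmod_markov_le[OF x, of \<phi>]
    show "(cmod (markov n \<phi> x 0))\<^sup>2 \<le> (\<Sum>i<3. (cmod (\<phi> (act n i x) 0))\<^sup>2) / 3" by simp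
  qed
  also have "\<dots> = (\<Sum>i<3. \<Sum>x\<in>V n. (cmod (\<phi> (act n i x) 0))\<^sup>2) / 3"
    by (simp add: sum.swap[of _ "{..<3}"] flip: sum_divide_distrib)
  also have "(\<Sum>i<3. \<Sum>x\<in>V n. (cmod (\<phi> (act n i x) 0))\<^sup>2) = (\<Sum>i<(3::nat). energy n \<phi>)"
    unfolding energy_def by (rule sum.cong[OF refl], rule sum_act) simp
  finally show ?thesis by simp
qed

text \<open>\<open>adjacency_bound\<close> for the moduli of the values; the 9 is the square of the
  degree.\<close>

lemma energy_markov_local:
  assumes "z \<in> V n" "\<And>x. x \<in> V n \<Longrightarrow> \<phi> x \<noteq> (\<lambda>j. 0) \<Longrightarrow> hdist x z \<le> real n"
  shows "energy n (markov n \<phi>) \<le> 8/9 * energy n \<phi>"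
proof -
  have "energy n (markov n \<phi>) \<le> (\<Sum>x\<in>V n. (\<Sum>i<3. cmod (\<phi> (act n i x) 0))\<^sup>2 / 9)"
    unfolding energy_def by (intro sum_mono cmod_markov_le)
  also have "\<dots> = (\<Sum>x\<in>V n. (\<Sum>i<3. cmod (\<phi> (act n i x) 0))\<^sup>2) / 9" by (simp add: sum_divide_distrib)
  also have "\<dots> \<le> 8 * (\<Sum>x\<in>V n. (cmod (\<phi> x 0))\<^sup>2) / 9"
  proof (intro divide_right_mono adjacency_bound[OF assms(1)])
    fix x assume "x \<in> V n" "cmod (\<phi> x 0) \<noteq> 0"
    then show "hdist x z \<le> real n" using assms(2)[of x] by (cases "\<phi> x = (\<lambda>j. 0)") auto
  qed simp
  finally show ?thesis by (simp add: energy_def)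
qed

lemma markov_support:
  assumes "z \<in> V n" "\<And>x. x \<in> V n \<Longrightarrow> \<phi> x \<noteq> (\<lambda>j. 0) \<Longrightarrow> hdist x z \<le> \<rho>"
    and "x \<in> V n" "markov n \<phi> x \<noteq> (\<lambda>j. 0)"
  shows "hdist x z \<le> \<rho> + 1"
proof -
  have "\<exists>i<3. \<phi> (act n i x) \<noteq> (\<lambda>j. 0)"
  proof (rule ccontr)
    assume "\<not> (\<exists>i<3. \<phi> (act n i x) \<noteq> (\<lambda>j. 0))"
    then have "markov n \<phi> x = (\<lambda>j. 0)" by (auto simp: markov_def fun_eq_iff)
    with assms(4) show False by simp
  qed
  then obtain i where i: "i < 3" "\<phi> (act n i x) \<noteq> (\<lambda>j. 0)" by blast
  then have "hdist (act n i x) z \<le> \<rho>" using assms act_in by blast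
  then show ?thesis using hdist_act[OF assms(3,1) i(1)] by linarith
qed

text \<open>Each step enlarges the support by 1. This gives the finite propagation of the powers and
  keeps a localised function in the tree range during the iteration.\<close>

lemma markov_power_support:
  assumes "z \<in> V n" "\<And>x. x \<in> V n \<Longrightarrow> \<phi> x \<noteq> (\<lambda>j. 0) \<Longrightarrow> hdist x z \<le> \<rho>"
  shows "x \<in> V n \<Longrightarrow> (markov n ^^ k) \<phi> x \<noteq> (\<lambda>j. 0) \<Longrightarrow> hdist x z \<le> \<rho> + real k"
proof (induction k arbitrary: x)
  case (Suc k)
  have "hdist x z \<le> (\<rho> + real k) + 1"
    by (rule markov_support[OF assms(1) Suc.IH]) (use Suc.prems in simp_all)
  then show ?case by simp
qed (use assms in simp)

lemma energy_markov_power_local: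
  assumes "z \<in> V n" "\<And>x. x \<in> V n \<Longrightarrow> \<phi> x \<noteq> (\<lambda>j. 0) \<Longrightarrow> hdist x z \<le> \<rho>" "\<rho> + real k \<le> real n"
  shows "energy n ((markov n ^^ k) \<phi>) \<le> (8/9)^k * energy n \<phi>"
  using assms(3)
proof (induction k)
  case (Suc k)
  have "energy n ((markov n ^^ Suc k) \<phi>) \<le> 8/9 * energy n ((markov n ^^ k) \<phi>)"
    unfolding funpow.simps comp_apply
  proof (rule energy_markov_local[OF assms(1)])
    fix x assume "x \<in> V n" "(markov n ^^ k) \<phi> x \<noteq> (\<lambda>j. 0)"
    with markov_power_support[OF assms(1,2)] have "hdist x z \<le> \<rho> + real k" by blast
    then show "hdist x z \<le> real n" using Suc.prems by simp
  qed
  also have "\<dots> \<le> 8/9 * ((8/9)^k * energy n \<phi>)" using Suc by (intro mult_left_mono) auto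
  finally show ?case by simp
qed simp

lemma
  shows markov_power_carrier: "\<phi> \<in> vcarrier (L2 n) \<Longrightarrow> (markov n ^^ k) \<phi> \<in> vcarrier (L2 n)"
    and markov_power_add: "(markov n ^^ k) (vadd (L2 n) \<phi> \<psi>) = vadd (L2 n) ((markov n ^^ k) \<phi>) ((markov n ^^ k) \<psi>)"
    and markov_power_scale: "(markov n ^^ k) (vscale (L2 n) a \<phi>) = vscale (L2 n) a ((markov n ^^ k) \<phi>)"
    and energy_markov_power: "energy n ((markov n ^^ k) \<phi>) \<le> energy n \<phi>"
proof (induction k)
  case (Suc k)
  { case 1 then show ?case using Suc by (simp add: markov_carrier) }
  { case 2 then show ?case using Suc by (simp add: markov_add) }
  { case 3 then show ?case using Suc by (simp add: markov_scale) }
  { case 4 then show ?case using Suc energy_markov[of n "(markov n ^^ k) \<phi>"] by simp }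
qed simp_all

lemma vnorm_markov_power: "vnorm (L2 n) ((markov n ^^ k) \<phi>) \<le> vnorm (L2 n) \<phi>"
  by (simp add: vnorm_L2 divide_right_mono energy_markov_power)

lemma markov_power_finite_prop:
  "markov n ^^ k \<in> finite_prop_ops (real k) X hdist (pmf_of_set (V n)) cline"
proof -
  have "\<exists>K. \<forall>\<phi>\<in>vcarrier (L2 n). vnorm (L2 n) ((markov n ^^ k) \<phi>) \<le> K * vnorm (L2 n) \<phi>"
    using vnorm_markov_power by (intro exI[of _ 1]) simp
  then have "bounded_operator (L2 n) (markov n ^^ k)"
    unfolding bounded_operator_def
    by (simp add: markov_power_carrier markov_power_add markov_power_scale)
  moreover have "matrix_entry cline (markov n ^^ k) x y h = vzero cline"
    if xy: "x \<in> V n" "y \<in> V n" "hdist x y > real k" for x y h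
  proof (rule ccontr)
    let ?\<delta> = "\<lambda>z. if z = y then h else vzero cline"
    assume "matrix_entry cline (markov n ^^ k) x y h \<noteq> vzero cline"
    then have "(markov n ^^ k) ?\<delta> x \<noteq> (\<lambda>j. 0)" by (simp add: matrix_entry_def vzero_cline)
    moreover have "hdist u y \<le> 0" if "?\<delta> u \<noteq> (\<lambda>j. 0)" for u
      using that by (cases "u = y") (auto simp: vzero_cline hdist_def)
    ultimately have "hdist x y \<le> 0 + real k"
      using markov_power_support[OF xy(2), of ?\<delta> 0 x k] xy(1) by blast
    with xy(3) show False by simp
  qed
  ultimately show ?thesis by (simp add: finite_prop_ops_def set_pmf_V)
qed

text \<open>Constant functions are fixed by \<open>markov\<close>, and the constant 1 is a unit
  vector because the measure has total mass 1.\<close>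

lemma operator_norm_markov_power: "operator_norm (L2 n) (markov n ^^ k) \<ge> 1"
proof -
  let ?U = "{\<phi>\<in>vcarrier (L2 n). vnorm (L2 n) \<phi> \<le> 1}"
  define u where "u x j = (if x \<in> V n \<and> j = 0 then 1 else 0 :: complex)" for x j :: nat
  have "markov n u = u"
    by (auto simp: markov_def u_def fun_eq_iff act_in)
  then have fix_u: "(markov n ^^ k) u = u" by (induction k) auto
  have "energy n u = real (card (V n))" by (simp add: energy_def u_def)
  then have norm_u: "vnorm (L2 n) u = 1" using finite_V V_nonempty by (simp add: vnorm_L2)
  have "u \<in> ?U" using norm_u by (simp add: carrier_L2 u_def)
  moreover have "bdd_above ((\<lambda>\<phi>. vnorm (L2 n) ((markov n ^^ k) \<phi>)) ` ?U)"
    using vnorm_markov_power by (intro bdd_aboveI[of _ 1]) (auto intro: order_trans)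
  ultimately have "vnorm (L2 n) ((markov n ^^ k) u) \<le> operator_norm (L2 n) (markov n ^^ k)"
    unfolding operator_norm_def by (rule cSUP_upper)
  then show ?thesis by (simp add: fix_u norm_u)
qed

text \<open>As \<open>c\<close> is fixed before \<open>R\<close>, the propagation \<open>k\<close>
  can be chosen with (8/9)^k below the square of \<open>c\<close>. The \<open>k\<close>-th power
  then shrinks every unit vector of support diameter at most \<open>S\<close> below
  \<open>c\<close>, although that power has norm at least 1.\<close>

lemma not_ONL: "\<not> ONL X hdist"
proof
  assume "ONL X hdist"
  then obtain c where c: "c > 0" and onl: "\<forall>R>0. \<exists>S>0. \<forall>\<mu>\<in>prob_measures X. \<forall>H :: (nat \<Rightarrow> complex) hilbert.
        separable_hilbert H \<and> vcarrier H \<noteq> {vzero H} \<longrightarrow>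
        (\<forall>T\<in>finite_prop_ops R X hdist \<mu> H. \<exists>\<phi>\<in>vcarrier (l2_space X \<mu> H).
           vnorm (l2_space X \<mu> H) \<phi> = 1 \<and>
           set_diam hdist (l2_supp \<mu> H \<phi>) \<le> ennreal S \<and>
           vnorm (l2_space X \<mu> H) (T \<phi>) \<ge> c * operator_norm (l2_space X \<mu> H) T)"
    unfolding ONL_def by (elim exE conjE) (rule that)
  obtain k0 where k0: "(8/9 :: real)^k0 < c\<^sup>2" using real_arch_pow_inv[of "c\<^sup>2" "8/9"] c by auto
  \<comment> \<open>The successor makes the propagation \<open>real k\<close> positive, as required
    of \<open>R\<close>.\<close>
  define k where "k = Suc k0"
  have k: "(8/9 :: real)^k < c\<^sup>2"
  proof -
    have "(8/9 :: real)^k \<le> (8/9)^k0" by (rule power_decreasing) (auto simp: k_def)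
    with k0 show ?thesis by linarith
  qed
  have k_pos: "real k > 0" by (simp add: k_def)
  obtain S where S: "S > 0" and onl': "\<forall>\<mu>\<in>prob_measures X. \<forall>H :: (nat \<Rightarrow> complex) hilbert.
        separable_hilbert H \<and> vcarrier H \<noteq> {vzero H} \<longrightarrow>
        (\<forall>T\<in>finite_prop_ops (real k) X hdist \<mu> H. \<exists>\<phi>\<in>vcarrier (l2_space X \<mu> H).
           vnorm (l2_space X \<mu> H) \<phi> = 1 \<and>
           set_diam hdist (l2_supp \<mu> H \<phi>) \<le> ennreal S \<and>
           vnorm (l2_space X \<mu> H) (T \<phi>) \<ge> c * operator_norm (l2_space X \<mu> H) T)"
    using onl[THEN spec, THEN mp, OF k_pos] by (elim exE conjE) (rule that)
  obtain n where n: "S + real k \<le> real n" using real_arch_simple by blast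
  have \<mu>: "pmf_of_set (V n) \<in> prob_measures X" using V_X by (simp add: prob_measures_def set_pmf_V)
  define e :: "nat \<Rightarrow> complex" where "e k = of_bool (k = 0)" for k
  have "e \<in> vcarrier cline" "e 0 \<noteq> vzero cline 0" by (simp_all add: cline_def e_def)
  then have ne: "vcarrier cline \<noteq> {vzero cline}" by auto
  obtain \<phi> where \<phi>: "\<phi> \<in> vcarrier (L2 n)" "vnorm (L2 n) \<phi> = 1"
    "set_diam hdist (l2_supp (pmf_of_set (V n)) cline \<phi>) \<le> ennreal S"
    "vnorm (L2 n) ((markov n ^^ k) \<phi>) \<ge> c * operator_norm (L2 n) (markov n ^^ k)"
    using onl'[THEN bspec, OF \<mu>, THEN spec, THEN mp, OF conjI[OF separable_cline ne],
        THEN bspec, OF markov_power_finite_prop] by (elim bexE conjE) (rule that)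
  have supp: "x \<in> l2_supp (pmf_of_set (V n)) cline \<phi>" if "x \<in> V n" "\<phi> x \<noteq> (\<lambda>j. 0)" for x
    using that finite_V V_nonempty by (simp add: l2_supp_def pmf_V vzero_cline card_gt_0_iff)
  have "\<exists>z\<in>V n. \<phi> z \<noteq> (\<lambda>j. 0)"
  proof (rule ccontr)
    assume "\<not> (\<exists>z\<in>V n. \<phi> z \<noteq> (\<lambda>j. 0))"
    then have "energy n \<phi> = 0" by (simp add: energy_def)
    with \<phi>(2) show False by (simp add: vnorm_L2)
  qed
  then obtain z where z: "z \<in> V n" "\<phi> z \<noteq> (\<lambda>j. 0)" by blast
  have "hdist x z \<le> S" if "x \<in> V n" "\<phi> x \<noteq> (\<lambda>j. 0)" for x
    using \<phi>(3) S supp[OF that] supp[OF z] by (simp add: set_diam_le_iff)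
  then have "energy n ((markov n ^^ k) \<phi>) \<le> (8/9)^k * energy n \<phi>"
    using z(1) n by (intro energy_markov_power_local[of z n \<phi> S])
  then have "energy n ((markov n ^^ k) \<phi>) / real (card (V n)) \<le> (8/9)^k * (energy n \<phi> / real (card (V n)))"
    by (simp add: divide_right_mono)
  also have "energy n \<phi> / real (card (V n)) = 1" using \<phi>(2) by (simp add: vnorm_L2)
  finally have "vnorm (L2 n) ((markov n ^^ k) \<phi>) \<le> sqrt ((8/9)^k)" by (simp add: vnorm_L2)
  also have "\<dots> < sqrt (c\<^sup>2)" using k by (rule real_sqrt_less_mono)
  also have "\<dots> = c" using c by simp
  finally have "vnorm (L2 n) ((markov n ^^ k) \<phi>) < c" .
  moreover have "c \<le> c * operator_norm (L2 n) (markov n ^^ k)"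
    using operator_norm_markov_power[of n k] c by simp
  ultimately show False using \<phi>(4) by linarith
qed

end

theorem corollary4p3:
  shows "(\<exists>(X :: nat set) d. bounded_geometry X d \<and> CE X d \<and> \<not> property_A X d) \<and>
         (\<exists>(X :: nat set) d. bounded_geometry X d \<and> CE X d \<and> \<not> ULA_mu X d) \<and>
         (\<exists>(X :: nat set) d. bounded_geometry X d \<and> CE X d \<and> \<not> ULA X d) \<and>
         (\<exists>(X :: nat set) d. bounded_geometry X d \<and> CE X d \<and> \<not> MSP X d) \<and>
         (\<exists>(X :: nat set) d. bounded_geometry X d \<and> CE X d \<and> \<not> ONL X d) \<and>
         ((\<forall>(X :: 'a set) d. bounded_geometry X d \<longrightarrow> ULA_mu X d \<longrightarrow> CE X d) \<and>
          \<not> (\<forall>(X :: nat set) d. bounded_geometry X d \<longrightarrow> CE X d \<longrightarrow> ULA_mu X d)) \<and>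
         ((\<forall>(X :: 'a set) d. bounded_geometry X d \<longrightarrow> property_A X d \<longrightarrow> CE X d) \<and>
          \<not> (\<forall>(X :: nat set) d. bounded_geometry X d \<longrightarrow> CE X d \<longrightarrow> property_A X d)) \<and>
         ((\<forall>(X :: 'a set) d. bounded_geometry X d \<longrightarrow> MSP X d \<longrightarrow> CE X d) \<and>
          \<not> (\<forall>(X :: nat set) d. bounded_geometry X d \<longrightarrow> CE X d \<longrightarrow> MSP X d))"
proof -
  \<comment> \<open>A single space is the witness for all five properties.\<close>
  obtain V act N where "cubic_tower V act N" using cubic_tower_exists by blast
  then interpret cubic_tower V act N .
  have "\<not> ULA_mu X hdist"
    using not_MSP ULA_mu_imp_MSP[OF Metric_space_hdist] by blast
  then have X: "bounded_geometry X hdist" "CE X hdist" "\<not> property_A X hdist" "\<not> ULA_mu X hdist"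
    "\<not> ULA X hdist" "\<not> MSP X hdist" "\<not> ONL X hdist"
    by (simp_all add: bounded_geometry_X CE_hdist not_property_A not_ULA not_MSP not_ONL)
  have imp: "bounded_geometry Y d \<Longrightarrow> ULA_mu Y d \<Longrightarrow> CE Y d" for Y :: "'a set" and d
    by (rule MSP_imp_CE) (auto intro: ULA_mu_imp_MSP bounded_geometry_metric)
  show ?thesis
    by (intro conjI allI impI notI; (rule imp property_A_imp_CE MSP_imp_CE; assumption)?)
      (use X in blast)+
qed

end
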